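(* There is an algorithm with the following guarantee. For any constant $\alpha > 0$, there exists a constant $c > 0$ such that if $k < c\sqrt{n}$ and $\widehat{x}$ is drawn from the Bernoulli model with parameter $k$, then the algorithm, given sample access to $x$, uses $O(k)$ samples, runs in time $O(k \log k)$, and returns exactly the vector $\widehat{x}$ with probability at least $1-\alpha$.
   Context: Let $n$ be such that $\sqrt{n}$ is a power of $2$, and write $[m] = \{0,\dots,m-1\}$. A signal is a matrix $x \in \mathbb{C}^{\sqrt{n}\times\sqrt{n}}$; its 2D discrete Fourier transform is $\widehat{x}_{i,j} = \frac{1}{\sqrt{n}}\sum_{l \in [\sqrt{n}]}\sum_{m \in [\sqrt{n}]} \omega^{il+jm} x_{l,m}$ with $\omega = e^{-2\pi \mathbf{i}/\sqrt{n}}$. A sample is the value of one entry $x_{l,m}$ queried by the algorithm. Bernoulli model with parameter $k$: there is a fixed (unknown, arbitrary) matrix of values $(a_{i,j})$ in $\mathbb{C}$; independently for each $(i,j) \in [\sqrt{n}]^2$, with probability $k/n$ the entry $\widehat{x}_{i,j}$ equals $a_{i,j}$, and otherwise $\widehat{x}_{i,j} = 0$. The probability is over the random support and the algorithm's randomness. *)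

theory Defs
  imports "HOL-Probability.Probability"
begin

section \<open>Signals and the two-dimensional Fourier transform\<close>

text \<open>
  An \<open>N \<times> N\<close> complex matrix is a function of a row and a column index, of which only the
  values at indices below \<open>N\<close> matter. The side length \<open>N\<close> is the square root of the signal size.
\<close>

type_synonym signal = "nat \<Rightarrow> nat \<Rightarrow> complex"

definition omega :: "nat \<Rightarrow> complex" where
  "omega N = exp (- (2 * of_real pi * \<i>) / of_nat N)"

definition dft2 :: "nat \<Rightarrow> signal \<Rightarrow> signal" where
  "dft2 N x = (\<lambda>i j. 1 / of_nat N * (\<Sum>l<N. \<Sum>m<N. omega N ^ (i * l + j * m) * x l m))"

definition idft2 :: "nat \<Rightarrow> signal \<Rightarrow> signal" where
  "idft2 N y = (\<lambda>l m. 1 / of_nat N * (\<Sum>i<N. \<Sum>j<N. inverse (omega N) ^ (i * l + j * m) * y i j))"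

lemma omega_neq_0: "omega N \<noteq> 0"
  by (simp add: omega_def)

lemma omega_power_eq_cis: "omega N ^ k = cis (- (2 * pi * real k / real N))"
proof -
  have "omega N = cis (- (2 * pi / real N))"
    by (simp add: omega_def cis_conv_exp mult_ac)
  then have "omega N ^ k = cis (real k * - (2 * pi / real N))"
    by (simp only: Complex.DeMoivre)
  then show ?thesis
    by (simp add: mult_ac)
qed

lemma omega_power_self: "N > 0 \<Longrightarrow> omega N ^ N = 1"
  by (simp add: omega_power_eq_cis cis.ctr one_complex.ctr)

lemma omega_power_neq_1:
  assumes "0 < k" "k < N"
  shows "omega N ^ k \<noteq> 1"
proof
  assume "omega N ^ k = 1"
  then have "cos (2 * pi * real k / real N) = 1"
    by (simp add: omega_power_eq_cis complex_eq_iff)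
  then obtain z :: int where "2 * pi * real k / real N = of_int z * 2 * pi"
    by (auto simp: cos_one_2pi_int)
  then have "real k / real N = of_int z"
    using pi_neq_zero by (metis mult.assoc mult.commute mult_cancel_left times_divide_eq_right
        zero_neq_numeral)
  moreover have "0 < real k / real N" "real k / real N < 1"
    using assms by auto
  ultimately show False
    by (metis of_int_0_less_iff of_int_less_1_iff zless_imp_add1_zle add_0 not_less)
qed

lemma omega_orthogonal:
  assumes "i < N" "i' < N"
  shows "(\<Sum>l<N. omega N ^ (i * l) * inverse (omega N) ^ (i' * l)) = (if i = i' then of_nat N else 0)"
proof -
  define z where "z = omega N ^ i * inverse (omega N) ^ i'"
  have sum_z: "(\<Sum>l<N. omega N ^ (i * l) * inverse (omega N) ^ (i' * l)) = (\<Sum>l<N. z ^ l)"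
    by (simp add: z_def power_mult power_mult_distrib)
  show ?thesis
  proof (cases "i = i'")
    case True
    then have "z = 1"
      by (simp add: z_def power_inverse omega_neq_0)
    then show ?thesis
      using True sum_z by simp
  next
    case False
    have "z \<noteq> 1"
    proof
      assume "z = 1"
      then have eq: "omega N ^ i = omega N ^ i'"
        using omega_neq_0[of N] by (simp add: z_def power_inverse field_simps)
      consider "i < i'" | "i' < i"
        using False by linarith
      then show False
      proof cases
        case 1
        have "omega N ^ (i' - i) = 1"
          using eq 1 omega_neq_0[of N] by (simp add: power_diff)
        then show False
          using omega_power_neq_1[of "i' - i" N] 1 assms by simp
      next
        case 2
        have "omega N ^ (i - i') = 1"
          using eq 2 omega_neq_0[of N] by (simp add: power_diff)
        then show False
          using omega_power_neq_1[of "i - i'" N] 2 assms by simp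
      qed
    qed
    moreover have "z ^ N = 1"
    proof -
      have "z ^ N = (omega N ^ N) ^ i * inverse (omega N ^ N) ^ i'"
        by (simp add: z_def power_mult_distrib power_inverse flip: power_mult)
           (simp add: mult.commute)
      then show ?thesis
        using assms by (simp add: omega_power_self)
    qed
    ultimately show ?thesis
      using False sum_z by (simp add: geometric_sum)
  qed
qed

lemma dft2_idft2:
  assumes "i < N" "j < N"
  shows "dft2 N (idft2 N y) i j = y i j"
proof -
  let ?w = "omega N" and ?v = "inverse (omega N)"
  have "dft2 N (idft2 N y) i j =
      1 / (of_nat N)\<^sup>2 * (\<Sum>l<N. \<Sum>m<N. \<Sum>a<N. \<Sum>b<N.
        (?w ^ (i * l) * ?v ^ (a * l)) * (?w ^ (j * m) * ?v ^ (b * m)) * y a b)"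
    by (simp add: dft2_def idft2_def sum_distrib_left power_add power2_eq_square mult_ac)
  also have "(\<Sum>l<N. \<Sum>m<N. \<Sum>a<N. \<Sum>b<N.
        (?w ^ (i * l) * ?v ^ (a * l)) * (?w ^ (j * m) * ?v ^ (b * m)) * y a b) =
      (\<Sum>l<N. \<Sum>a<N. \<Sum>m<N. \<Sum>b<N.
        (?w ^ (i * l) * ?v ^ (a * l)) * (?w ^ (j * m) * ?v ^ (b * m)) * y a b)"
    by (intro sum.cong refl sum.swap)
  also have "\<dots> = (\<Sum>a<N. \<Sum>l<N. \<Sum>b<N. \<Sum>m<N.
        (?w ^ (i * l) * ?v ^ (a * l)) * (?w ^ (j * m) * ?v ^ (b * m)) * y a b)"
    by (subst sum.swap) (intro sum.cong refl sum.swap)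
  also have "\<dots> = (\<Sum>a<N. \<Sum>b<N. \<Sum>l<N. \<Sum>m<N.
        (?w ^ (i * l) * ?v ^ (a * l)) * (?w ^ (j * m) * ?v ^ (b * m)) * y a b)"
    by (intro sum.cong refl sum.swap)
  also have "\<dots> = (\<Sum>a<N. \<Sum>b<N. (\<Sum>l<N. ?w ^ (i * l) * ?v ^ (a * l)) *
        (\<Sum>m<N. ?w ^ (j * m) * ?v ^ (b * m)) * y a b)"
    by (intro sum.cong refl, subst sum_product) (simp only: sum_distrib_right)
  also have "\<dots> = (\<Sum>a<N. \<Sum>b<N. (if i = a then of_nat N else 0) *
        (if j = b then of_nat N else 0) * y a b)"
    using assms by (intro sum.cong refl) (simp add: omega_orthogonal)
  also have "\<dots> = (\<Sum>a<N. \<Sum>b<N. if i = a then if j = b then (of_nat N)\<^sup>2 * y a b else 0 else 0)"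
    by (intro sum.cong refl) (simp add: power2_eq_square)
  also have "\<dots> = (\<Sum>a<N. if i = a then (\<Sum>b<N. if j = b then (of_nat N)\<^sup>2 * y a b else 0) else 0)"
    by (intro sum.cong refl) simp
  also have "\<dots> = (of_nat N)\<^sup>2 * y i j"
    using assms by simp
  finally show ?thesis
    using assms by simp
qed


section \<open>The Bernoulli model\<close>

text \<open>
  The parameter \<open>p\<close> is the probability of an entry being in the support. By the lemma \<open>dft2_idft2\<close>,
  \<open>idft2 N\<close> turns a spectrum into the signal having that spectrum.
\<close>

definition bernoulli_spectrum :: "nat \<Rightarrow> real \<Rightarrow> signal \<Rightarrow> signal pmf" where
  "bernoulli_spectrum N p a =
     map_pmf (\<lambda>b i j. if b (i, j) then a i j else 0)
       (Pi_pmf ({..<N} \<times> {..<N}) False (\<lambda>_. bernoulli_pmf p))"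

definition bernoulli_signal :: "nat \<Rightarrow> real \<Rightarrow> signal \<Rightarrow> signal pmf" where
  "bernoulli_signal N p a = map_pmf (idft2 N) (bernoulli_spectrum N p a)"


section \<open>Randomized random access machine with sample access\<close>

text \<open>
  Programs are finite texts in a while language over two random access memories, one holding
  machine words and one holding exact complex numbers. Words have \<open>4 log n = 8 log N\<close> bits, where
  \<open>n = N\<^sup>2\<close>; word arithmetic is modulo \<open>word_limit N\<close>, except that subtraction truncates at zero.
  Complex constants arise only by conversion of words and evaluation of roots of unity. The signal is accessible only
  through the instruction \<open>Sample\<close>.

  Every elementary instruction, every evaluation of a condition and every transition past a
  \<open>Skip\<close> costs one time unit. Expressions are part of the program text, so their size is bounded
  by a constant that does not depend on the input.
\<close>

datatype wexp =
    WConst nat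
  | WMem wexp
  | WAdd wexp wexp
  | WSub wexp wexp
  | WMul wexp wexp
  | WDiv wexp wexp
  | WMod wexp wexp

datatype cexp =
    CWord wexp
  | CMem wexp
  | CRoot wexp wexp
  | CAdd cexp cexp
  | CSub cexp cexp
  | CMul cexp cexp
  | CDiv cexp cexp

datatype bexp =
    WLess wexp wexp
  | CEq cexp cexp
  | CLess cexp cexp
  | BNot bexp
  | BAnd bexp bexp

datatype com =
    Skip
  | WStore wexp wexp
  | CStore wexp cexp
  | Phase wexp cexp wexp
  | Rand wexp wexp
  | Sample wexp wexp wexp
  | Emit wexp wexp cexp
  | Seq com com
  | Ite bexp com com
  | While bexp com

record state =
  wmem :: "nat \<Rightarrow> nat"
  cmem :: "nat \<Rightarrow> complex"
  samples :: nat
  out :: "((nat \<times> nat) \<times> complex) list"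

definition word_limit :: "nat \<Rightarrow> nat" where
  "word_limit N = N ^ 8"

primrec wval :: "nat \<Rightarrow> state \<Rightarrow> wexp \<Rightarrow> nat" where
  "wval W s (WConst v) = v mod W"
| "wval W s (WMem e) = wmem s (wval W s e)"
| "wval W s (WAdd e f) = (wval W s e + wval W s f) mod W"
| "wval W s (WSub e f) = wval W s e - wval W s f"
| "wval W s (WMul e f) = (wval W s e * wval W s f) mod W"
| "wval W s (WDiv e f) = wval W s e div wval W s f"
| "wval W s (WMod e f) = wval W s e mod wval W s f"

primrec cval :: "nat \<Rightarrow> state \<Rightarrow> cexp \<Rightarrow> complex" where
  "cval W s (CWord e) = of_nat (wval W s e)"
| "cval W s (CMem e) = cmem s (wval W s e)"
| "cval W s (CRoot e f) = omega (wval W s f) ^ wval W s e"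
| "cval W s (CAdd e f) = cval W s e + cval W s f"
| "cval W s (CSub e f) = cval W s e - cval W s f"
| "cval W s (CMul e f) = cval W s e * cval W s f"
| "cval W s (CDiv e f) = cval W s e / cval W s f"

primrec bval :: "nat \<Rightarrow> state \<Rightarrow> bexp \<Rightarrow> bool" where
  "bval W s (WLess e f) \<longleftrightarrow> wval W s e < wval W s f"
| "bval W s (CEq e f) \<longleftrightarrow> cval W s e = cval W s f"
| "bval W s (CLess e f) \<longleftrightarrow> Re (cval W s e) < Re (cval W s f)"
| "bval W s (BNot b) \<longleftrightarrow> \<not> bval W s b"
| "bval W s (BAnd b b') \<longleftrightarrow> bval W s b \<and> bval W s b'"

text \<open>The index of the \<open>q\<close>-th root of unity \<open>exp (2 \<pi> \<i> r / q)\<close> whose direction is nearest to \<open>z\<close>.\<close>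

definition phase_index :: "nat \<Rightarrow> complex \<Rightarrow> nat" where
  "phase_index q z = nat (round (Arg z * real q / (2 * pi)) mod int q)"

definition rand_word :: "nat \<Rightarrow> nat pmf" where
  "rand_word b = (if b = 0 then return_pmf 0 else pmf_of_set {..<b})"

definition query :: "nat \<Rightarrow> signal \<Rightarrow> nat \<Rightarrow> nat \<Rightarrow> complex" where
  "query N x l m = (if l < N \<and> m < N then x l m else 0)"

primrec step :: "nat \<Rightarrow> signal \<Rightarrow> com \<Rightarrow> state \<Rightarrow> (com \<times> state) pmf" where
  "step N x Skip s = return_pmf (Skip, s)"
| "step N x (WStore e f) s = (let W = word_limit N in
     return_pmf (Skip, s\<lparr>wmem := (wmem s)(wval W s e := wval W s f)\<rparr>))"
| "step N x (CStore e f) s = (let W = word_limit N in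
     return_pmf (Skip, s\<lparr>cmem := (cmem s)(wval W s e := cval W s f)\<rparr>))"
| "step N x (Phase e f g) s = (let W = word_limit N in
     return_pmf (Skip, s\<lparr>wmem := (wmem s)(wval W s e := phase_index (wval W s g) (cval W s f))\<rparr>))"
| "step N x (Rand e f) s = (let W = word_limit N in
     map_pmf (\<lambda>r. (Skip, s\<lparr>wmem := (wmem s)(wval W s e := r)\<rparr>)) (rand_word (wval W s f)))"
| "step N x (Sample e f g) s = (let W = word_limit N in
     return_pmf (Skip, s\<lparr>cmem := (cmem s)(wval W s e := query N x (wval W s f) (wval W s g)),
                         samples := Suc (samples s)\<rparr>))"
| "step N x (Emit e f g) s = (let W = word_limit N in
     return_pmf (Skip, s\<lparr>out := ((wval W s e, wval W s f), cval W s g) # out s\<rparr>))"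
| "step N x (Seq c d) s =
     (if c = Skip then return_pmf (d, s)
      else map_pmf (\<lambda>(c', s'). (Seq c' d, s')) (step N x c s))"
| "step N x (Ite b c d) s = return_pmf (if bval (word_limit N) s b then c else d, s)"
| "step N x (While b c) s =
     return_pmf (if bval (word_limit N) s b then Seq c (While b c) else Skip, s)"

primrec run :: "nat \<Rightarrow> signal \<Rightarrow> nat \<Rightarrow> com \<times> state \<Rightarrow> (com \<times> state) pmf" where
  "run N x 0 cf = return_pmf cf"
| "run N x (Suc t) cf = bind_pmf (step N x (fst cf) (snd cf)) (run N x t)"

text \<open>
  The input consists of \<open>N\<close> and \<open>k\<close> as words and the failure probability \<open>\<alpha>\<close> as a complex number.
  All other memory cells are zero.
\<close>

definition init_state :: "nat \<Rightarrow> nat \<Rightarrow> real \<Rightarrow> state" where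
  "init_state N k \<alpha> = \<lparr>wmem = (\<lambda>_. 0)(0 := N, 1 := k), cmem = (\<lambda>_. 0)(0 := of_real \<alpha>),
     samples = 0, out = []\<rparr>"

text \<open>The output is a sparse matrix: a list of entries at distinct positions, all others being zero.\<close>

definition represents :: "nat \<Rightarrow> ((nat \<times> nat) \<times> complex) list \<Rightarrow> signal \<Rightarrow> bool" where
  "represents N es y \<longleftrightarrow>
     distinct (map fst es) \<and>
     fst ` set es \<subseteq> {..<N} \<times> {..<N} \<and>
     (\<forall>i<N. \<forall>j<N. y i j = (case map_of es (i, j) of None \<Rightarrow> 0 | Some v \<Rightarrow> v))"

definition halts_within :: "com \<Rightarrow> nat \<Rightarrow> nat \<Rightarrow> real \<Rightarrow> signal \<Rightarrow> nat \<Rightarrow> bool" where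
  "halts_within P N k \<alpha> x t \<longleftrightarrow>
     (\<forall>(c, s) \<in> set_pmf (run N x t (P, init_state N k \<alpha>)). c = Skip)"

definition uses_samples_within :: "com \<Rightarrow> nat \<Rightarrow> nat \<Rightarrow> real \<Rightarrow> signal \<Rightarrow> nat \<Rightarrow> real \<Rightarrow> bool" where
  "uses_samples_within P N k \<alpha> x t q \<longleftrightarrow>
     (\<forall>(c, s) \<in> set_pmf (run N x t (P, init_state N k \<alpha>)). real (samples s) \<le> q)"

text \<open>
  The joint distribution of a random signal and the output after \<open>t\<close> steps. The machine's
  randomness is independent of the signal, on which it depends only through the samples.
\<close>

definition joint_outcome ::
    "com \<Rightarrow> nat \<Rightarrow> nat \<Rightarrow> real \<Rightarrow> nat \<Rightarrow> signal pmf \<Rightarrow> (signal \<times> ((nat \<times> nat) \<times> complex) list) pmf" where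
  "joint_outcome P N k \<alpha> t D =
     bind_pmf D (\<lambda>x. map_pmf (\<lambda>(c, s). (x, out s)) (run N x t (P, init_state N k \<alpha>)))"

end

theory Submission
  imports Defs
begin

text \<open>
  The algorithm is deterministic. Let \<open>B\<close> be the least power of two with \<open>\<alpha> B \<ge> 8 k\<close>. The DFT of
  size \<open>B\<close> of the samples with spacing \<open>N / B\<close> on a line parallel to an axis hashes the spectrum
  into \<open>B\<close> buckets, according to the residue modulo \<open>B\<close> of one of the two coordinates, and
  translating the line multiplies every coefficient by a root of unity that encodes its position.
  The support thus becomes a random bipartite multigraph with \<open>2 B\<close> vertices (row and column buckets)
  and about \<open>k \<le> \<alpha> B / 8\<close> edges. It is acyclic except with probability of order \<open>(k / B)\<^sup>2\<close>, and then
  it can be decoded by repeatedly removing the edge at a vertex of degree one.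

  A bucket is taken for a singleton if its values at the shifts 0, 1, 2, 3 form a geometric
  progression. If a minimal set of at least two points in a bucket passes this test, then, by the linear
  independence of four nodes on four shifts, all its points but one determine the last point up to two
  choices of one coordinate, whatever the coefficients are. So a union bound over all subsets of all
  buckets bounds the probability of a wrong decision by a multiple of \<open>k / N\<close>.
\<close>

section \<open>Executions of the machine\<close>

text \<open>The values \<open>a\<close> are adversarial: several coefficients may be tuned so that
  together they imitate one. The error must therefore be paid by the random positions alone, and
  collisions are counted for a fixed matrix of values. The number four comes from comparing two
  disguises of the same points: each contributes the node of an added point and the node of the
  imitation. A fifth translation, one step along the line, reads the coordinate of which a bucket
  shows only the residue.

  What is left of a bucket when it is examined depends on the history of the peeling. Demanding a
  correct test for all subsets removes this dependence; it is affordable because a bucket holds on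
  average k / B \<le> \<alpha> / 8 points, so that the sum over subsets stays bounded. Pairs with
  equal nodes escape the algebra, but they are double edges and belong to the cycle bound.

  Time and sample bounds are worst case over all signals, whereas correctness holds for good
  supports only; the invariants of the program separate the two.\<close>

lemma run_Skip: "run N x t (Skip, s) = return_pmf (Skip, s)"
  by (induction t) (simp_all add: bind_return_pmf)

lemma run_add: "run N x (t + u) cf = bind_pmf (run N x t cf) (run N x u)"
proof (induction t arbitrary: cf)
  case (Suc t)
  then have "run N x (t + u) = (\<lambda>cf. bind_pmf (run N x t cf) (run N x u))"
    by blast
  then show ?case by (simp add: bind_assoc_pmf)
qed (simp add: bind_return_pmf)

lemma run_halted_mono:
  assumes "run N x t cf = return_pmf (Skip, s)" "t \<le> u"
  shows "run N x u cf = return_pmf (Skip, s)"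
proof -
  have "run N x (t + (u - t)) cf = return_pmf (Skip, s)"
    unfolding run_add assms(1) by (simp add: bind_return_pmf run_Skip)
  then show ?thesis using assms(2) by simp
qed

lemma bind_pmf_eq_return:
  assumes "bind_pmf M f = return_pmf v" "y \<in> set_pmf M"
  shows "f y = return_pmf v"
proof -
  have "set_pmf (f y) \<subseteq> {v}"
    using assms by (metis UN_upper set_bind_pmf set_return_pmf)
  then show ?thesis by (simp add: set_pmf_subset_singleton)
qed

text \<open>A halted configuration stays put, so steps that \<open>c\<close> does not use can be
  moved behind \<open>d\<close>, and budgets may exceed the actual running time. The extra unit pays
  for the transition past \<open>Skip\<close>.\<close>

lemma run_Seq:
  assumes "run N x t (c, s) = return_pmf (Skip, s1)"
    and "run N x u (d, s1) = return_pmf (Skip, s2)"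
  shows "run N x (t + 1 + u) (Seq c d, s) = return_pmf (Skip, s2)"
  using assms(1)
proof (induction t arbitrary: c s)
  case 0
  then have "c = Skip" "s = s1" by auto
  then show ?case using assms(2) by (simp add: bind_return_pmf)
next
  case (Suc t)
  show ?case
  proof (cases "c = Skip")
    case True
    then have "s = s1" using Suc.prems run_Skip[of N x "Suc t" s] by simp
    then show ?thesis
      using True run_halted_mono[OF assms(2), of "Suc t + u"] by (simp add: bind_return_pmf)
  next
    case False
    have "run N x t cf = return_pmf (Skip, s1)" if "cf \<in> set_pmf (step N x c s)" for cf
      using bind_pmf_eq_return[OF _ that] Suc.prems by simp
    then have "run N x (t + 1 + u) (Seq (fst cf) d, snd cf) = return_pmf (Skip, s2)"
      if "cf \<in> set_pmf (step N x c s)" for cf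
      using Suc.IH[of "fst cf" "snd cf"] that by simp
    then have "run N x (Suc (t + 1 + u)) (Seq c d, s)
        = bind_pmf (step N x c s) (\<lambda>_. return_pmf (Skip, s2))"
      unfolding run.simps(2) fst_conv snd_conv step.simps if_not_P[OF False] bind_map_pmf
        case_prod_unfold by (rule bind_pmf_cong[OF refl])
    then show ?thesis by simp
  qed
qed

text \<open>A total-correctness triple for runs whose final distribution is a point mass. The time
  \<open>T\<close> is an upper bound, which lets branches of different lengths share one
  budget.\<close>

definition wp :: "nat \<Rightarrow> signal \<Rightarrow> com \<Rightarrow> nat \<Rightarrow> (state \<Rightarrow> bool) \<Rightarrow> state \<Rightarrow> bool" where
  "wp N x c T Q s \<longleftrightarrow> (\<exists>s'. run N x T (c, s) = return_pmf (Skip, s') \<and> Q s')"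

lemma wp_mono:
  assumes "wp N x c T Q s" "T \<le> T'" "\<And>s'. Q s' \<Longrightarrow> Q' s'"
  shows "wp N x c T' Q' s"
  using assms run_halted_mono unfolding wp_def by blast

lemma wp_Seq:
  assumes "wp N x c T Q s" "\<And>s'. Q s' \<Longrightarrow> wp N x d U R s'" "T + 1 + U \<le> V"
  shows "wp N x (Seq c d) V R s"
proof -
  obtain s1 where s1: "run N x T (c, s) = return_pmf (Skip, s1)" "Q s1"
    using assms(1) by (auto simp: wp_def)
  then obtain s2 where "run N x U (d, s1) = return_pmf (Skip, s2)" "R s2"
    using assms(2) by (auto simp: wp_def)
  with run_Seq[OF s1(1)] have "wp N x (Seq c d) (T + 1 + U) R s"
    by (auto simp: wp_def)
  then show ?thesis by (rule wp_mono) (use assms in auto)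
qed

text \<open>The invariant is indexed by the number of completed iterations. An iteration costs its
  body plus two units, for the test and for leaving \<open>Skip\<close>; the last unit is the
  failing test.\<close>

lemma wp_While:
  assumes step: "\<And>i s. i < n \<Longrightarrow> I i s \<Longrightarrow> bval (word_limit N) s b \<and> wp N x c T (I (Suc i)) s"
    and stop: "\<And>s. I n s \<Longrightarrow> \<not> bval (word_limit N) s b"
    and "I 0 s" "n * (T + 2) + 1 \<le> V"
  shows "wp N x (While b c) V (I n) s"
proof -
  have "wp N x (While b c) ((n - i) * (T + 2) + 1) (I n) s" if "i \<le> n" "I i s" for i s
    using that
  proof (induction i arbitrary: s rule: inc_induct)
    case base
    then show ?case using stop[OF base] by (auto simp: wp_def bind_return_pmf run_Skip)
  next
    case (step m)
    have b: "bval (word_limit N) s b" and w: "wp N x c T (I (Suc m)) s"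
      using assms(1)[of m s] step by auto
    have "wp N x (Seq c (While b c)) (T + 1 + ((n - Suc m) * (T + 2) + 1)) (I n) s"
      by (rule wp_Seq[OF w]) (use step.IH in auto)
    then have "wp N x (While b c) (Suc (T + 1 + ((n - Suc m) * (T + 2) + 1))) (I n) s"
      using b by (simp add: wp_def bind_return_pmf)
    moreover have "Suc (T + 1 + ((n - Suc m) * (T + 2) + 1)) = (n - m) * (T + 2) + 1"
      using step(2) by (simp add: Suc_diff_Suc[symmetric])
    ultimately show ?case by simp
  qed
  from this[of 0] assms have "wp N x (While b c) (n * (T + 2) + 1) (I n) s" by simp
  then show ?thesis by (rule wp_mono) (use assms in auto)
qed

section \<open>Loop-free deterministic programs as functions on states\<close>

primrec straight :: "com \<Rightarrow> bool" where
  "straight Skip \<longleftrightarrow> True"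
| "straight (WStore e f) \<longleftrightarrow> True"
| "straight (CStore e f) \<longleftrightarrow> True"
| "straight (Phase e f g) \<longleftrightarrow> True"
| "straight (Rand e f) \<longleftrightarrow> False"
| "straight (Sample e f g) \<longleftrightarrow> True"
| "straight (Emit e f g) \<longleftrightarrow> True"
| "straight (Seq c d) \<longleftrightarrow> straight c \<and> straight d"
| "straight (Ite b c d) \<longleftrightarrow> straight c \<and> straight d"
| "straight (While b c) \<longleftrightarrow> False"

text \<open>A conditional is charged for both branches, which gives a bound independent of the
  state.\<close>

primrec straight_time :: "com \<Rightarrow> nat" where
  "straight_time Skip = 1"
| "straight_time (WStore e f) = 1"
| "straight_time (CStore e f) = 1"
| "straight_time (Phase e f g) = 1"
| "straight_time (Rand e f) = 1"
| "straight_time (Sample e f g) = 1"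
| "straight_time (Emit e f g) = 1"
| "straight_time (Seq c d) = straight_time c + 1 + straight_time d"
| "straight_time (Ite b c d) = Suc (straight_time c + straight_time d)"
| "straight_time (While b c) = 1"

primrec exec :: "nat \<Rightarrow> signal \<Rightarrow> com \<Rightarrow> state \<Rightarrow> state" where
  "exec N x Skip s = s"
| "exec N x (WStore e f) s = (let W = word_limit N in
     s\<lparr>wmem := (wmem s)(wval W s e := wval W s f)\<rparr>)"
| "exec N x (CStore e f) s = (let W = word_limit N in
     s\<lparr>cmem := (cmem s)(wval W s e := cval W s f)\<rparr>)"
| "exec N x (Phase e f g) s = (let W = word_limit N in
     s\<lparr>wmem := (wmem s)(wval W s e := phase_index (wval W s g) (cval W s f))\<rparr>)"
| "exec N x (Rand e f) s = s"
| "exec N x (Sample e f g) s = (let W = word_limit N in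
     s\<lparr>cmem := (cmem s)(wval W s e := query N x (wval W s f) (wval W s g)),
       samples := Suc (samples s)\<rparr>)"
| "exec N x (Emit e f g) s = (let W = word_limit N in
     s\<lparr>out := ((wval W s e, wval W s f), cval W s g) # out s\<rparr>)"
| "exec N x (Seq c d) s = exec N x d (exec N x c s)"
| "exec N x (Ite b c d) s = (if bval (word_limit N) s b then exec N x c s else exec N x d s)"
| "exec N x (While b c) s = s"

lemma run_straight:
  "straight c \<Longrightarrow> run N x (straight_time c) (c, s) = return_pmf (Skip, exec N x c s)"
proof (induction c arbitrary: s)
  case (Seq c d)
  then show ?case using run_Seq[of N x "straight_time c" c s] by simp
next
  case (Ite b c d)
  then have c: "run N x (straight_time c) (c, s) = return_pmf (Skip, exec N x c s)"
    and d: "run N x (straight_time d) (d, s) = return_pmf (Skip, exec N x d s)"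
    by simp_all
  note run_halted_mono[OF c, of "straight_time c + straight_time d"]
    run_halted_mono[OF d, of "straight_time c + straight_time d"]
  then show ?case by (simp add: bind_return_pmf)
qed (simp_all add: bind_return_pmf Let_def)

lemma wp_straight:
  assumes "straight c" "straight_time c \<le> T" "Q (exec N x c s)"
  shows "wp N x c T Q s"
  using wp_mono[of N x c "straight_time c" Q s T Q] run_straight[OF assms(1)] assms
  by (auto simp: wp_def)

section \<open>Fourier transforms on lines\<close>

lemma inverse_omega_power: "inverse (omega N) ^ k = cis (2 * pi * real k / real N)"
  by (simp add: power_inverse omega_power_eq_cis)

lemma inverse_omega_power_inj:
  assumes "i < N" "j < N" "inverse (omega N) ^ i = inverse (omega N) ^ j"
  shows "i = j"
proof -
  have *: False if "a < b" "b < N" "omega N ^ a = omega N ^ b" for a b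
  proof -
    have "omega N ^ (b - a) = 1"
      using that omega_neq_0[of N] by (simp add: power_diff)
    then show False
      using omega_power_neq_1[of "b - a" N] that by simp
  qed
  from assms(3) have "omega N ^ i = omega N ^ j"
    by (simp add: power_inverse)
  then show ?thesis
    using *[of i j] *[of j i] assms(1,2) by (metis nat_neq_iff)
qed

text \<open>The argument is known only up to full turns. After scaling by q / (2 pi) it is exactly
  \<open>j\<close> plus a multiple of \<open>q\<close>, so rounding changes nothing and the
  reduction modulo \<open>q\<close> removes the choice of branch.\<close>

lemma phase_index_inverse_omega:
  assumes "j < q"
  shows "phase_index q (inverse (omega q) ^ j) = j"
proof -
  define z where "z = inverse (omega q) ^ j"
  have q: "real q > 0" using assms by simp
  have "cis (Arg z) = z"
    using cis_Arg[of z] unfolding z_def inverse_omega_power by simp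
  then have "cis (Arg z - 2 * pi * real j / real q) = 1"
    unfolding cis_divide[symmetric] by (simp add: z_def inverse_omega_power)
  then have "cos (Arg z - 2 * pi * real j / real q) = 1"
    by (metis Re_complex_of_real cis.simps(1) of_real_1)
  then obtain n :: int where "Arg z - 2 * pi * real j / real q = of_int n * 2 * pi"
    by (auto simp: cos_one_2pi_int)
  then have "Arg z * real q / (2 * pi) = of_int (int j + n * int q)"
    using q by (simp add: field_simps)
  then have "round (Arg z * real q / (2 * pi)) = int j + n * int q"
    by (simp only: round_of_int)
  then show ?thesis
    using assms by (simp add: phase_index_def z_def[symmetric])
qed

section \<open>Aliasing and the radix-two Fourier transform\<close>

lemma omega_power_mod: "N > 0 \<Longrightarrow> omega N ^ (k mod N) = omega N ^ k"
  by (metis mult_div_mod_eq omega_power_self power_add power_mult power_one mult_1)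

text \<open>Spacing N / B turns N-th roots of unity into B-th roots; this is the source of the
  hashing by residues modulo \<open>B\<close>.\<close>

lemma omega_power_dvd:
  assumes "B dvd N" "N > 0"
  shows "omega N ^ (k * (N div B)) = omega B ^ k"
proof -
  have "real (N div B) = real N / real B" "B > 0"
    using assms by (auto simp: real_of_nat_div intro: dvd_pos_nat)
  then show ?thesis
    using assms by (simp add: omega_power_eq_cis mult.assoc)
qed

lemma omega_orthogonal_mod:
  assumes "r < B"
  shows "(\<Sum>l<B. omega B ^ (r * l) * inverse (omega B) ^ (i * l)) =
    (if i mod B = r then of_nat B else 0)"
proof -
  have "omega B ^ (i * l) = omega B ^ (i mod B * l)" for l
    using omega_power_mod[of B i] assms by (simp add: power_mult)
  then show ?thesis
    using omega_orthogonal[of r B "i mod B"] assms by (auto simp: power_inverse)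
qed

text \<open>With \<open>i = h * f + r\<close>, \<open>r < h\<close> and \<open>h\<close> dividing
  \<open>B\<close>, this is entry \<open>f\<close> of the DFT of length \<open>B div h\<close> of
  the subsequence at r, r + h, r + 2 h, and so on. Level \<open>B\<close> is the input and level 1
  the full transform. Packing frequency and offset into one index is the Stockham order, which
  avoids bit reversal.\<close>

definition fft_level :: "nat \<Rightarrow> (nat \<Rightarrow> complex) \<Rightarrow> nat \<Rightarrow> nat \<Rightarrow> complex" where
  "fft_level B y h i = (\<Sum>q<B div h. omega B ^ ((i - i mod h) * q) * y (i mod h + h * q))"

lemma fft_level_top: "i < B \<Longrightarrow> fft_level B y B i = y i"
  by (simp add: fft_level_def)

lemma fft_level_bottom: "fft_level B y (Suc 0) i = (\<Sum>q<B. omega B ^ (i * q) * y q)"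
  by (simp add: fft_level_def)

lemma sum_even_odd: "(\<Sum>q<2 * n. f q) = (\<Sum>q<n. f (2 * q) + f (2 * q + 1))"
  for f :: "nat \<Rightarrow> 'a::comm_monoid_add"
  by (induction n) (simp_all add: add_ac)

text \<open>The butterfly: even and odd members of a subsequence are the subsequences of step
  \<open>2 * h\<close> with offsets \<open>r\<close> and \<open>r + h\<close>. Their frequencies
  wrap around modulo \<open>B div (2 * h)\<close>, which in the packed index is a reduction of
  \<open>2 * (i - r)\<close> modulo \<open>B\<close>.\<close>

lemma fft_level_step:
  fixes B h i :: nat
  assumes "2 * h dvd B" "h > 0" "B > 0"
  defines "r \<equiv> i mod h"
  defines "i' \<equiv> (2 * (i - r)) mod B + r"
  shows "fft_level B y h i =
    fft_level B y (2 * h) i' + omega B ^ (i - r) * fft_level B y (2 * h) (i' + h)"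
    and "i < B \<Longrightarrow> i' + h < B"
proof -
  obtain m where m: "B = 2 * h * m" using assms(1) by auto
  have rh: "r < h" using assms by simp
  have hd: "2 * h dvd (2 * (i - r)) mod B"
    using assms(1) by (simp add: dvd_mod r_def minus_mod_eq_mult_div)
  then obtain c where c: "(2 * (i - r)) mod B = 2 * h * c" by auto
  have mod1: "i' mod (2 * h) = r" and mod2: "(i' + h) mod (2 * h) = r + h"
    unfolding i'_def c using rh by (simp_all add: mod_mult_self4 add.assoc)
  have diff: "i' - r = 2 * h * c" "i' + h - (r + h) = 2 * h * c"
    by (simp_all add: i'_def c)
  have tw: "omega B ^ (2 * h * c * q) = omega B ^ ((i - r) * (2 * q))" for q
  proof -
    have "omega B ^ (2 * h * c * q) = (omega B ^ (2 * (i - r) mod B)) ^ q"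
      by (simp only: c power_mult)
    also have "\<dots> = omega B ^ (2 * (i - r) * q)"
      using assms(3) by (simp only: omega_power_mod power_mult)
    finally show ?thesis by (simp only: mult.assoc mult.left_commute)
  qed
  have "fft_level B y h i = (\<Sum>q<2 * m. omega B ^ ((i - r) * q) * y (r + h * q))"
    using assms(2) by (simp add: fft_level_def m r_def)
  also have "\<dots> = (\<Sum>q<m. omega B ^ (2 * h * c * q) * y (r + 2 * h * q)
      + omega B ^ (i - r) * (omega B ^ (2 * h * c * q) * y (r + h + 2 * h * q)))"
    unfolding sum_even_odd tw by (intro sum.cong refl) (simp add: power_add algebra_simps)
  also have "\<dots> = fft_level B y (2 * h) i' + omega B ^ (i - r) * fft_level B y (2 * h) (i' + h)"
    using assms(2) unfolding fft_level_def mod1 mod2 diff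
    by (simp add: m sum.distrib sum_distrib_left)
  finally show "fft_level B y h i =
    fft_level B y (2 * h) i' + omega B ^ (i - r) * fft_level B y (2 * h) (i' + h)" .
  have "2 * h * c < 2 * h * m"
    using c m assms(3) by (metis mod_less_divisor)
  then have "c + 1 \<le> m" using assms by auto
  then have "2 * h * (c + 1) \<le> B" using m by (metis mult_le_mono2)
  then show "i' + h < B"
    using rh by (simp add: i'_def c)
qed

section \<open>Buckets as aliased sums over the spectrum\<close>

definition own :: "bool \<Rightarrow> nat \<times> nat \<Rightarrow> nat" where
  "own t p = (if t then snd p else fst p)"

definition bucket :: "nat \<Rightarrow> bool \<times> nat \<Rightarrow> (nat \<times> nat) set" where
  "bucket B b = {p. own (fst b) p mod B = snd b}"

text \<open>Two translations are packed into \<open>s\<close>: by \<open>s mod 4\<close> across the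
  line and by \<open>s div 4\<close> along it. Shifts 0 to 3 give the powers 0 to 3 of one node,
  which encodes the cross coordinate; shift 4 is a single step along the line and encodes the other
  coordinate, beyond its residue.\<close>

definition shift_factor :: "nat \<Rightarrow> bool \<Rightarrow> nat \<Rightarrow> nat \<times> nat \<Rightarrow> complex" where
  "shift_factor N t s p = inverse (omega N) ^ (own t p * (s div 4) + own (\<not> t) p * (s mod 4))"

definition line_sample :: "nat \<Rightarrow> nat \<Rightarrow> signal \<Rightarrow> bool \<Rightarrow> nat \<Rightarrow> nat \<Rightarrow> complex" where
  "line_sample N B x t s l =
    (let u = l * (N div B) + s div 4; v = s mod 4 in if t then query N x v u else query N x u v)"

definition bucket_sum ::
    "nat \<Rightarrow> nat \<Rightarrow> signal \<Rightarrow> (nat \<times> nat) set \<Rightarrow> bool \<times> nat \<Rightarrow> nat \<Rightarrow> complex" where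
  "bucket_sum N B y T b s = (\<Sum>p\<in>T \<inter> bucket B b.
     of_nat B / of_nat N * y (fst p) (snd p) * shift_factor N (fst b) s p)"

lemma idft2_eq_own:
  "(if t then idft2 N y v u else idft2 N y u v) = 1 / of_nat N *
    (\<Sum>p\<in>{..<N} \<times> {..<N}. inverse (omega N) ^ (own t p * u + own (\<not> t) p * v) * y (fst p) (snd p))"
  by (simp add: idft2_def own_def sum.cartesian_product' add.commute)

lemma fourier_line_sample:
  assumes B: "B dvd N" "2 * B \<le> N" "3 < N" and r: "r < B" and s: "s < 5"
  shows "(\<Sum>l<B. omega B ^ (r * l) * line_sample N B (idft2 N y) t s l) =
    bucket_sum N B y ({..<N} \<times> {..<N}) (t, r) s"
proof -
  define M where "M = N div B"
  let ?D = "{..<N} \<times> {..<N}"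
  have N: "N = B * M" using B by (simp add: M_def)
  \<comment> \<open>Spacing at least two leaves room behind the last sample for the translate by one
    step along the line.\<close>
  have M: "2 \<le> M"
  proof -
    have "B * 2 \<le> B * M" using B(2) N by linarith
    then show ?thesis using r by simp
  qed
  have u: "l * M + s div 4 < N" if "l < B" for l
  proof -
    have "(l + 1) * M \<le> B * M" using that by (intro mult_le_mono1) simp
    then show ?thesis using s M N by simp
  qed
  have smp: "line_sample N B (idft2 N y) t s l = 1 / of_nat N *
     (\<Sum>p\<in>?D. inverse (omega B) ^ (own t p * l) * (shift_factor N t s p * y (fst p) (snd p)))"
    if "l < B" for l
  proof -
    have "line_sample N B (idft2 N y) t s l =
      (if t then idft2 N y (s mod 4) (l * M + s div 4) else idft2 N y (l * M + s div 4) (s mod 4))"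
      using u[OF that] s B(3) by (auto simp: line_sample_def Let_def query_def M_def[symmetric])
    also have "\<dots> = 1 / of_nat N *
     (\<Sum>p\<in>?D. inverse (omega B) ^ (own t p * l) * (shift_factor N t s p * y (fst p) (snd p)))"
    proof -
      have "inverse (omega N) ^ (a * (l * M)) = inverse (omega B) ^ (a * l)" for a
        using omega_power_dvd[of B N "a * l"] B by (simp add: power_inverse M_def mult.assoc)
      then have "inverse (omega N) ^ (own t p * (l * M + s div 4) + own (\<not> t) p * (s mod 4)) =
          inverse (omega B) ^ (own t p * l) * shift_factor N t s p" for p
        by (simp only: shift_factor_def distrib_left power_add mult.assoc)
      then show ?thesis
        by (simp only: idft2_eq_own mult.assoc)
    qed
    finally show ?thesis .
  qed
  have "(\<Sum>l<B. omega B ^ (r * l) * line_sample N B (idft2 N y) t s l) =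
    (\<Sum>l<B. \<Sum>p\<in>?D. omega B ^ (r * l) * inverse (omega B) ^ (own t p * l) *
      (1 / of_nat N * shift_factor N t s p * y (fst p) (snd p)))"
    by (intro sum.cong refl) (simp add: smp sum_distrib_left mult.left_commute mult.assoc
        del: power_inverse)
  also have "\<dots> = (\<Sum>p\<in>?D. (\<Sum>l<B. omega B ^ (r * l) * inverse (omega B) ^ (own t p * l)) *
      (1 / of_nat N * shift_factor N t s p * y (fst p) (snd p)))"
    by (subst sum.swap) (simp only: sum_distrib_right)
  also have "\<dots> = (\<Sum>p\<in>?D. if p \<in> bucket B (t, r) then
      of_nat B / of_nat N * y (fst p) (snd p) * shift_factor N t s p else 0)"
    unfolding omega_orthogonal_mod[OF r] by (intro sum.cong refl) (simp add: bucket_def)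
  also have "\<dots> = bucket_sum N B y ?D (t, r) s"
    unfolding bucket_sum_def fst_conv by (rule sum.inter_restrict[symmetric]) simp
  finally show ?thesis .
qed

section \<open>Peeling\<close>

text \<open>Every nonempty set of edges has a leaf, so the multigraph is a forest. Quantifying over
  subsets makes the property survive every removal.\<close>

definition peelable :: "nat \<Rightarrow> (nat \<times> nat) set \<Rightarrow> bool" where
  "peelable B S \<longleftrightarrow> (\<forall>T\<subseteq>S. T \<noteq> {} \<longrightarrow> (\<exists>b p. T \<inter> bucket B b = {p}))"

text \<open>A forest has at most as many edges as vertices: removing an edge at a leaf also removes
  that leaf from the touched vertices. The bound later limits the number of successful
  rounds.\<close>

lemma peelable_card:
  assumes "peelable B S" "finite S" "B > 0"
  shows "card S \<le> 2 * B"
proof -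
  define touched where "touched T = (\<Union>t. (\<lambda>p. (t, own t p mod B)) ` T)" for T
  have fin: "finite (touched T)" if "finite T" for T
    using that by (simp add: touched_def)
  have "card T \<le> card (touched T)" if "finite T" "T \<subseteq> S" for T
    using that
  proof (induction "card T" arbitrary: T)
    case (Suc n)
    then have "T \<noteq> {}" by auto
    then obtain b p where bp: "T \<inter> bucket B b = {p}"
      using assms(1) Suc.prems unfolding peelable_def by metis
    then have p: "p \<in> T" "own (fst b) p mod B = snd b"
      by (auto simp: bucket_def)
    have "card (T - {p}) \<le> card (touched (T - {p}))"
      using Suc p by (intro Suc.hyps) auto
    also have "touched (T - {p}) \<subseteq> touched T - {b}"
    proof
      fix z assume "z \<in> touched (T - {p})"
      then obtain t q where q: "z = (t, own t q mod B)" "q \<in> T" "q \<noteq> p"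
        by (auto simp: touched_def)
      have "z \<noteq> b"
      proof
        assume "z = b"
        then have "q \<in> T \<inter> bucket B b" using q by (auto simp: bucket_def)
        then show False using bp q by simp
      qed
      then show "z \<in> touched T - {b}" using q by (auto simp: touched_def)
    qed
    then have "card (touched (T - {p})) \<le> card (touched T - {b})"
      using fin Suc.prems by (intro card_mono) auto
    also have "b \<in> touched T"
      using p by (auto simp: touched_def intro!: exI[of _ "fst b"] image_eqI[of _ _ p] prod_eqI)
    then have "card (touched T - {b}) < card (touched T)"
      using fin Suc.prems by (intro card_Diff1_less) auto
    finally show ?case
      using p Suc by simp
  qed auto
  from this[of S] have "card S \<le> card (touched S)" using assms by simp
  also have "touched S \<subseteq> UNIV \<times> {..<B}"
    using assms by (auto simp: touched_def)
  then have "card (touched S) \<le> card ((UNIV :: bool set) \<times> {..<B})"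
    by (intro card_mono) auto
  also have "\<dots> = 2 * B" by (simp add: card_cartesian_product)
  finally show ?thesis .
qed

text \<open>The values that a single point would produce at the first four shifts.\<close>

definition one_node :: "(nat \<Rightarrow> complex) \<Rightarrow> bool" where
  "one_node u \<longleftrightarrow> (\<exists>v w. \<forall>s<4. u s = v * w ^ s)"

text \<open>All subsets are required because any of them may be what is left of a bucket when it is
  examined.\<close>

definition resolvable :: "nat \<Rightarrow> nat \<Rightarrow> signal \<Rightarrow> (nat \<times> nat) set \<Rightarrow> bool" where
  "resolvable N B y S \<longleftrightarrow>
    (\<forall>b. \<forall>T\<subseteq>S \<inter> bucket B b. 2 \<le> card T \<longrightarrow> \<not> one_node (bucket_sum N B y T b))"

text \<open>The form that the machine can evaluate: a ratio proposes an integer phase, and exact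
  equations confirm it. This is stronger than \<open>one_node\<close>, which allows any complex
  node; the probabilistic part works with the weaker notion.\<close>

definition accepts :: "nat \<Rightarrow> (nat \<Rightarrow> complex) \<Rightarrow> bool" where
  "accepts N u \<longleftrightarrow> u 0 \<noteq> 0 \<and>
    (\<forall>s\<in>{1, 2, 3}. u s * omega N ^ (s * phase_index N (u 1 / u 0)) = u 0)"

lemma accepts_one_node:
  assumes "accepts N u"
  shows "one_node u"
proof -
  let ?j = "phase_index N (u 1 / u 0)"
  have "u s = u 0 * (inverse (omega N) ^ ?j) ^ s" if "s < 4" for s
  proof -
    have "s = 0 \<or> s \<in> {1, 2, 3}" using that by auto
    then have "u s * omega N ^ (s * ?j) = u 0"
      using assms unfolding accepts_def by auto
    moreover have "omega N ^ (s * ?j) * (inverse (omega N) ^ ?j) ^ s = 1"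
      using omega_neq_0[of N]
      by (simp add: power_inverse mult.commute[of s] flip: power_mult)
    ultimately show ?thesis
      by (metis mult.assoc mult.right_neutral)
  qed
  then show ?thesis unfolding one_node_def by blast
qed

lemma bucket_sum_singleton:
  assumes "T \<inter> bucket B b = {p}"
  shows "bucket_sum N B y T b s =
    of_nat B / of_nat N * y (fst p) (snd p) * shift_factor N (fst b) s p"
  by (simp add: bucket_sum_def assms)

lemma bucket_sum_restrict: "bucket_sum N B y (T \<inter> bucket B b) b = bucket_sum N B y T b"
  by (simp add: bucket_sum_def fun_eq_iff Int_assoc)

lemma bucket_sum_empty: "T \<inter> bucket B b = {} \<Longrightarrow> bucket_sum N B y T b s = 0"
  by (simp add: bucket_sum_def)

lemma bucket_sum_remove:
  assumes "finite T" "p \<in> T"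
  shows "bucket_sum N B y (T - {p}) b s = bucket_sum N B y T b s -
    (if p \<in> bucket B b
     then of_nat B / of_nat N * y (fst p) (snd p) * shift_factor N (fst b) s p else 0)"
proof (cases "p \<in> bucket B b")
  case True
  have "(T - {p}) \<inter> bucket B b = T \<inter> bucket B b - {p}" by auto
  then show ?thesis
    using True assms by (simp add: bucket_sum_def sum_diff1)
next
  case False
  then have "(T - {p}) \<inter> bucket B b = T \<inter> bucket B b" by auto
  then show ?thesis
    using False by (simp add: bucket_sum_def)
qed

lemma accepts_singleton:
  assumes T: "T \<inter> bucket B b = {p}" and p: "p \<in> {..<N} \<times> {..<N}" "y (fst p) (snd p) \<noteq> 0"
    and "B > 0"
  defines "u \<equiv> bucket_sum N B y T b"
  shows "accepts N u"
    and "phase_index N (u 1 / u 0) = own (\<not> fst b) p"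
    and "phase_index N (u 4 / u 0) = own (fst b) p"
    and "u 0 * of_nat N / of_nat B = y (fst p) (snd p)"
proof -
  have N: "N > 0" "own t p < N" for t using p by (auto simp: own_def)
  have us: "u s = u 0 * shift_factor N (fst b) s p" for s
    unfolding u_def bucket_sum_singleton[OF T] by (simp add: shift_factor_def)
  have u0: "u 0 = of_nat B / of_nat N * y (fst p) (snd p)"
    unfolding u_def bucket_sum_singleton[OF T] by (simp add: shift_factor_def)
  then have nz: "u 0 \<noteq> 0" using p N assms(4) by simp
  show u4: "phase_index N (u 4 / u 0) = own (fst b) p"
    using nz N phase_index_inverse_omega unfolding us[of 4] by (simp add: shift_factor_def)
  show u1: "phase_index N (u 1 / u 0) = own (\<not> fst b) p"
    using nz N phase_index_inverse_omega unfolding us[of 1] by (simp add: shift_factor_def)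
  show "u 0 * of_nat N / of_nat B = y (fst p) (snd p)"
    using u0 N assms(4) by (simp add: divide_simps)
  have "u s * omega N ^ (s * own (\<not> fst b) p) = u 0" if "s \<in> {1, 2, 3}" for s
  proof -
    have "s div 4 = 0" "s mod 4 = s" using that by auto
    then show ?thesis
      using omega_neq_0[of N] unfolding us[of s]
      by (simp add: shift_factor_def power_inverse mult.commute)
  qed
  then show "accepts N u"
    unfolding accepts_def u1 using nz by blast
qed

text \<open>An empty bucket is rejected by \<open>u 0 \<noteq> 0\<close> and a bucket with several
  points by resolvability, while a genuine singleton always passes.\<close>

lemma accepts_bucket_sum_iff:
  assumes "resolvable N B y S" "T \<subseteq> S" "S \<subseteq> {p \<in> {..<N} \<times> {..<N}. y (fst p) (snd p) \<noteq> 0}" "B > 0"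
  shows "accepts N (bucket_sum N B y T b) \<longleftrightarrow> (\<exists>p. T \<inter> bucket B b = {p})"
proof
  assume acc: "accepts N (bucket_sum N B y T b)"
  have fin: "finite (T \<inter> bucket B b)"
    using assms(2,3) by (auto intro: finite_subset[of _ "{..<N} \<times> {..<N}"])
  have "\<not> 2 \<le> card (T \<inter> bucket B b)"
    using assms(1,2) accepts_one_node[OF acc] unfolding resolvable_def
    by (metis Int_mono bucket_sum_restrict order_refl)
  moreover have "T \<inter> bucket B b \<noteq> {}"
    using acc by (auto simp: accepts_def bucket_sum_empty)
  then have "card (T \<inter> bucket B b) \<noteq> 0"
    using fin by simp
  ultimately have "card (T \<inter> bucket B b) = 1" by linarith
  then show "\<exists>p. T \<inter> bucket B b = {p}" by (simp add: card_1_singleton_iff)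
next
  assume "\<exists>p. T \<inter> bucket B b = {p}"
  then obtain p where p: "T \<inter> bucket B b = {p}" ..
  then have "p \<in> S" using assms(2) by auto
  then show "accepts N (bucket_sum N B y T b)"
    using accepts_singleton(1)[OF p] assms(3,4) by auto
qed

section \<open>Random supports\<close>

text \<open>The list continues a closed walk after the edge \<open>e\<close>: successive edges share
  an \<open>f\<close>-vertex and a \<open>g\<close>-vertex in turn, and the last one returns to the
  \<open>g\<close>-vertex of \<open>e0\<close>. Cycles in a bipartite graph are even, hence two
  edges per recursive step; a single edge closes the walk, and for \<open>e = e0\<close> it forms a
  double edge with \<open>e\<close>.\<close>

fun cyclic :: "('e \<Rightarrow> 'v) \<Rightarrow> ('e \<Rightarrow> 'v) \<Rightarrow> 'e \<Rightarrow> 'e \<Rightarrow> 'e list \<Rightarrow> bool" where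
  "cyclic f g e0 e [] \<longleftrightarrow> False"
| "cyclic f g e0 e [e'] \<longleftrightarrow> f e' = f e \<and> g e' = g e0"
| "cyclic f g e0 e (e' # e'' # es) \<longleftrightarrow> f e' = f e \<and> g e'' = g e' \<and> cyclic f g e0 e'' es"

lemma cyclic_walk:
  assumes "\<And>n. h (odd n) (w (Suc n)) = h (odd n) (w n)"
    and "h (even m) (w (m + 2 * l + 1)) = h (even m) e0"
  shows "cyclic (h (odd m)) (h (even m)) e0 (w m) (map w [Suc m..<m + 2 * l + 2])"
  using assms(2)
proof (induction l arbitrary: m)
  case 0
  then show ?case using assms(1)[of m] by simp
next
  case (Suc l)
  have "[Suc m..<m + 2 * Suc l + 2] = Suc m # Suc (Suc m) # [Suc (m + 2)..<m + 2 + 2 * l + 2]"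
    by (simp add: upt_conv_Cons)
  moreover have "cyclic (h (odd m)) (h (even m)) e0 (w (m + 2))
      (map w [Suc (m + 2)..<m + 2 + 2 * l + 2])"
    using Suc.IH[of "m + 2"] Suc.prems by simp
  ultimately show ?case
    using assms(1)[of m] assms(1)[of "Suc m"] by simp
qed

text \<open>
  In a finite bipartite multigraph (the edges are \<open>T\<close>, the end points of \<open>p\<close> are \<open>h False p\<close> and
  \<open>h True p\<close>) without vertices of degree one, a walk that never turns back must revisit a vertex;
  the shortest such return is a cycle.
\<close>

lemma ex_cyclic:
  fixes h :: "bool \<Rightarrow> 'e \<Rightarrow> 'v"
  assumes "finite T" "T \<noteq> {}"
    and partner: "\<And>t p. p \<in> T \<Longrightarrow> \<exists>q\<in>T. q \<noteq> p \<and> h t q = h t p"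
  shows "\<exists>t l e0 es. length es = 2 * l + 1 \<and> set (e0 # es) \<subseteq> T \<and> distinct (e0 # es) \<and>
    cyclic (h t) (h (\<not> t)) e0 e0 es"
proof -
  define nx where "nx t p = (SOME q. q \<in> T \<and> q \<noteq> p \<and> h t q = h t p)" for t p
  have nx: "nx t p \<in> T \<and> nx t p \<noteq> p \<and> h t (nx t p) = h t p" if "p \<in> T" for t p
    unfolding nx_def by (rule someI_ex) (use partner[OF that, of t] in blast)
  obtain p0 where p0: "p0 \<in> T" using assms by auto
  define w where "w = rec_nat p0 (\<lambda>n p. nx (odd n) p)"
  have w_Suc: "w (Suc n) = nx (odd n) (w n)" for n by (simp add: w_def)
  have wT: "w n \<in> T" for n
    by (induction n) (use p0 nx in \<open>auto simp: w_Suc\<close>, simp add: w_def)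
  have w_ne: "w (Suc n) \<noteq> w n" and w_h: "h (odd n) (w (Suc n)) = h (odd n) (w n)" for n
    using nx[OF wT] by (auto simp: w_Suc)
  \<comment> \<open>The vertex shared by \<open>w n\<close> and \<open>w (Suc n)\<close>; the parity
    records its side.\<close>
  define vx where "vx n = (odd n, h (odd n) (w n))" for n
  have "range vx \<subseteq> UNIV \<times> (\<Union>t. h t ` T)" using wT by (auto simp: vx_def)
  then have "finite (range vx)"
    by (rule finite_subset) (use assms(1) in auto)
  then have "\<not> inj vx" using finite_imageD infinite_UNIV_nat by blast
  then obtain i0 j0 where "vx i0 = vx j0" "i0 < j0"
    unfolding inj_def by (metis nat_neq_iff)
  then have ex: "\<exists>d. \<exists>i. d > 0 \<and> vx i = vx (i + d)"
    by (intro exI[of _ "j0 - i0"] exI[of _ i0]) auto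
  \<comment> \<open>The smallest distance between two visits of the same vertex. Minimality will
    give distinct edges, and the side component makes \<open>d\<close> even.\<close>
  define d where "d = (LEAST d. \<exists>i. d > 0 \<and> vx i = vx (i + d))"
  obtain i where d: "d > 0" "vx i = vx (i + d)"
    using LeastI_ex[OF ex] unfolding d_def by blast
  have min: "vx a \<noteq> vx b" if "a < b" "b - a < d" for a b
    using not_less_Least[of "b - a" "\<lambda>d. \<exists>i. d > 0 \<and> vx i = vx (i + d)"] that
    by (auto simp: d_def dest!: spec[of _ a])
  have "even d" using d by (auto simp: vx_def)
  then obtain l where l: "d = 2 * l + 2"
    using d(1) by (metis evenE Suc_pred mult_Suc_right add.commute nat_0_less_mult_iff)
  \<comment> \<open>Equal edges repeat a vertex too early: for equal parity
    \<open>vx a = vx b\<close>; otherwise the vertex before \<open>w b\<close> is already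
    \<open>vx a\<close>, and \<open>w_ne\<close> excludes adjacent indices.\<close>
  have inj: "w a \<noteq> w b" if "i < a" "a < b" "b \<le> i + d" for a b
  proof
    assume eq: "w a = w b"
    show False
    proof (cases "odd a = odd b")
      case True
      then have "vx a = vx b" by (simp add: vx_def eq)
      then show False using min[of a b] that by simp
    next
      case False
      obtain b' where b': "b = Suc b'" using \<open>a < b\<close> by (cases b) auto
      have odd: "odd b' = odd a" using False b' by auto
      have "vx b' = vx a" using w_h[of b'] odd by (simp add: vx_def eq b')
      moreover have "a \<noteq> b'" using b' eq w_ne[of a] by auto
      then have "a < b'" using that b' by simp
      moreover have "b' - a < d" using that b' by linarith
      ultimately show False using min[of a b'] by simp
    qed
  qed
  \<comment> \<open>Together with \<open>w (i + 1)\<close> these are the edges up to index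
    \<open>i + d\<close>; they lie between the two visits of \<open>vx i\<close>, where the walk
    closes.\<close>
  let ?es = "map w [Suc (i + 1)..<i + 1 + 2 * l + 2]"
  have "cyclic (h (odd (i + 1))) (h (even (i + 1))) (w (i + 1)) (w (i + 1)) ?es"
  proof (rule cyclic_walk)
    show "h (odd n) (w (Suc n)) = h (odd n) (w n)" for n by (rule w_h)
    have "vx i = vx (i + 1 + 2 * l + 1)" using d(2) l by (simp add: add_ac)
    then have "h (odd i) (w (i + 1 + 2 * l + 1)) = h (odd i) (w i)"
      by (auto simp: vx_def)
    then show "h (even (i + 1)) (w (i + 1 + 2 * l + 1)) = h (even (i + 1)) (w (i + 1))"
      using w_h[of i] by simp
  qed
  moreover have "distinct (w (i + 1) # ?es)"
  proof -
    have "inj_on w {i + 1..<i + 1 + 2 * l + 2}"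
      using inj l by (intro linorder_inj_onI') auto
    then have "distinct (map w [i + 1..<i + 1 + 2 * l + 2])"
      by (simp add: distinct_map del: upt_Suc)
    then show ?thesis by (subst (asm) upt_conv_Cons) auto
  qed
  moreover have "set (w (i + 1) # ?es) \<subseteq> T" using wT by auto
  moreover have "length ?es = 2 * l + 1" by (simp del: upt_Suc)
  ultimately show ?thesis
    by (intro exI[of _ "odd (i + 1)"] exI[of _ l] exI[of _ "w (i + 1)"] exI[of _ ?es] conjI)
       (simp_all only: not_not)
qed

definition cycles :: "'e set \<Rightarrow> ('e \<Rightarrow> 'v) \<Rightarrow> ('e \<Rightarrow> 'v) \<Rightarrow> nat \<Rightarrow> 'e \<Rightarrow> 'e \<Rightarrow> 'e list set" where
  "cycles D f g l e0 e = {es. set es \<subseteq> D \<and> length es = 2 * l + 1 \<and> cyclic f g e0 e es}"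

lemma finite_cycles: "finite D \<Longrightarrow> finite (cycles D f g l e0 e)"
  by (rule finite_subset[OF _ finite_lists_length_eq[of D "2 * l + 1"]]) (auto simp: cycles_def)

text \<open>Each of the first \<open>2 * l\<close> edges has one end point prescribed by its
  predecessor, and the last edge has both prescribed. It is this closing constraint that will
  compensate for the free choice of the starting edge.\<close>

lemma card_cycles_le:
  assumes "finite D" "e \<in> D" "e0 \<in> D"
    and f: "\<And>e. e \<in> D \<Longrightarrow> card {e' \<in> D. f e' = f e} \<le> M"
    and g: "\<And>e. e \<in> D \<Longrightarrow> card {e' \<in> D. g e' = g e} \<le> M"
    and fg: "\<And>e e0. e \<in> D \<Longrightarrow> e0 \<in> D \<Longrightarrow> card {e' \<in> D. f e' = f e \<and> g e' = g e0} \<le> Q"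
  shows "card (cycles D f g l e0 e) \<le> M ^ (2 * l) * Q"
  using assms(2)
proof (induction l arbitrary: e)
  case 0
  have "cycles D f g 0 e0 e \<subseteq> (\<lambda>e'. [e']) ` {e' \<in> D. f e' = f e \<and> g e' = g e0}"
    by (auto simp: cycles_def length_Suc_conv)
  then have "card (cycles D f g 0 e0 e) \<le> card {e' \<in> D. f e' = f e \<and> g e' = g e0}"
    using assms(1) by (intro surj_card_le) auto
  then show ?case using fg[OF 0 assms(3)] by simp
next
  case (Suc l)
  have "cycles D f g (Suc l) e0 e \<subseteq> (\<Union>e'\<in>{e' \<in> D. f e' = f e}. \<Union>e''\<in>{e'' \<in> D. g e'' = g e'}.
      (\<lambda>es. e' # e'' # es) ` cycles D f g l e0 e'')"
  proof
    fix es assume es: "es \<in> cycles D f g (Suc l) e0 e"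
    then have "length es = Suc (Suc (2 * l + 1))" by (simp add: cycles_def)
    then obtain e' e'' es' where "es = e' # e'' # es'" by (metis length_Suc_conv)
    then have "e' \<in> D" "f e' = f e" "e'' \<in> D" "g e'' = g e'" "es' \<in> cycles D f g l e0 e''"
      "es = e' # e'' # es'"
      using es by (auto simp: cycles_def)
    then show "es \<in> (\<Union>e'\<in>{e' \<in> D. f e' = f e}. \<Union>e''\<in>{e'' \<in> D. g e'' = g e'}.
      (\<lambda>es. e' # e'' # es) ` cycles D f g l e0 e'')"
      by blast
  qed
  then have "card (cycles D f g (Suc l) e0 e) \<le> card \<dots>"
    using assms(1) by (intro card_mono) (auto intro!: finite_cycles)
  also have "\<dots> \<le> (\<Sum>e'\<in>{e' \<in> D. f e' = f e}. card (\<Union>e''\<in>{e'' \<in> D. g e'' = g e'}.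
      (\<lambda>es. e' # e'' # es) ` cycles D f g l e0 e''))"
    using assms(1) by (intro card_UN_le) auto
  also have "\<dots> \<le> (\<Sum>e'\<in>{e' \<in> D. f e' = f e}. M * (M ^ (2 * l) * Q))"
  proof (intro sum_mono)
    fix e' assume e': "e' \<in> {e' \<in> D. f e' = f e}"
    have "card (\<Union>e''\<in>{e'' \<in> D. g e'' = g e'}. (\<lambda>es. e' # e'' # es) ` cycles D f g l e0 e'')
      \<le> (\<Sum>e''\<in>{e'' \<in> D. g e'' = g e'}. card ((\<lambda>es. e' # e'' # es) ` cycles D f g l e0 e''))"
      using assms(1) by (intro card_UN_le) auto
    also have "\<dots> \<le> (\<Sum>e''\<in>{e'' \<in> D. g e'' = g e'}. M ^ (2 * l) * Q)"
      using Suc.IH by (intro sum_mono order_trans[OF card_image_le])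
        (auto intro!: finite_cycles assms(1))
    also have "\<dots> \<le> M * (M ^ (2 * l) * Q)"
      using g[of e'] e' by simp
    finally show "card (\<Union>e''\<in>{e'' \<in> D. g e'' = g e'}.
      (\<lambda>es. e' # e'' # es) ` cycles D f g l e0 e'') \<le> M * (M ^ (2 * l) * Q)" .
  qed
  also have "\<dots> \<le> M * (M * (M ^ (2 * l) * Q))"
    using f[OF Suc.prems] by simp
  finally show ?case by (simp add: mult_ac)
qed

section \<open>Union bounds for Bernoulli supports\<close>

definition random_set :: "'e set \<Rightarrow> real \<Rightarrow> ('e \<Rightarrow> bool) pmf" where
  "random_set D q = Pi_pmf D False (\<lambda>_. bernoulli_pmf q)"

lemma prob_random_set_superset:
  assumes "finite D" "A \<subseteq> D" "0 \<le> q" "q \<le> 1"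
  shows "measure_pmf.prob (random_set D q) {b. \<forall>e\<in>A. b e} = q ^ card A"
proof -
  let ?X = "\<lambda>e. if e \<in> A then {True} else UNIV"
  have "{b. \<forall>e\<in>A. b e} = Pi D ?X"
    using assms(2) by (auto simp: Pi_def)
  then have "measure_pmf.prob (random_set D q) {b. \<forall>e\<in>A. b e} =
      (\<Prod>e\<in>D. measure_pmf.prob (bernoulli_pmf q) (?X e))"
    unfolding random_set_def using assms(1) by (simp only: measure_Pi_pmf_Pi)
  also have "\<dots> = (\<Prod>e\<in>D. if e \<in> A then q else 1)"
    using assms(3,4) by (intro prod.cong refl) (auto simp: measure_pmf_single)
  also have "\<dots> = (\<Prod>e\<in>D \<inter> A. q)"
    using assms(1) by (simp only: prod.inter_restrict)
  also have "D \<inter> A = A" using assms(2) by auto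
  finally show ?thesis by simp
qed

lemma prob_random_set_union_bound:
  assumes "finite D" "finite I" "\<And>i. i \<in> I \<Longrightarrow> A i \<subseteq> D" "0 \<le> q" "q \<le> 1"
    and "X \<subseteq> {b. \<exists>i\<in>I. \<forall>e\<in>A i. b e}"
  shows "measure_pmf.prob (random_set D q) X \<le> (\<Sum>i\<in>I. q ^ card (A i))"
proof -
  have "measure_pmf.prob (random_set D q) X \<le>
      measure_pmf.prob (random_set D q) (\<Union>i\<in>I. {b. \<forall>e\<in>A i. b e})"
    using assms(6) by (intro measure_pmf.finite_measure_mono) auto
  also have "\<dots> \<le> (\<Sum>i\<in>I. measure_pmf.prob (random_set D q) {b. \<forall>e\<in>A i. b e})"
    using assms(2) by (intro measure_pmf.finite_measure_subadditive_finite) auto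
  also have "\<dots> = (\<Sum>i\<in>I. q ^ card (A i))"
    using assms by (intro sum.cong refl prob_random_set_superset) auto
  finally show ?thesis .
qed

lemma sum_Pow_power:
  fixes q :: real
  assumes "finite X"
  shows "(\<Sum>R\<in>Pow X. q ^ card R) = (1 + q) ^ card X"
  using prod_add[OF assms, of "\<lambda>_. q" "\<lambda>_. 1"] by (simp add: add.commute)

lemma card_mod_eq_le:
  assumes "B dvd N" "B > 0"
  shows "card {i. i < N \<and> i mod B = r} \<le> N div B"
proof -
  have "inj_on (\<lambda>i. i div B) {i. i < N \<and> i mod B = r}"
    by (rule inj_onI) (metis (mono_tags, lifting) mem_Collect_eq div_mult_mod_eq)
  moreover have "(\<lambda>i. i div B) ` {i. i < N \<and> i mod B = r} \<subseteq> {..<N div B}"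
    using assms by (auto simp: div_less_iff_less_mult)
  ultimately have "card {i. i < N \<and> i mod B = r} \<le> card {..<N div B}"
    by (intro card_inj_on_le) auto
  then show ?thesis by simp
qed

text \<open>Applying the coefficients of the cubic with roots \<open>z\<close>, \<open>w\<close>,
  \<open>w'\<close> to the four equations annihilates the right-hand side and leaves
  \<open>c\<close> times the value of the cubic at \<open>z'\<close>. Only \<open>z'\<close> has to
  differ from the other nodes, so these may coincide and may serve as padding.\<close>

lemma vandermonde4:
  fixes c v v' a w w' z z' :: complex
  assumes eq: "\<And>s. s < 4 \<Longrightarrow> c * z' ^ s = v' * w' ^ s - v * w ^ s + a * z ^ s"
    and "z' \<noteq> z" "z' \<noteq> w" "z' \<noteq> w'"
  shows "c = 0"
proof -
  note e = eq[of 0] eq[of 1] eq[of 2] eq[of 3]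
  have "c * ((z' - z) * (z' - w) * (z' - w')) =
      c * z' ^ 3 - (z + w + w') * (c * z' ^ 2) + (z * w + z * w' + w * w') * (c * z' ^ 1)
      - z * w * w' * (c * z' ^ 0)"
    by (simp add: algebra_simps power2_eq_square power3_eq_cube)
  also have "\<dots> =
      (v' * w' ^ 3 - v * w ^ 3 + a * z ^ 3) - (z + w + w') * (v' * w' ^ 2 - v * w ^ 2 + a * z ^ 2)
      + (z * w + z * w' + w * w') * (v' * w' ^ 1 - v * w ^ 1 + a * z ^ 1)
      - z * w * w' * (v' * w' ^ 0 - v * w ^ 0 + a * z ^ 0)"
    using e by simp
  also have "\<dots> = 0"
    by (simp add: algebra_simps power2_eq_square power3_eq_cube)
  finally show ?thesis using assms by simp
qed

lemma not_one_node_two: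
  assumes "z1 \<noteq> z2" "a \<noteq> 0" "b \<noteq> 0"
  shows "\<not> one_node (\<lambda>s. a * z1 ^ s + b * z2 ^ s)"
proof
  assume "one_node (\<lambda>s. a * z1 ^ s + b * z2 ^ s)"
  then obtain v w where vw: "\<And>s. s < 4 \<Longrightarrow> a * z1 ^ s + b * z2 ^ s = v * w ^ s"
    by (auto simp: one_node_def)
  show False
  \<comment> \<open>The node \<open>w\<close> cannot equal both \<open>z1\<close> and
    \<open>z2\<close>, so one of these is isolated; the third node on the other side is padding with
    coefficient zero.\<close>
  proof (cases "w = z1")
    case True
    have "b = 0"
      by (rule vandermonde4[of b z2 v w a z1 0 z1]) (use vw True assms in \<open>auto simp: algebra_simps\<close>)
    then show False using assms by simp
  next
    case False
    have "a = 0"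
      by (rule vandermonde4[of a z1 v w b z2 0 z2]) (use vw False assms in \<open>auto simp: algebra_simps\<close>)
    then show False using assms by simp
  qed
qed

text \<open>
  Any four distinct nodes are linearly independent on four shifts, so values outside the one-node
  set determine the unordered pair of nodes of a two-node representation.
\<close>

lemma one_node_extension:
  assumes u: "\<not> one_node u" and vw: "\<And>s. s < 4 \<Longrightarrow> u s + a * z ^ s = v * w ^ s"
    and "one_node (\<lambda>s. u s + a' * z' ^ s)"
  shows "z' = z \<or> z' = w"
proof (rule ccontr)
  assume neg: "\<not> (z' = z \<or> z' = w)"
  obtain v' w' where vw': "\<And>s. s < 4 \<Longrightarrow> u s + a' * z' ^ s = v' * w' ^ s"
    using assms(3) by (auto simp: one_node_def)
  have "w' \<noteq> z'"
  proof
    assume "w' = z'"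
    then have "\<forall>s<4. u s = (v' - a') * z' ^ s"
      using vw' by (auto simp: left_diff_distrib simp flip: eq_diff_eq)
    then show False using u by (auto simp: one_node_def)
  qed
  then have "a' = 0"
  proof (intro vandermonde4[of a' z' v' w' v w a z])
    fix s :: nat assume "s < 4"
    \<comment> \<open>Both representations are solved for \<open>u s\<close> and compared, which
      eliminates the unknown values.\<close>
    then show "a' * z' ^ s = v' * w' ^ s - v * w ^ s + a * z ^ s"
      by (simp flip: vw vw')
  qed (use neg in auto)
  then show False using u vw' by (auto simp: one_node_def)
qed

section \<open>Collisions inside a bucket\<close>

lemma one_node_cong: "(\<And>s. s < 4 \<Longrightarrow> u s = u' s) \<Longrightarrow> one_node u \<longleftrightarrow> one_node u'"
  by (auto simp: one_node_def)

lemma bucket_sum_insert: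
  assumes "finite T" "p \<notin> T" "p \<in> bucket B b" "s < 4"
  shows "bucket_sum N B y (insert p T) b s = bucket_sum N B y T b s +
    of_nat B / of_nat N * y (fst p) (snd p) * (inverse (omega N) ^ own (\<not> fst b) p) ^ s"
proof -
  have "s div 4 = 0" "s mod 4 = s" using assms(4) by auto
  then show ?thesis
    using assms(1-3) by (simp add: bucket_sum_def shift_factor_def power_mult)
qed

text \<open>Two points that share a bucket and also the other coordinate lie in the same two
  buckets, a double edge without a leaf. Such a pair has equal nodes and would fool the test, so
  this collision is left to the bound on cycles.\<close>

lemma peelable_columns:
  assumes "peelable B S" "p \<in> S" "q \<in> S" "p \<noteq> q" "p \<in> bucket B b" "q \<in> bucket B b"
  shows "own (\<not> fst b) p \<noteq> own (\<not> fst b) q"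
proof
  assume eq: "own (\<not> fst b) p = own (\<not> fst b) q"
  have "own t p mod B = own t q mod B" for t
    using eq assms(5,6) by (cases "t = fst b") (auto simp: bucket_def)
  then have same: "p \<in> bucket B b' \<longleftrightarrow> q \<in> bucket B b'" for b'
    by (simp add: bucket_def)
  have "{p, q} \<subseteq> S" "{p, q} \<noteq> {}" using assms by auto
  then obtain b' r where r: "{p, q} \<inter> bucket B b' = {r}"
    using assms(1)[unfolded peelable_def, rule_format, of "{p, q}"] by blast
  then have "r \<in> bucket B b'" "r = p \<or> r = q" by blast+
  then have "p \<in> bucket B b'" "q \<in> bucket B b'" using same by blast+
  then have "p \<in> {r}" "q \<in> {r}" unfolding r[symmetric] by simp_all
  then show False using assms(4) by simp
qed

text \<open>A smallest confusable set is split into one point and the rest \<open>R\<close>. By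
  minimality \<open>R\<close> is no longer confusable, which is the condition under which few
  extensions exist. A one-point \<open>R\<close> cannot occur: it would leave a pair with two
  distinct nodes, and such a pair never looks like one node.\<close>

lemma minimal_unresolvable:
  assumes "\<not> resolvable N B y S" "peelable B S" "B > 0" "N > 0"
    and S: "S \<subseteq> {p \<in> {..<N} \<times> {..<N}. y (fst p) (snd p) \<noteq> 0}"
  shows "\<exists>b R p. snd b < B \<and> R \<subseteq> S \<inter> bucket B b \<and> p \<in> S \<inter> bucket B b - R \<and>
    \<not> one_node (bucket_sum N B y R b) \<and> one_node (bucket_sum N B y (insert p R) b)"
proof -
  define bad where "bad T \<longleftrightarrow> (\<exists>b. T \<subseteq> S \<inter> bucket B b \<and> 2 \<le> card T \<and>
    one_node (bucket_sum N B y T b))" for T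
  obtain T where T: "bad T" and min: "\<And>T'. bad T' \<Longrightarrow> card T \<le> card T'"
    using assms(1) ex_has_least_nat[of bad _ card] unfolding resolvable_def bad_def by metis
  obtain b where b: "T \<subseteq> S \<inter> bucket B b" "2 \<le> card T" "one_node (bucket_sum N B y T b)"
    using T by (auto simp: bad_def)
  have finT: "finite T" using b(2) by (metis card.infinite not_numeral_le_zero)
  have "T \<noteq> {}" using b(2) by auto
  then obtain p where p: "p \<in> T" by auto
  define R where "R = T - {p}"
  have R: "finite R" "p \<notin> R" "insert p R = T" "card T = Suc (card R)"
    using finT p card.remove[OF finT p] by (auto simp: R_def)
  have pb: "p \<in> bucket B b" using p b(1) by auto
  have "\<not> one_node (bucket_sum N B y R b)"
  proof (cases "card R = 1")
    case True
    then obtain q where q: "R = {q}" by (auto simp: card_1_singleton_iff)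
    have "q \<in> T" "q \<noteq> p" using q unfolding R_def by blast+
    then have pq: "p \<in> S" "q \<in> S" "q \<in> bucket B b" using p b(1) by blast+
    have col: "own (\<not> fst b) p \<noteq> own (\<not> fst b) q"
      using peelable_columns[OF assms(2) pq(1,2) \<open>q \<noteq> p\<close>[symmetric] pb pq(3)] .
    have pq': "p \<in> {..<N} \<times> {..<N}" "q \<in> {..<N} \<times> {..<N}"
      "y (fst p) (snd p) \<noteq> 0" "y (fst q) (snd q) \<noteq> 0"
      using pq S by blast+
    then have lt: "own t p < N" "own t q < N" for t
      by (auto simp: own_def)
    define z where "z p = inverse (omega N) ^ own (\<not> fst b) p" for p
    define c where "c p = of_nat B / of_nat N * y (fst p) (snd p)" for p
    have "bucket_sum N B y T b s = c q * z q ^ s + c p * z p ^ s" if "s < 4" for s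
    proof -
      have "T = insert p {q}" using R(3) q by simp
      then show ?thesis
        using bucket_sum_insert[of "{}" q B b s N y] bucket_sum_insert[of "{q}" p B b s N y]
          \<open>q \<noteq> p\<close> pq(3) pb that by (simp add: bucket_sum_empty c_def z_def)
    qed
    then have "one_node (bucket_sum N B y T b) \<longleftrightarrow> one_node (\<lambda>s. c q * z q ^ s + c p * z p ^ s)"
      by (rule one_node_cong)
    then have "one_node (\<lambda>s. c q * z q ^ s + c p * z p ^ s)"
      using b(3) by simp
    moreover have "z q \<noteq> z p"
      using col inverse_omega_power_inj[OF lt] unfolding z_def by metis
    moreover have "c q \<noteq> 0" "c p \<noteq> 0"
      using assms(3,4) pq'(3,4) by (simp_all add: c_def)
    ultimately have False using not_one_node_two by blast
    then show ?thesis ..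
  next
    case False
    then have "2 \<le> card R" using R(4) b(2) by linarith
    then show ?thesis
      using min[of R] R(3,4) b(1) unfolding bad_def by (metis insert_subset not_less_eq_eq order_refl)
  qed
  moreover have "snd b < B" using pb assms(3) unfolding bucket_def by (metis mem_Collect_eq mod_less_divisor)
  moreover have "R \<subseteq> S \<inter> bucket B b" "p \<in> S \<inter> bucket B b - R" using b(1) R by auto
  moreover have "one_node (bucket_sum N B y (insert p R) b)" using b(3) R(3) by simp
  ultimately show ?thesis by (intro exI[of _ b] exI[of _ R] exI[of _ p] conjI)
qed

text \<open>If \<open>R\<close> has one node itself, for instance if it is empty, arbitrarily many
  points may extend it. The value \<open>{}\<close> in that case keeps the count below valid, and
  the splitting of a minimal set never meets it.\<close>

definition confusing :: "nat \<Rightarrow> nat \<Rightarrow> signal \<Rightarrow> bool \<times> nat \<Rightarrow> (nat \<times> nat) set \<Rightarrow> (nat \<times> nat) set" where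
  "confusing N B y b R = (if one_node (bucket_sum N B y R b) then {}
     else {p \<in> {..<N} \<times> {..<N} \<inter> bucket B b - R. one_node (bucket_sum N B y (insert p R) b)})"

lemma card_node_le:
  assumes "B dvd N" "B > 0"
  shows "card {p \<in> {..<N} \<times> {..<N} \<inter> bucket B b. inverse (omega N) ^ own (\<not> fst b) p = z}
    \<le> N div B" (is "card ?X \<le> _")
proof -
  have "inj_on (own (fst b)) ?X"
  proof (rule inj_onI)
    fix p q assume p: "p \<in> ?X" and q: "q \<in> ?X" and eq: "own (fst b) p = own (fst b) q"
    have "own (\<not> fst b) p < N" "own (\<not> fst b) q < N" using p q by (auto simp: own_def)
    then have "own (\<not> fst b) p = own (\<not> fst b) q"
      using p q inverse_omega_power_inj by auto
    then show "p = q" using eq by (auto simp: own_def prod_eq_iff split: if_splits)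
  qed
  moreover have "own (fst b) ` ?X \<subseteq> {i. i < N \<and> i mod B = snd b}"
    by (auto simp: own_def bucket_def)
  ultimately have "card ?X \<le> card {i. i < N \<and> i mod B = snd b}"
    by (intro card_inj_on_le) auto
  then show ?thesis using card_mod_eq_le[OF assms, of "snd b"] by simp
qed

text \<open>One confusing point \<open>p0\<close> fixes two nodes: its own and the node
  \<open>w\<close> of the extended bucket. Every confusing point has one of these two, so uniformly
  in the coefficients its cross coordinate has two possible values, and its coordinate along the
  line has at most \<open>N div B\<close>.\<close>

lemma card_confusing_le:
  assumes "B dvd N" "B > 0" "R \<subseteq> {..<N} \<times> {..<N}"
  shows "card (confusing N B y b R) \<le> 2 * (N div B)"
proof (cases "confusing N B y b R = {}")
  case False
  let ?D = "{..<N} \<times> {..<N} \<inter> bucket B b"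
  define z where "z p = inverse (omega N) ^ own (\<not> fst b) p" for p
  define c where "c p = of_nat B / of_nat N * y (fst p) (snd p)" for p
  have fin: "finite R" using assms(3) by (rule finite_subset) auto
  have u: "\<not> one_node (bucket_sum N B y R b)"
    using False by (auto simp: confusing_def)
  have ins: "one_node (\<lambda>s. bucket_sum N B y R b s + c p * z p ^ s)" "p \<in> ?D"
    if "p \<in> confusing N B y b R" for p
  proof -
    have *: "p \<in> ?D" "p \<notin> R" "one_node (bucket_sum N B y (insert p R) b)"
      using that by (auto simp: confusing_def split: if_splits)
    have "one_node (bucket_sum N B y (insert p R) b) \<longleftrightarrow>
        one_node (\<lambda>s. bucket_sum N B y R b s + c p * z p ^ s)"
      unfolding c_def z_def using *(1,2) by (intro one_node_cong bucket_sum_insert fin) auto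
    then show "one_node (\<lambda>s. bucket_sum N B y R b s + c p * z p ^ s)"
      using *(3) by simp
    show "p \<in> ?D" by fact
  qed
  obtain p0 where p0: "p0 \<in> confusing N B y b R" using False by auto
  obtain v w where vw: "\<And>s. s < 4 \<Longrightarrow> bucket_sum N B y R b s + c p0 * z p0 ^ s = v * w ^ s"
    using ins(1)[OF p0] by (auto simp: one_node_def)
  have "confusing N B y b R \<subseteq> {p \<in> ?D. z p = z p0} \<union> {p \<in> ?D. z p = w}"
    using one_node_extension[OF u vw ins(1)] ins(2) by blast
  then have "card (confusing N B y b R) \<le> card ({p \<in> ?D. z p = z p0} \<union> {p \<in> ?D. z p = w})"
    by (intro card_mono) auto
  also have "\<dots> \<le> card {p \<in> ?D. z p = z p0} + card {p \<in> ?D. z p = w}"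
    by (rule card_Un_le)
  also have "\<dots> \<le> N div B + N div B"
    unfolding z_def by (intro add_mono card_node_le assms)
  finally show ?thesis by simp
qed simp

section \<open>Probabilities of the two failure events\<close>

lemma card_bucket_le:
  assumes "B dvd N" "B > 0"
  shows "card ({..<N} \<times> {..<N} \<inter> bucket B b) \<le> N * (N div B)" (is "card ?X \<le> _")
proof -
  have "inj_on (\<lambda>p. (own (\<not> fst b) p, own (fst b) p)) ?X"
    by (auto simp: inj_on_def own_def split: if_splits)
  moreover have "(\<lambda>p. (own (\<not> fst b) p, own (fst b) p)) ` ?X \<subseteq>
      {..<N} \<times> {i. i < N \<and> i mod B = snd b}"
    by (auto simp: own_def bucket_def)
  ultimately have "card ?X \<le> card ({..<N} \<times> {i. i < N \<and> i mod B = snd b})"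
    by (intro card_inj_on_le) auto
  then show ?thesis
    using card_mod_eq_le[OF assms, of "snd b"]
    by (simp add: card_cartesian_product) (meson le_trans mult_le_mono2)
qed

lemma card_bucket2_le:
  assumes "B dvd N" "B > 0"
  shows "card ({..<N} \<times> {..<N} \<inter> bucket B (t, r) \<inter> bucket B (\<not> t, r')) \<le> (N div B) * (N div B)"
    (is "card ?X \<le> _")
proof -
  have "inj_on (\<lambda>p. (own t p, own (\<not> t) p)) ?X"
    by (auto simp: inj_on_def own_def split: if_splits)
  moreover have "(\<lambda>p. (own t p, own (\<not> t) p)) ` ?X \<subseteq>
      {i. i < N \<and> i mod B = r} \<times> {i. i < N \<and> i mod B = r'}"
    by (auto simp: own_def bucket_def)
  ultimately have "card ?X \<le> card ({i. i < N \<and> i mod B = r} \<times> {i. i < N \<and> i mod B = r'})"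
    by (intro card_inj_on_le) auto
  also have "\<dots> \<le> (N div B) * (N div B)"
    unfolding card_cartesian_product by (intro mult_le_mono card_mod_eq_le assms)
  finally show ?thesis .
qed

lemma sum_Sigma2_const:
  fixes F :: "'a \<Rightarrow> 'b \<Rightarrow> real"
  assumes "finite V" "\<And>v. finite (P v)" "\<And>v r. finite (C v r)"
  shows "(\<Sum>i\<in>(SIGMA v:V. SIGMA r:P v. C v r). F (fst i) (fst (snd i))) =
    (\<Sum>v\<in>V. \<Sum>r\<in>P v. real (card (C v r)) * F v r)"
proof -
  have "(\<Sum>i\<in>(SIGMA v:V. SIGMA r:P v. C v r). F (fst i) (fst (snd i))) =
      (\<Sum>(v, i)\<in>(SIGMA v:V. SIGMA r:P v. C v r). F v (fst i))"
    by (simp add: split_def)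
  also have "\<dots> = (\<Sum>v\<in>V. \<Sum>i\<in>(SIGMA r:P v. C v r). F v (fst i))"
    using assms by (intro sum.Sigma[symmetric]) auto
  also have "\<dots> = (\<Sum>v\<in>V. \<Sum>r\<in>P v. real (card (C v r)) * F v r)"
  proof (intro sum.cong refl)
    fix v
    have "(\<Sum>i\<in>(SIGMA r:P v. C v r). F v (fst i)) = (\<Sum>(r, p)\<in>(SIGMA r:P v. C v r). F v r)"
      by (simp add: split_def)
    also have "\<dots> = (\<Sum>r\<in>P v. \<Sum>p\<in>C v r. F v r)"
      using assms by (intro sum.Sigma[symmetric]) auto
    finally show "(\<Sum>i\<in>(SIGMA r:P v. C v r). F v (fst i)) =
        (\<Sum>r\<in>P v. real (card (C v r)) * F v r)" by simp
  qed
  finally show ?thesis .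
qed

text \<open>There are \<open>N * N\<close> starting edges and two starting sides. With
  \<open>real M * q = \<epsilon>\<close> and \<open>N * N * Q = M * M\<close>, the cycles of
  \<open>2 * l + 2\<close> edges contribute at most \<open>\<epsilon> ^ (2 * l + 2)\<close> per
  side, and the geometric series is dominated by the double edges.\<close>

lemma prob_not_peelable:
  fixes N B k :: nat and S :: "(nat \<times> nat \<Rightarrow> bool) \<Rightarrow> (nat \<times> nat) set"
  assumes B: "B dvd N" "B > 0" and N: "N > 0" and eps: "real k / real B \<le> 1 / 8"
    and q: "q = real k / (real N)\<^sup>2" "q \<le> 1"
    and S: "\<And>b. S b \<subseteq> {p \<in> {..<N} \<times> {..<N}. b p}"
  shows "measure_pmf.prob (random_set ({..<N} \<times> {..<N}) q) {b. \<not> peelable B (S b)}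
    \<le> 4 * (real k / real B)\<^sup>2"
proof -
  let ?D = "{..<N} \<times> {..<N}"
  define h where "h t p = own t p mod B" for t p
  define C where "C = (\<lambda>(t, l) e. {es \<in> cycles ?D (h t) (h (\<not> t)) l e e. distinct (e # es)})"
  define I where "I = (SIGMA v:UNIV \<times> {..<N * N}. SIGMA e:?D. C v e)"
  define A where "A = (\<lambda>(v :: bool \<times> nat, e, es). set (e # es :: (nat \<times> nat) list))"
  define M where "M = N * (N div B)"
  define Q where "Q = (N div B) * (N div B)"
  define \<epsilon> where "\<epsilon> = real k / real B"
  have eps': "0 \<le> \<epsilon>" "\<epsilon> \<le> 1 / 8" using eps by (auto simp: \<epsilon>_def)
  have finC: "finite (C v e)" for v e
    by (cases v) (auto simp: C_def intro!: finite_subset[OF _ finite_cycles])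
  have NB: "real (N div B) = real N / real B" using B by (simp add: real_of_nat_div)
  have Mq: "real M * q = \<epsilon>"
    using N B by (simp add: M_def NB q \<epsilon>_def power2_eq_square)
  have M2: "real N * real N * real Q = real M * real M"
    by (simp add: M_def Q_def)
  have sub: "{b. \<not> peelable B (S b)} \<subseteq> {b. \<exists>i\<in>I. \<forall>e\<in>A i. b e}"
  proof safe
    fix b assume "\<not> peelable B (S b)"
    then obtain T where T: "T \<subseteq> S b" "T \<noteq> {}" and no: "\<And>v p. T \<inter> bucket B v \<noteq> {p}"
      unfolding peelable_def by auto
    have TD: "T \<subseteq> {p \<in> ?D. b p}" using T S by blast
    have fin: "finite T" by (rule finite_subset[OF TD]) simp
    have partner: "\<exists>q\<in>T. q \<noteq> p \<and> h t q = h t p" if "p \<in> T" for t p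
    proof -
      have "p \<in> T \<inter> bucket B (t, h t p)" using that by (simp add: bucket_def h_def)
      then obtain q where "q \<in> T \<inter> bucket B (t, h t p)" "q \<noteq> p"
        using no[of "(t, h t p)" p] by auto
      then show ?thesis by (auto simp: bucket_def h_def)
    qed
    obtain t l e es where c: "length es = 2 * l + 1" "set (e # es) \<subseteq> T"
      "distinct (e # es)" "cyclic (h t) (h (\<not> t)) e e es"
      using ex_cyclic[where h = h, OF fin T(2) partner] by blast
    have "card (set (e # es)) \<le> card ?D"
      using c(2) TD by (intro card_mono) auto
    then have "length (e # es) \<le> card ?D"
      by (simp only: distinct_card[OF c(3)])
    then have "l < N * N" using c(1) by simp
    moreover have "e \<in> ?D" "set es \<subseteq> ?D" "\<forall>e'\<in>set (e # es). b e'" using c(2) TD by auto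
    ultimately have "((t, l), e, es) \<in> I" "\<forall>e'\<in>A ((t, l), e, es). b e'"
      using c by (auto simp: I_def C_def cycles_def A_def)
    then show "\<exists>i\<in>I. \<forall>e\<in>A i. b e" by blast
  qed
  have "measure_pmf.prob (random_set ?D q) {b. \<not> peelable B (S b)} \<le> (\<Sum>i\<in>I. q ^ card (A i))"
  proof (rule prob_random_set_union_bound[OF _ _ _ _ _ sub])
    show "finite I" unfolding I_def by (intro finite_SigmaI finC) auto
    show "A i \<subseteq> ?D" if "i \<in> I" for i
      using that by (auto simp: I_def C_def cycles_def A_def)
  qed (use q in auto)
  also have "\<dots> = (\<Sum>i\<in>I. q ^ (2 * snd (fst i) + 2))"
    by (intro sum.cong refl) (auto simp: I_def C_def cycles_def A_def distinct_card)
  also have "\<dots> = (\<Sum>v\<in>UNIV \<times> {..<N * N}. \<Sum>e\<in>?D. real (card (C v e)) * q ^ (2 * snd v + 2))"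
    unfolding I_def by (rule sum_Sigma2_const) (use finC in auto)
  also have "\<dots> = (\<Sum>t\<in>UNIV. \<Sum>l<N * N. \<Sum>e\<in>?D. real (card (C (t, l) e)) * q ^ (2 * l + 2))"
    by (subst sum.cartesian_product'[of _ UNIV]) (simp only: snd_conv)
  also have "\<dots> \<le> (\<Sum>t\<in>(UNIV :: bool set). \<Sum>l<N * N. \<Sum>e\<in>?D. real (M ^ (2 * l) * Q) * q ^ (2 * l + 2))"
  proof (intro sum_mono mult_right_mono of_nat_mono)
    fix t l e assume e: "e \<in> ?D"
    have "card (C (t, l) e) \<le> card (cycles ?D (h t) (h (\<not> t)) l e e)"
      unfolding C_def split by (intro card_mono finite_cycles) auto
    also have "\<dots> \<le> M ^ (2 * l) * Q"
    proof (rule card_cycles_le)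
      have *: "{e' \<in> ?D. h t e' = h t e} = ?D \<inter> bucket B (t, h t e)" for t e
        by (auto simp: h_def bucket_def)
      show "card {e' \<in> ?D. h t e' = h t e} \<le> M" "card {e' \<in> ?D. h (\<not> t) e' = h (\<not> t) e} \<le> M" for e
        unfolding * M_def by (rule card_bucket_le[OF B])+
      have "{e' \<in> ?D. h t e' = h t e \<and> h (\<not> t) e' = h (\<not> t) e0} =
          ?D \<inter> bucket B (t, h t e) \<inter> bucket B (\<not> t, h (\<not> t) e0)" for e e0
        by (auto simp: h_def bucket_def)
      then show "card {e' \<in> ?D. h t e' = h t e \<and> h (\<not> t) e' = h (\<not> t) e0} \<le> Q" for e e0
        unfolding Q_def using card_bucket2_le[OF B] by simp
    qed (use e in auto)
    finally show "card (C (t, l) e) \<le> M ^ (2 * l) * Q" .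
  qed (use q in auto)
  also have "\<dots> = 2 * (\<Sum>l<N * N. real N * real N * real Q * q\<^sup>2 * (real M * q) ^ (2 * l))"
    by (simp add: card_cartesian_product UNIV_bool power_add power_mult_distrib
        algebra_simps power2_eq_square)
  also have "real N * real N * real Q * q\<^sup>2 = \<epsilon>\<^sup>2"
    unfolding M2 using Mq by (simp add: power2_eq_square algebra_simps)
  also have "(\<Sum>l<N * N. \<epsilon>\<^sup>2 * (real M * q) ^ (2 * l)) = \<epsilon>\<^sup>2 * (\<Sum>l<N * N. (\<epsilon>\<^sup>2) ^ l)"
    unfolding Mq by (simp add: sum_distrib_left power_mult)
  also have "(\<Sum>l<N * N. (\<epsilon>\<^sup>2) ^ l) \<le> 2"
  proof -
    have "\<epsilon>\<^sup>2 \<le> (1 / 8)\<^sup>2" using eps' by (intro power_mono) auto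
    then have e2: "0 \<le> \<epsilon>\<^sup>2" "\<epsilon>\<^sup>2 \<le> 1 / 2" by (auto simp: power2_eq_square)
    then have "(\<Sum>l<N * N. (\<epsilon>\<^sup>2) ^ l) = (1 - (\<epsilon>\<^sup>2) ^ (N * N)) / (1 - \<epsilon>\<^sup>2)"
      by (subst sum_gp_strict) auto
    also have "\<dots> \<le> 1 / (1 - \<epsilon>\<^sup>2)"
      using e2 by (intro divide_right_mono) auto
    also have "\<dots> \<le> 2" using e2 by (simp add: divide_simps)
    finally show ?thesis .
  qed
  finally show ?thesis
    by (simp add: \<epsilon>_def mult_left_mono)
qed

text \<open>A bad support contains some \<open>R\<close> in one bucket and a confusing point. The
  latter costs a factor of at most q * 2 N / B, which over the 2 B buckets amounts to 4 k / N. The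
  sum of \<open>q ^ card R\<close> over all \<open>R\<close> in a bucket is at most e \<le> 3, since
  the expected load of a bucket is at most k / B \<le> 1.\<close>

lemma prob_not_resolvable:
  fixes N B k :: nat and S :: "(nat \<times> nat \<Rightarrow> bool) \<Rightarrow> (nat \<times> nat) set"
  assumes B: "B dvd N" "B > 0" and N: "N > 0" and eps: "real k / real B \<le> 1 / 8"
    and q: "q = real k / (real N)\<^sup>2" "q \<le> 1"
    and S: "\<And>b. S b \<subseteq> {p \<in> {..<N} \<times> {..<N}. b p \<and> y (fst p) (snd p) \<noteq> 0}"
  shows "measure_pmf.prob (random_set ({..<N} \<times> {..<N}) q)
    {b. peelable B (S b) \<and> \<not> resolvable N B y (S b)} \<le> 12 * (real k / real N)"
proof -
  let ?D = "{..<N} \<times> {..<N}"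
  define I where "I = (SIGMA v:UNIV \<times> {..<B}. SIGMA R:Pow (?D \<inter> bucket B v). confusing N B y v R)"
  define A where "A = (\<lambda>(v :: bool \<times> nat, R, p :: nat \<times> nat). insert p R)"
  define \<epsilon> where "\<epsilon> = real k / real B"
  have eps': "0 \<le> \<epsilon>" "\<epsilon> \<le> 1 / 8" using eps by (auto simp: \<epsilon>_def)
  have q0: "0 \<le> q" using q by simp
  have finC: "finite (confusing N B y v R)" for v R
    by (rule finite_subset[of _ ?D]) (auto simp: confusing_def)
  have finR: "finite R" if "R \<subseteq> ?D" for R using that by (rule finite_subset) simp
  have NB: "real (N div B) = real N / real B" using B by (simp add: real_of_nat_div)
  have sub: "{b. peelable B (S b) \<and> \<not> resolvable N B y (S b)} \<subseteq> {b. \<exists>i\<in>I. \<forall>e\<in>A i. b e}"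
  proof safe
    fix b assume b: "peelable B (S b)" "\<not> resolvable N B y (S b)"
    have "S b \<subseteq> {p \<in> ?D. y (fst p) (snd p) \<noteq> 0}" using S by blast
    from minimal_unresolvable[OF b(2,1) B(2) N this]
    obtain v R p where "snd v < B" "R \<subseteq> S b \<inter> bucket B v" "p \<in> S b \<inter> bucket B v - R"
      "\<not> one_node (bucket_sum N B y R v)" "one_node (bucket_sum N B y (insert p R) v)"
      by metis
    moreover from this have "R \<subseteq> {p \<in> ?D. b p}" "p \<in> ?D" "b p" using S by blast+
    ultimately have "(v, R, p) \<in> I" "\<forall>e\<in>A (v, R, p). b e"
      by (auto simp: I_def confusing_def A_def mem_Times_iff)
    then show "\<exists>i\<in>I. \<forall>e\<in>A i. b e" by blast
  qed
  have "measure_pmf.prob (random_set ?D q) {b. peelable B (S b) \<and> \<not> resolvable N B y (S b)}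
      \<le> (\<Sum>i\<in>I. q ^ card (A i))"
  proof (rule prob_random_set_union_bound[OF _ _ _ _ _ sub])
    show "finite I" unfolding I_def by (intro finite_SigmaI finC) auto
    show "A i \<subseteq> ?D" if "i \<in> I" for i
      using that by (auto simp: I_def confusing_def A_def split: if_splits)
  qed (use q in auto)
  also have "\<dots> = (\<Sum>i\<in>I. q ^ (card (fst (snd i)) + 1))"
  proof (intro sum.cong refl)
    fix i assume "i \<in> I"
    then obtain v R p where i: "i = (v, R, p)" "R \<subseteq> ?D" "p \<notin> R"
      by (auto simp: I_def confusing_def split: if_splits)
    then show "q ^ card (A i) = q ^ (card (fst (snd i)) + 1)"
      using finR[OF i(2)] by (simp add: A_def)
  qed
  also have "\<dots> = (\<Sum>v\<in>UNIV \<times> {..<B}. \<Sum>R\<in>Pow (?D \<inter> bucket B v).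
      real (card (confusing N B y v R)) * q ^ (card R + 1))"
    unfolding I_def by (rule sum_Sigma2_const) (use finC in auto)
  also have "\<dots> \<le> (\<Sum>v\<in>(UNIV :: bool set) \<times> {..<B}. 2 * (real N / real B) * q * 3)"
  proof (intro sum_mono)
    fix v :: "bool \<times> nat"
    let ?X = "?D \<inter> bucket B v"
    have "(\<Sum>R\<in>Pow ?X. q ^ card R) = (1 + q) ^ card ?X"
      by (rule sum_Pow_power) simp
    also have "(1 + q) ^ card ?X \<le> exp q ^ card ?X"
      using q0 by (intro power_mono exp_ge_add_one_self) auto
    also have "\<dots> = exp (real (card ?X) * q)" by (simp add: exp_of_nat_mult)
    also have "\<dots> \<le> exp 1"
    proof -
      have "real (card ?X) * q \<le> real (N * (N div B)) * q"
        using card_bucket_le[OF B, of v] q0 by (intro mult_right_mono of_nat_mono) auto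
      also have "\<dots> = \<epsilon>"
        using N B by (simp add: NB q \<epsilon>_def power2_eq_square)
      finally show ?thesis using eps' by simp
    qed
    also have "\<dots> \<le> 3" by (rule exp_le)
    finally have sum_le: "(\<Sum>R\<in>Pow ?X. q ^ card R) \<le> 3" .
    have "(\<Sum>R\<in>Pow ?X. real (card (confusing N B y v R)) * q ^ (card R + 1)) \<le>
        (\<Sum>R\<in>Pow ?X. 2 * (real N / real B) * q ^ (card R + 1))"
    proof (intro sum_mono mult_right_mono)
      fix R assume "R \<in> Pow ?X"
      then have "R \<subseteq> ?D" by auto
      from card_confusing_le[OF B this, of y v]
      show "real (card (confusing N B y v R)) \<le> 2 * (real N / real B)"
        unfolding NB[symmetric] by linarith
    qed (use q0 in simp)
    also have "\<dots> = 2 * (real N / real B) * q * (\<Sum>R\<in>Pow ?X. q ^ card R)"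
      by (simp add: sum_distrib_left mult.assoc)
    also have "\<dots> \<le> 2 * (real N / real B) * q * 3"
      using sum_le q0 by (intro mult_left_mono) auto
    finally show "(\<Sum>R\<in>Pow ?X. real (card (confusing N B y v R)) * q ^ (card R + 1)) \<le>
        2 * (real N / real B) * q * 3" .
  qed
  also have "\<dots> = 12 * (real k / real N)"
    using N B by (simp add: card_cartesian_product q power2_eq_square)
  finally show ?thesis .
qed

lemma prob_recoverable:
  fixes N B k :: nat and S :: "(nat \<times> nat \<Rightarrow> bool) \<Rightarrow> (nat \<times> nat) set"
  assumes B: "B dvd N" "B > 0" "2 * B \<le> N" and alpha: "\<alpha> < 1" "8 * real k \<le> \<alpha> * real B"
    and S: "\<And>b. S b \<subseteq> {p \<in> {..<N} \<times> {..<N}. b p \<and> y (fst p) (snd p) \<noteq> 0}"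
  shows "measure_pmf.prob (random_set ({..<N} \<times> {..<N}) (real k / (real N)\<^sup>2))
    {b. peelable B (S b) \<and> resolvable N B y (S b)} \<ge> 1 - \<alpha>"
proof -
  define \<epsilon> where "\<epsilon> = real k / real B"
  let ?q = "real k / (real N)\<^sup>2"
  let ?M = "random_set ({..<N} \<times> {..<N}) ?q"
  have N: "N > 0" using B by linarith
  have e1: "\<epsilon> \<le> \<alpha> / 8" using alpha B by (simp add: \<epsilon>_def field_simps)
  have e0: "0 \<le> \<epsilon>" by (simp add: \<epsilon>_def)
  have eps: "\<epsilon> \<le> 1 / 8" using e1 alpha by simp
  have kB: "real k \<le> real B" using eps B by (simp add: \<epsilon>_def field_simps)
  have kN: "real k / real N \<le> \<epsilon> / 2"
  proof -
    have "real k * (2 * real B) \<le> real k * real N"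
      using B(3) by (intro mult_left_mono) (simp_all flip: of_nat_mult)
    then show ?thesis using N B by (simp add: \<epsilon>_def field_simps)
  qed
  have q1: "?q \<le> 1"
  proof -
    have "real k \<le> real N" using kB B(3) by linarith
    also have "\<dots> \<le> (real N)\<^sup>2" using N by (simp add: power2_eq_square)
    finally show ?thesis using N by (simp add: divide_simps)
  qed
  have "{b. \<not> (peelable B (S b) \<and> resolvable N B y (S b))} =
      {b. \<not> peelable B (S b)} \<union> {b. peelable B (S b) \<and> \<not> resolvable N B y (S b)}" by auto
  then have "measure_pmf.prob ?M {b. \<not> (peelable B (S b) \<and> resolvable N B y (S b))} \<le>
      measure_pmf.prob ?M {b. \<not> peelable B (S b)} +
      measure_pmf.prob ?M {b. peelable B (S b) \<and> \<not> resolvable N B y (S b)}"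
    by (simp add: measure_Un_le)
  also have "\<dots> \<le> 4 * \<epsilon>\<^sup>2 + 12 * (real k / real N)"
    unfolding \<epsilon>_def using S eps
    by (intro add_mono prob_not_peelable prob_not_resolvable B N q1 refl) (auto simp: \<epsilon>_def)
  \<comment> \<open>The first term uses \<epsilon> \<le> 1/8 and the second N \<ge> 2 B. The factor
    8 in the choice of \<open>B\<close> then gives 13/2 \<epsilon> \<le> 13/16 \<alpha>.\<close>
  also have "\<dots> \<le> \<epsilon> / 2 + 6 * \<epsilon>"
  proof (intro add_mono)
    have "\<epsilon> * \<epsilon> \<le> (1 / 8) * \<epsilon>" using e0 eps by (intro mult_right_mono) auto
    then show "4 * \<epsilon>\<^sup>2 \<le> \<epsilon> / 2" by (simp add: power2_eq_square)
  qed (use kN in auto)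
  also have "\<dots> \<le> \<alpha>" using e1 e0 by simp
  finally have "measure_pmf.prob ?M {b. \<not> (peelable B (S b) \<and> resolvable N B y (S b))} \<le> \<alpha>" .
  moreover have "measure_pmf.prob ?M {b. \<not> (peelable B (S b) \<and> resolvable N B y (S b))} =
      1 - measure_pmf.prob ?M {b. peelable B (S b) \<and> resolvable N B y (S b)}"
    using measure_pmf.prob_compl[of "{b. peelable B (S b) \<and> resolvable N B y (S b)}" ?M]
    by (simp add: Collect_neg_eq Compl_eq_Diff_UNIV del: de_Morgan_conj)
  ultimately show ?thesis by linarith
qed

section \<open>Rounds of the peeling process\<close>

definition bucket_index :: "nat \<Rightarrow> bool \<times> nat \<Rightarrow> nat" where
  "bucket_index B b = (if fst b then B else 0) + snd b"

lemma bucket_index_less: "snd b < B \<Longrightarrow> bucket_index B b < 2 * B"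
  by (simp add: bucket_index_def)

lemma bucket_index_inj:
  "snd b < B \<Longrightarrow> snd b' < B \<Longrightarrow> bucket_index B b = bucket_index B b' \<Longrightarrow> b = b'"
  by (auto simp: bucket_index_def prod_eq_iff split: if_splits)

definition point_of :: "bool \<Rightarrow> nat \<Rightarrow> nat \<Rightarrow> nat \<times> nat" where
  "point_of t u v = (if t then (v, u) else (u, v))"

text \<open>
  The set \<open>T\<close> contains the points that have not been found after \<open>m\<close> rounds. Buckets with an index
  below \<open>fresh\<close> have been examined, and only the bucket \<open>cur\<close> may have become a singleton since then.
\<close>

definition peel_inv :: "nat \<Rightarrow> nat \<Rightarrow> signal \<Rightarrow> (nat \<times> nat) set \<Rightarrow> nat \<Rightarrow> nat \<Rightarrow> nat \<Rightarrow>
    (bool \<times> nat \<Rightarrow> nat \<Rightarrow> complex) \<Rightarrow> ((nat \<times> nat) \<times> complex) list \<Rightarrow> bool" where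
  "peel_inv N B y S m cur fresh u es \<longleftrightarrow> (\<exists>T\<subseteq>S.
    (\<forall>b s. snd b < B \<longrightarrow> s < 5 \<longrightarrow> u b s = bucket_sum N B y T b s) \<and>
    distinct (map fst es) \<and> fst ` set es = S - T \<and>
    (\<forall>(p, v)\<in>set es. v = y (fst p) (snd p)) \<and>
    (\<forall>b. snd b < B \<longrightarrow> bucket_index B b < fresh \<longrightarrow> bucket_index B b \<noteq> cur \<longrightarrow>
      \<not> (\<exists>p. T \<inter> bucket B b = {p})) \<and>
    (if cur < 2 * B then fresh \<le> 2 * B \<and> fresh + card (S - T) = m + 1 else 2 * B < fresh))"

text \<open>Bucket 0 is current and already counted as taken, so \<open>fresh\<close> starts at 1.
  From here on \<open>fresh\<close> plus the number of points found grows by one per active round;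
  this potential bounds the rounds.\<close>

lemma peel_inv_init:
  assumes "B > 0" "\<And>b s. snd b < B \<Longrightarrow> s < 5 \<Longrightarrow> u b s = bucket_sum N B y S b s"
  shows "peel_inv N B y S 0 0 1 u []"
  unfolding peel_inv_def using assms by (intro exI[of _ S]) auto

text \<open>Once the current index has left the range, rounds pass without effect, so the loop can
  have a fixed length.\<close>

lemma peel_inv_idle:
  "peel_inv N B y S m cur fresh u es \<Longrightarrow> 2 * B \<le> cur \<Longrightarrow> peel_inv N B y S m' cur fresh u es"
  unfolding peel_inv_def by (simp add: not_less[symmetric])

lemma accepts_cong: "(\<And>s. s < 5 \<Longrightarrow> u s = u' s) \<Longrightarrow> accepts N u \<longleftrightarrow> accepts N u'"
  by (simp add: accepts_def)

context
  fixes N B :: nat and y :: signal and S :: "(nat \<times> nat) set"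
  assumes B: "B > 0"
    and S: "S \<subseteq> {p \<in> {..<N} \<times> {..<N}. y (fst p) (snd p) \<noteq> 0}"
    and resolvable: "resolvable N B y S"
begin

text \<open>A rejected bucket is no singleton, so its exemption in the invariant ends and passes to
  the next unexamined bucket.\<close>

lemma peel_inv_fail:
  assumes inv: "peel_inv N B y S m cur fresh u es" and b: "cur = bucket_index B b" "snd b < B"
    and rej: "\<not> accepts N (u b)"
  shows "peel_inv N B y S (Suc m) fresh (Suc fresh) u es"
proof -
  obtain T where T: "T \<subseteq> S" "\<And>b s. snd b < B \<Longrightarrow> s < 5 \<Longrightarrow> u b s = bucket_sum N B y T b s"
    "distinct (map fst es)" "fst ` set es = S - T" "\<forall>(p, v)\<in>set es. v = y (fst p) (snd p)"
    and non: "\<And>b. snd b < B \<Longrightarrow> bucket_index B b < fresh \<Longrightarrow> bucket_index B b \<noteq> cur \<Longrightarrow>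
      \<not> (\<exists>p. T \<inter> bucket B b = {p})"
    and cnt: "if cur < 2 * B then fresh \<le> 2 * B \<and> fresh + card (S - T) = m + 1 else 2 * B < fresh"
    using inv unfolding peel_inv_def by auto
  have "\<not> accepts N (bucket_sum N B y T b)"
    using rej accepts_cong[of "u b" "bucket_sum N B y T b"] T(2)[OF b(2)] by auto
  then have nb: "\<not> (\<exists>p. T \<inter> bucket B b = {p})"
    using accepts_bucket_sum_iff[OF resolvable T(1) S B] by simp
  have cur: "cur < 2 * B" using b bucket_index_less by simp
  have non': "\<not> (\<exists>p. T \<inter> bucket B b' = {p})"
    if "snd b' < B" "bucket_index B b' < Suc fresh" "bucket_index B b' \<noteq> fresh" for b'
  proof (cases "b' = b")
    case False
    then have "bucket_index B b' \<noteq> cur" using bucket_index_inj[OF that(1) b(2)] b(1) by auto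
    then show ?thesis using non[of b'] that by simp
  qed (use nb in simp)
  show ?thesis
    unfolding peel_inv_def
    by (rule exI[of _ T]) (use T non' cnt cur in auto)
qed

lemma peel_inv_pass:
  assumes inv: "peel_inv N B y S m cur fresh u es" and b: "cur = bucket_index B b" "snd b < B"
    and acc: "accepts N (u b)"
  defines "v \<equiv> phase_index N (u b 4 / u b 0)" and "w \<equiv> phase_index N (u b 1 / u b 0)"
  defines "p \<equiv> point_of (fst b) v w" and "b' \<equiv> (\<not> fst b, w mod B)"
  assumes u': "\<And>s. s < 5 \<Longrightarrow> u' b s = 0"
    "\<And>s. s < 5 \<Longrightarrow> u' b' s = u b' s - u b 0 * shift_factor N (fst b') s p"
    "\<And>b'' s. s < 5 \<Longrightarrow> snd b'' < B \<Longrightarrow> b'' \<noteq> b \<Longrightarrow> b'' \<noteq> b' \<Longrightarrow> u' b'' s = u b'' s"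
  shows "peel_inv N B y S (Suc m) (bucket_index B b') fresh u'
    ((p, u b 0 * of_nat N / of_nat B) # es)"
proof -
  obtain T where T: "T \<subseteq> S" "\<And>b s. snd b < B \<Longrightarrow> s < 5 \<Longrightarrow> u b s = bucket_sum N B y T b s"
    "distinct (map fst es)" "fst ` set es = S - T" "\<forall>(p, v)\<in>set es. v = y (fst p) (snd p)"
    and non: "\<And>b. snd b < B \<Longrightarrow> bucket_index B b < fresh \<Longrightarrow> bucket_index B b \<noteq> cur \<Longrightarrow>
      \<not> (\<exists>p. T \<inter> bucket B b = {p})"
    and cnt: "if cur < 2 * B then fresh \<le> 2 * B \<and> fresh + card (S - T) = m + 1 else 2 * B < fresh"
    using inv unfolding peel_inv_def by auto
  have finS: "finite S" using S by (rule finite_subset) simp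
  then have finT: "finite T" using T(1) finite_subset by blast
  have "accepts N (bucket_sum N B y T b)"
    using acc accepts_cong[of "u b" "bucket_sum N B y T b"] T(2)[OF b(2)] by auto
  then obtain p' where p': "T \<inter> bucket B b = {p'}"
    using accepts_bucket_sum_iff[OF resolvable T(1) S B] by auto
  then have p'T: "p' \<in> T" "p' \<in> bucket B b" by auto
  then have p'S: "p' \<in> {..<N} \<times> {..<N}" "y (fst p') (snd p') \<noteq> 0" using T(1) S by blast+
  note sing = accepts_singleton[where y = y, OF p' p'S B]
  have v: "v = own (fst b) p'" and w: "w = own (\<not> fst b) p'"
    using sing(2,3) T(2)[OF b(2)] by (simp_all add: v_def w_def)
  have p: "p = p'"
    unfolding p_def v w by (auto simp: point_of_def own_def)
  have val: "u b 0 * of_nat N / of_nat B = y (fst p) (snd p)"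
    using sing(4) T(2)[OF b(2)] p by simp
  have u0: "u b 0 = of_nat B / of_nat N * y (fst p) (snd p)"
    using bucket_sum_singleton[OF p', of N y 0] T(2)[OF b(2)] p by (simp add: shift_factor_def)
  have b': "p \<in> bucket B b'" "snd b' < B" "b' \<noteq> b"
    using B by (auto simp: b'_def bucket_def p w prod_eq_iff)
  have only: "p \<notin> bucket B b''" if "b'' \<noteq> b" "b'' \<noteq> b'" for b''
    using that p'T(2) unfolding p
    by (cases "fst b''"; cases "fst b") (auto simp: bucket_def b'_def w prod_eq_iff)
  define T' where "T' = T - {p}"
  have sums: "u' b'' s = bucket_sum N B y T' b'' s" if "snd b'' < B" "s < 5" for b'' s
  proof -
    have rem: "bucket_sum N B y T' b'' s = bucket_sum N B y T b'' s -
      (if p \<in> bucket B b'' then u b 0 * shift_factor N (fst b'') s p else 0)"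
      unfolding T'_def u0 using bucket_sum_remove[OF finT] p'T p by simp
    consider "b'' = b" | "b'' = b'" | "b'' \<noteq> b" "b'' \<noteq> b'" by blast
    then show ?thesis
    proof cases
      case 1
      have "T' \<inter> bucket B b = {}" using p' p by (auto simp: T'_def)
      then show ?thesis using 1 u'(1) that by (simp add: bucket_sum_empty)
    next
      case 2
      then show ?thesis using u'(2) rem b' T(2) that by simp
    next
      case 3
      then show ?thesis using u'(3) rem only T(2) that by simp
    qed
  qed
  have dist: "distinct (map fst ((p, u b 0 * of_nat N / of_nat B) # es))"
    using T(3,4) p'T p by auto
  have fsts: "fst ` set ((p, u b 0 * of_nat N / of_nat B) # es) = S - T'"
    using T(1,4) p'T p by (auto simp: T'_def)
  have vals: "\<forall>(q, v)\<in>set ((p, u b 0 * of_nat N / of_nat B) # es). v = y (fst q) (snd q)"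
    using T(5) val by auto
  have non': "\<not> (\<exists>q. T' \<inter> bucket B b'' = {q})"
    if "snd b'' < B" "bucket_index B b'' < fresh" "bucket_index B b'' \<noteq> bucket_index B b'" for b''
  proof (cases "b'' = b")
    case True
    then have "T' \<inter> bucket B b'' = {}" using p' p by (auto simp: T'_def)
    then show ?thesis by simp
  next
    case False
    have "b'' \<noteq> b'" using that(3) by auto
    then have "T' \<inter> bucket B b'' = T \<inter> bucket B b''"
      using only[OF False] by (auto simp: T'_def)
    moreover have "bucket_index B b'' \<noteq> cur" using False bucket_index_inj[OF that(1) b(2)] b(1) by auto
    ultimately show ?thesis using non[OF that(1,2)] by simp
  qed
  have "S - T' = insert p (S - T)" using T(1) p'T p by (auto simp: T'_def)
  then have "card (S - T') = Suc (card (S - T))"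
    using finS p'T p by simp
  moreover have "cur < 2 * B" using b bucket_index_less by simp
  ultimately have cnt': "if bucket_index B b' < 2 * B
      then fresh \<le> 2 * B \<and> fresh + card (S - T') = Suc m + 1 else 2 * B < fresh"
    using cnt bucket_index_less[OF b'(2)] by simp
  have "T' \<subseteq> S" using T(1) by (auto simp: T'_def)
  then show ?thesis
    unfolding peel_inv_def using sums dist fsts vals non' cnt' by (intro exI[of _ T'] conjI) blast+
qed

text \<open>There are at most \<open>2 * B\<close> rejections and, by \<open>peelable_card\<close>,
  at most \<open>2 * B\<close> removals, so after \<open>4 * B\<close> rounds the count rules out an
  active bucket. Then no bucket is a singleton, and the remaining set, having no leaf, is
  empty.\<close>

lemma peel_inv_final:
  assumes inv: "peel_inv N B y S (4 * B) cur fresh u es" and peel: "peelable B S"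
  shows "distinct (map fst es)" "fst ` set es = S" "\<forall>(p, v)\<in>set es. v = y (fst p) (snd p)"
proof -
  obtain T where T: "T \<subseteq> S"
    "distinct (map fst es)" "fst ` set es = S - T" "\<forall>(p, v)\<in>set es. v = y (fst p) (snd p)"
    and non: "\<And>b. snd b < B \<Longrightarrow> bucket_index B b < fresh \<Longrightarrow> bucket_index B b \<noteq> cur \<Longrightarrow>
      \<not> (\<exists>p. T \<inter> bucket B b = {p})"
    and cnt: "if cur < 2 * B then fresh \<le> 2 * B \<and> fresh + card (S - T) = 4 * B + 1 else 2 * B < fresh"
    using inv unfolding peel_inv_def by auto
  have finS: "finite S" using S by (rule finite_subset) simp
  have "card (S - T) \<le> 2 * B"
    using peelable_card[OF peel finS B] card_mono[OF finS Diff_subset, of T] by linarith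
  then have cur: "\<not> cur < 2 * B" using cnt by (auto split: if_splits)
  have "T = {}"
  proof (rule ccontr)
    assume "T \<noteq> {}"
    then obtain b p where bp: "T \<inter> bucket B b = {p}"
      using peel T(1) unfolding peelable_def by blast
    then have "p \<in> bucket B b" by auto
    then have sb: "snd b < B" using B by (auto simp: bucket_def) (metis mod_less_divisor)
    then show False
      using non[OF sb] bucket_index_less[OF sb] cur cnt bp by auto
  qed
  then show "distinct (map fst es)" "fst ` set es = S" "\<forall>(p, v)\<in>set es. v = y (fst p) (snd p)"
    using T by auto
qed

end

section \<open>The program\<close>

definition reg :: "nat \<Rightarrow> wexp" where "reg i = WMem (WConst i)"

text \<open>
  Word registers: 0: \<open>N\<close>, 1: \<open>k\<close>, 2: \<open>B\<close>, 3: stride of the current Fourier level, 4: loop counter,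
  5: address of the current level, 6: scratch, 7 and 8: current and first unexamined bucket,
  9 and 10: decoded coordinates, 11 and 12: addresses. The complex cell 1 is scratch; arrays start
  at the cell 16.
\<close>

definition choose_size :: com where
  "choose_size = Seq (WStore (WConst 2) (WConst 1))
    (While (CLess (CMul (CMem (WConst 0)) (CWord (reg 2))) (CWord (WMul (WConst 8) (reg 1))))
      (WStore (WConst 2) (WAdd (reg 2) (reg 2))))"

text \<open>The counter is a mixed-radix number: modulo \<open>B\<close> it is the position on the
  line, and the quotient runs through the five shifts of one direction and then through those of the
  other. The samples thus form ten consecutive arrays of length \<open>B\<close>.\<close>

definition sample_body :: com where
  "sample_body =
    Seq (WStore (WConst 9) (WAdd (WMul (WMod (reg 4) (reg 2)) (WDiv (reg 0) (reg 2)))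
      (WDiv (WMod (WDiv (reg 4) (reg 2)) (WConst 5)) (WConst 4))))
    (Seq (WStore (WConst 10) (WMod (WMod (WDiv (reg 4) (reg 2)) (WConst 5)) (WConst 4)))
    (Seq (Ite (WLess (reg 4) (WMul (WConst 5) (reg 2)))
      (Sample (WAdd (WConst 16) (reg 4)) (reg 9) (reg 10))
      (Sample (WAdd (WConst 16) (reg 4)) (reg 10) (reg 9)))
    (WStore (WConst 4) (WAdd (reg 4) (WConst 1)))))"

definition sample_lines :: com where
  "sample_lines = Seq (WStore (WConst 4) (WConst 0))
    (While (WLess (reg 4) (WMul (WConst 10) (reg 2))) sample_body)"

text \<open>All ten transforms advance together. The new level goes to the next
  \<open>10 * B\<close> cells, as the packed order reads and writes at different positions.\<close>

definition fft_body :: com where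
  "fft_body =
    Seq (WStore (WConst 6) (WMod (WMod (reg 4) (reg 2)) (reg 3)))
    (Seq (WStore (WConst 11) (WAdd (WAdd (reg 5) (WSub (reg 4) (WMod (reg 4) (reg 2))))
      (WAdd (WMod (WMul (WConst 2) (WSub (WMod (reg 4) (reg 2)) (reg 6))) (reg 2)) (reg 6))))
    (Seq (CStore (WAdd (WAdd (reg 5) (WMul (WConst 10) (reg 2))) (reg 4))
      (CAdd (CMem (reg 11)) (CMul (CRoot (WSub (WMod (reg 4) (reg 2)) (reg 6)) (reg 2))
        (CMem (WAdd (reg 11) (reg 3))))))
    (WStore (WConst 4) (WAdd (reg 4) (WConst 1)))))"

definition fft_next :: com where
  "fft_next =
    Seq (WStore (WConst 3) (WDiv (reg 3) (WConst 2)))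
    (Seq (WStore (WConst 4) (WConst 0))
    (Seq (While (WLess (reg 4) (WMul (WConst 10) (reg 2))) fft_body)
    (WStore (WConst 5) (WAdd (reg 5) (WMul (WConst 10) (reg 2))))))"

definition fft :: com where
  "fft = Seq (Seq (WStore (WConst 5) (WConst 16)) (WStore (WConst 3) (reg 2)))
    (While (WLess (WConst 1) (reg 3)) fft_next)"

definition shift_cell :: "nat \<Rightarrow> nat \<Rightarrow> wexp" where
  "shift_cell a s = WAdd (reg a) (WMul (WConst s) (reg 2))"

definition decode :: com where
  "decode =
    Seq (WStore (WConst 11) (WAdd (WAdd (reg 5) (WMul (WDiv (reg 7) (reg 2)) (WMul (WConst 5) (reg 2))))
      (WMod (reg 7) (reg 2))))
    (Seq (CStore (WConst 1) (CMem (shift_cell 11 0)))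
    (Seq (Phase (WConst 10) (CDiv (CMem (shift_cell 11 1)) (CMem (WConst 1))) (reg 0))
    (Phase (WConst 9) (CDiv (CMem (shift_cell 11 4)) (CMem (WConst 1))) (reg 0))))"

definition check_shift :: "nat \<Rightarrow> bexp" where
  "check_shift s = CEq (CMul (CMem (shift_cell 11 s)) (CRoot (WMul (WConst s) (reg 10)) (reg 0)))
    (CMem (WConst 1))"

definition accept_test :: bexp where
  "accept_test = BAnd (BNot (CEq (CMem (WConst 1)) (CWord (WConst 0))))
    (BAnd (check_shift 1) (BAnd (check_shift 2) (check_shift 3)))"

text \<open>The branches are the two directions. Besides emitting the entry, rescaled by N / B, they
  store the address and the index of the other bucket of the point, which becomes current.\<close>

definition locate :: com where
  "locate = Ite (WLess (reg 7) (reg 2))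
    (Seq (Emit (reg 9) (reg 10) (CMul (CMem (WConst 1)) (CWord (WDiv (reg 0) (reg 2)))))
    (Seq (WStore (WConst 12) (WAdd (WAdd (reg 5) (WMul (WConst 5) (reg 2))) (WMod (reg 10) (reg 2))))
    (WStore (WConst 7) (WAdd (reg 2) (WMod (reg 10) (reg 2))))))
    (Seq (Emit (reg 10) (reg 9) (CMul (CMem (WConst 1)) (CWord (WDiv (reg 0) (reg 2)))))
    (Seq (WStore (WConst 12) (WAdd (reg 5) (WMod (reg 10) (reg 2))))
    (WStore (WConst 7) (WMod (reg 10) (reg 2)))))"

definition clear_shift :: "nat \<Rightarrow> com" where
  "clear_shift s = CStore (shift_cell 11 s) (CWord (WConst 0))"

definition subtract_shift :: "nat \<Rightarrow> wexp \<Rightarrow> com" where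
  "subtract_shift s e = CStore (shift_cell 12 s)
    (CSub (CMem (shift_cell 12 s)) (CDiv (CMem (WConst 1)) (CRoot e (reg 0))))"

text \<open>In the other bucket the coordinates exchange roles: register 9 enters the shifts 0 to 3
  and register 10 the shift 4. The bucket of the singleton itself is still addressed through
  register 11, which \<open>locate\<close> leaves alone.\<close>

definition peel :: com where
  "peel = Seq locate
    (Seq (Seq (clear_shift 0) (Seq (clear_shift 1) (Seq (clear_shift 2)
      (Seq (clear_shift 3) (clear_shift 4)))))
    (Seq (subtract_shift 0 (WMul (WConst 0) (reg 9)))
    (Seq (subtract_shift 1 (WMul (WConst 1) (reg 9)))
    (Seq (subtract_shift 2 (WMul (WConst 2) (reg 9)))
    (Seq (subtract_shift 3 (WMul (WConst 3) (reg 9)))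
    (subtract_shift 4 (reg 10)))))))"

definition advance :: com where
  "advance = Seq (WStore (WConst 7) (reg 8)) (WStore (WConst 8) (WAdd (reg 8) (WConst 1)))"

definition peel_body :: com where
  "peel_body = Seq (Ite (WLess (reg 7) (WMul (WConst 2) (reg 2)))
      (Seq decode (Ite accept_test peel advance)) Skip)
    (WStore (WConst 4) (WAdd (reg 4) (WConst 1)))"

definition peel_loop :: com where
  "peel_loop = Seq (Seq (WStore (WConst 7) (WConst 0)) (Seq (WStore (WConst 8) (WConst 1))
      (WStore (WConst 4) (WConst 0))))
    (While (WLess (reg 4) (WMul (WConst 4) (reg 2))) peel_body)"

definition sparse_fft :: com where
  "sparse_fft = Seq choose_size (Seq sample_lines (Seq fft peel_loop))"

text \<open>Constants are reduced modulo the word size, so even register numbers require a large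
  enough \<open>W\<close>.\<close>

lemma wval_small:
  assumes "16 < W" "i \<le> 16"
  shows "wval W s (reg i) = wmem s i" "wval W s (WConst i) = i"
  using assms by (simp_all add: reg_def)

section \<open>Sampling and Fourier phases: effect, running time, absence of overflow\<close>

context
  fixes N :: nat and W :: nat
  defines "W \<equiv> word_limit N"
begin

lemma exec_sample_body:
  fixes x :: signal
  assumes s: "wmem s 0 = N" "wmem s 2 = B" "wmem s 4 = e"
    and e: "e < 10 * B" and B: "B > 0" "2 * B \<le> N" and W: "100 * N < W"
  defines "s' \<equiv> exec N x sample_body s"
  shows "wmem s' 0 = N" "wmem s' 2 = B" "wmem s' 4 = Suc e" "out s' = out s"
    "samples s' = Suc (samples s)"
    "cmem s' = (cmem s)(16 + e :=
      line_sample N B x (5 \<le> e div B) (e div B mod 5) (e mod B))"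
proof -
  have NW: "e + 16 < W" "5 * B < W" "16 < W" "N + 2 < W" using e B W by linarith+
  have "e mod B * (N div B) \<le> B * (N div B)" using B by (intro mult_le_mono1) simp
  also have "\<dots> \<le> N" by simp
  finally have le: "e mod B * (N div B) \<le> N" .
  have d: "e div B mod 5 div 4 \<le> 1" by (simp add: less_Suc_eq_le[symmetric] div_less_iff_less_mult)
  have mods: "e mod B * (N div B) mod W = e mod B * (N div B)"
    "(e mod B * (N div B) + e div B mod 5 div 4) mod W = e mod B * (N div B) + e div B mod 5 div 4"
    "5 * B mod W = 5 * B" "(16 + e) mod W = 16 + e" "Suc e mod W = Suc e"
    using le d NW by simp_all
  have c: "e < 5 * B \<longleftrightarrow> \<not> 5 \<le> e div B"
    using B by (simp add: not_le div_less_iff_less_mult)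
  show "wmem s' 0 = N" "wmem s' 2 = B" "wmem s' 4 = Suc e" "out s' = out s"
    "samples s' = Suc (samples s)"
    "cmem s' = (cmem s)(16 + e :=
      line_sample N B x (5 \<le> e div B) (e div B mod 5) (e mod B))"
    unfolding s'_def sample_body_def
    by (simp_all add: Let_def W_def[symmetric] line_sample_def wval_small[OF NW(3)] s mods c
        del: wval.simps(1))
qed

lemma exec_fft_body:
  fixes x :: signal
  assumes s: "wmem s 0 = N" "wmem s 2 = B" "wmem s 3 = h" "wmem s 4 = e" "wmem s 5 = off"
    and e: "e < 10 * B" and B: "B > 0" "2 * B \<le> N" and h: "h > 0" "h \<le> B"
    and W: "off + 100 * N < W" and off: "off \<ge> 16"
  defines "s' \<equiv> exec N x fft_body s"
  defines "i \<equiv> e mod B" and "a \<equiv> off + e - e mod B + ((2 * (e mod B - e mod B mod h)) mod B + e mod B mod h)"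
  shows "wmem s' 0 = N" "wmem s' 2 = B" "wmem s' 3 = h" "wmem s' 4 = Suc e" "wmem s' 5 = off"
    "out s' = out s" "samples s' = samples s"
    "cmem s' = (cmem s)(off + 10 * B + e :=
      cmem s a + omega B ^ (i - i mod h) * cmem s (a + h))"
proof -
  have i: "i < B" "i mod h < h" using B h by (simp_all add: i_def)
  have m2: "(2 * (i - i mod h)) mod B < B" using B by simp
  have bnd: "e + 16 < W" "10 * B < W" "16 < W" "Suc e < W" "2 * (i - i mod h) < W" "off + e - i < W"
    "(2 * (i - i mod h)) mod B + i mod h < W" "a < W" "a + h < W" "off + 10 * B + e < W"
    "off + 10 * B < W"
    using e B W i m2 h unfolding a_def i_def[symmetric] by linarith+
  note mods = bnd[unfolded a_def, folded i_def, THEN mod_less]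
  show "wmem s' 0 = N" "wmem s' 2 = B" "wmem s' 3 = h" "wmem s' 4 = Suc e" "wmem s' 5 = off"
    "out s' = out s" "samples s' = samples s"
    "cmem s' = (cmem s)(off + 10 * B + e :=
      cmem s a + omega B ^ (i - i mod h) * cmem s (a + h))"
    unfolding s'_def fft_body_def
    by (simp_all add: Let_def W_def[symmetric] i_def[symmetric] a_def[folded i_def]
        wval_small[OF bnd(3)] s mods del: wval.simps(1))
qed

lemma wp_choose_size:
  assumes b: "\<And>i. i < b \<Longrightarrow> \<alpha> * 2 ^ i < 8 * real k" "\<not> \<alpha> * 2 ^ b < 8 * real k"
    and W: "2 ^ b \<le> N" "k \<le> N" "100 * N < W" and T: "3 * b + 3 \<le> T"
  shows "wp N x choose_size T (\<lambda>s. wmem s 0 = N \<and> wmem s 2 = 2 ^ b \<and> samples s = 0 \<and> out s = [])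
    (init_state N k \<alpha>)"
proof -
  define I where "I i s \<longleftrightarrow> wmem s 0 = N \<and> wmem s 1 = k \<and> wmem s 2 = 2 ^ i \<and>
    cmem s 0 = of_real \<alpha> \<and> samples s = 0 \<and> out s = []" for i and s :: state
  have N: "N > 0" using W(1) by (metis less_le_trans zero_less_numeral zero_less_power)
  have NW: "16 < W" "8 * k < W" "1 < W" using W N by linarith+
  note small = wval_small[OF NW(1)]
  have start: "I 0 (exec N x (WStore (WConst 2) (WConst 1)) (init_state N k \<alpha>))"
    by (simp add: I_def init_state_def Let_def W_def[symmetric] small del: wval.simps(1))
  have guard: "bval (word_limit N) s (CLess (CMul (CMem (WConst 0)) (CWord (reg 2)))
      (CWord (WMul (WConst 8) (reg 1)))) \<longleftrightarrow> \<alpha> * 2 ^ i < 8 * real k" if "I i s" for i s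
    using that NW(2) by (simp add: I_def small W_def[symmetric] del: wval.simps(1))
  have body: "I (Suc i) (exec N x (WStore (WConst 2) (WAdd (reg 2) (reg 2))) s)"
    if "i < b" "I i s" for i s
  proof -
    have "(2::nat) ^ Suc i \<le> 2 ^ b" using that(1) by (intro power_increasing) auto
    then have "(2::nat) ^ i + 2 ^ i < W" using W N by simp
    then show ?thesis
      using that(2) by (simp add: I_def small W_def[symmetric] Let_def del: wval.simps(1))
  qed
  show ?thesis
    unfolding choose_size_def
  proof (rule wp_Seq)
    show "wp N x (WStore (WConst 2) (WConst 1)) 1 (I 0) (init_state N k \<alpha>)"
      by (rule wp_straight) (use start in simp_all)
    fix s assume "I 0 s"
    then have "wp N x (While (CLess (CMul (CMem (WConst 0)) (CWord (reg 2)))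
        (CWord (WMul (WConst 8) (reg 1)))) (WStore (WConst 2) (WAdd (reg 2) (reg 2))))
        (b * (1 + 2) + 1) (I b) s"
    proof (rule wp_While[rotated 2])
      fix i s assume i: "i < b" "I i s"
      show "bval (word_limit N) s (CLess (CMul (CMem (WConst 0)) (CWord (reg 2)))
          (CWord (WMul (WConst 8) (reg 1)))) \<and>
        wp N x (WStore (WConst 2) (WAdd (reg 2) (reg 2))) 1 (I (Suc i)) s"
        using guard[OF i(2)] b(1)[OF i(1)] by (simp only: simp_thms)
          (rule wp_straight; use body[OF i] in simp)
    qed (use guard b(2) in auto)
    then show "wp N x (While (CLess (CMul (CMem (WConst 0)) (CWord (reg 2)))
        (CWord (WMul (WConst 8) (reg 1)))) (WStore (WConst 2) (WAdd (reg 2) (reg 2))))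
        (b * (1 + 2) + 1) (\<lambda>s. wmem s 0 = N \<and> wmem s 2 = 2 ^ b \<and> samples s = 0 \<and> out s = []) s"
      by (rule wp_mono) (auto simp: I_def)
  qed (use T in simp)
qed

definition line_value :: "nat \<Rightarrow> signal \<Rightarrow> nat \<Rightarrow> nat \<Rightarrow> complex" where
  "line_value B x g l = line_sample N B x (5 \<le> g) (g mod 5) l"

definition sampled :: "nat \<Rightarrow> signal \<Rightarrow> state \<Rightarrow> bool" where
  "sampled B x s \<longleftrightarrow> wmem s 0 = N \<and> wmem s 2 = B \<and> samples s = 10 * B \<and> out s = [] \<and>
    (\<forall>m<10 * B. cmem s (16 + m) = line_value B x (m div B) (m mod B))"

lemma wp_sample_lines:
  assumes s: "wmem s 0 = N" "wmem s 2 = B" "samples s = 0" "out s = []"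
    and B: "B > 0" "2 * B \<le> N" and W: "100 * N < W" and T: "220 * B + 3 \<le> T"
  shows "wp N x sample_lines T (sampled B x) s"
proof -
  define I where "I e s \<longleftrightarrow> wmem s 0 = N \<and> wmem s 2 = B \<and> wmem s 4 = e \<and> samples s = e \<and>
    out s = [] \<and> (\<forall>m<e. cmem s (16 + m) = line_value B x (m div B) (m mod B))" for e and s :: state
  have NW: "16 < W" "10 * B < W" using W B by linarith+
  note small = wval_small[OF NW(1)]
  have start: "I 0 (exec N x (WStore (WConst 4) (WConst 0)) s)"
    by (simp add: I_def s Let_def W_def[symmetric] small del: wval.simps(1))
  have guard: "bval (word_limit N) s (WLess (reg 4) (WMul (WConst 10) (reg 2))) \<longleftrightarrow> e < 10 * B"
    if "I e s" for e s
    using that NW(2) by (simp add: I_def small W_def[symmetric] del: wval.simps(1))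
  have body: "I (Suc e) (exec N x sample_body s)" if e: "e < 10 * B" and I: "I e s" for e s
  proof -
    have s: "wmem s 0 = N" "wmem s 2 = B" "wmem s 4 = e" using I by (simp_all add: I_def)
    note ex = exec_sample_body[OF s e B W, of x]
    show ?thesis
      using I unfolding I_def ex by (auto simp: less_Suc_eq line_value_def)
  qed
  show ?thesis
    unfolding sample_lines_def
  proof (rule wp_Seq)
    show "wp N x (WStore (WConst 4) (WConst 0)) 1 (I 0) s"
      by (rule wp_straight) (use start in simp_all)
    fix s assume "I 0 s"
    then have "wp N x (While (WLess (reg 4) (WMul (WConst 10) (reg 2))) sample_body)
        (10 * B * (20 + 2) + 1) (I (10 * B)) s"
    proof (rule wp_While[rotated 2])
      fix e s assume e: "e < 10 * B" "I e s"
      show "bval (word_limit N) s (WLess (reg 4) (WMul (WConst 10) (reg 2))) \<and>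
        wp N x sample_body 20 (I (Suc e)) s"
        using guard[OF e(2)] e(1) wp_straight[of sample_body 20 "I (Suc e)", OF _ _ body[OF e]]
        by (simp add: sample_body_def)
    qed (use guard in auto)
    then show "wp N x (While (WLess (reg 4) (WMul (WConst 10) (reg 2))) sample_body)
        (10 * B * (20 + 2) + 1) (sampled B x) s"
      by (rule wp_mono) (auto simp: I_def sampled_def)
  qed (use T in simp)
qed

definition level_value :: "nat \<Rightarrow> signal \<Rightarrow> nat \<Rightarrow> nat \<Rightarrow> complex" where
  "level_value B x h m = fft_level B (line_value B x (m div B)) h (m mod B)"

definition level_state :: "nat \<Rightarrow> signal \<Rightarrow> nat \<Rightarrow> nat \<Rightarrow> state \<Rightarrow> bool" where
  "level_state B x h off s \<longleftrightarrow> wmem s 0 = N \<and> wmem s 2 = B \<and> wmem s 3 = h \<and> wmem s 5 = off \<and>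
    samples s = 10 * B \<and> out s = [] \<and> (\<forall>m<10 * B. cmem s (off + m) = level_value B x h m)"

text \<open>The butterfly stays inside the block of length \<open>B\<close> of its line, so one loop
  over \<open>10 * B\<close> cells serves all ten transforms.\<close>

lemma level_value_step:
  assumes "2 * h dvd B" "h > 0" "B > 0" "e < 10 * B"
  defines "m \<equiv> e - e mod B + ((2 * (e mod B - e mod B mod h)) mod B + e mod B mod h)"
  shows "level_value B x h e =
    level_value B x (2 * h) m + omega B ^ (e mod B - e mod B mod h) * level_value B x (2 * h) (m + h)"
    and "m + h < 10 * B"
proof -
  define i' where "i' = (2 * (e mod B - e mod B mod h)) mod B + e mod B mod h"
  have i': "i' + h < B"
    using fft_level_step(2)[OF assms(1-3), of "e mod B"] assms(3) by (simp add: i'_def)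
  have m: "m = e div B * B + i'"
    by (simp add: m_def i'_def minus_mod_eq_div_mult)
  have "m div B = e div B" "m mod B = i'" "(m + h) div B = e div B" "(m + h) mod B = i' + h"
    unfolding m add.assoc using i' by simp_all
  then show "level_value B x h e = level_value B x (2 * h) m +
      omega B ^ (e mod B - e mod B mod h) * level_value B x (2 * h) (m + h)"
    unfolding level_value_def by (simp only: i'_def fft_level_step(1)[OF assms(1-3)])
  have "e div B + 1 \<le> 10"
    using assms(3,4) by (simp add: div_less_iff_less_mult Suc_le_eq)
  then have "(e div B + 1) * B \<le> 10 * B" by (rule mult_le_mono1)
  then show "m + h < 10 * B" using i' unfolding m add_mult_distrib by linarith
qed

lemma wp_fft_next:
  assumes s: "level_state B x (2 * h) off s"
    and h: "2 * h dvd B" "h > 0" and B: "B > 0" "2 * B \<le> N"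
    and W: "off + 100 * N < W" "off \<ge> 16" and T: "220 * B + 8 \<le> T"
  shows "wp N x fft_next T (level_state B x h (off + 10 * B)) s"
proof -
  \<comment> \<open>The old level stays intact while the new one is filled in behind it.\<close>
  define I where "I e s \<longleftrightarrow> wmem s 0 = N \<and> wmem s 2 = B \<and> wmem s 3 = h \<and> wmem s 4 = e \<and>
    wmem s 5 = off \<and> samples s = 10 * B \<and> out s = [] \<and>
    (\<forall>m<10 * B. cmem s (off + m) = level_value B x (2 * h) m) \<and>
    (\<forall>m<e. cmem s (off + 10 * B + m) = level_value B x h m)" for e and s :: state
  have hB: "2 * h \<le> B" using h(1) B by (auto dest: dvd_imp_le)
  have NW: "16 < W" "10 * B < W" "2 * h < W" "off + 10 * B < W" using W B hB by linarith+
  note small = wval_small[OF NW(1)]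
  let ?loop = "While (WLess (reg 4) (WMul (WConst 10) (reg 2))) fft_body"
  have start: "I 0 (exec N x (WStore (WConst 4) (WConst 0))
      (exec N x (WStore (WConst 3) (WDiv (reg 3) (WConst 2))) s))"
    using s by (simp add: I_def level_state_def Let_def W_def[symmetric] small del: wval.simps(1))
  have guard: "bval (word_limit N) s (WLess (reg 4) (WMul (WConst 10) (reg 2))) \<longleftrightarrow> e < 10 * B"
    if "I e s" for e s
    using that NW(2) by (simp add: I_def small W_def[symmetric] del: wval.simps(1))
  have body: "I (Suc e) (exec N x fft_body s)" if e: "e < 10 * B" and I: "I e s" for e s
  proof -
    have s: "wmem s 0 = N" "wmem s 2 = B" "wmem s 3 = h" "wmem s 4 = e" "wmem s 5 = off"
      using I by (simp_all add: I_def)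
    have "h \<le> B" using hB by simp
    note ex = exec_fft_body[OF s e B h(2) this W, of x]
    define m where "m = e - e mod B + ((2 * (e mod B - e mod B mod h)) mod B + e mod B mod h)"
    have a: "off + e - e mod B + ((2 * (e mod B - e mod B mod h)) mod B + e mod B mod h) = off + m"
    proof -
      have "e mod B \<le> e" by simp
      then show ?thesis unfolding m_def by linarith
    qed
    note lv = level_value_step(1)[OF h B(1) e, of x, folded m_def]
      level_value_step(2)[OF h B(1) e, folded m_def]
    have "cmem s (off + m) = level_value B x (2 * h) m"
      "cmem s (off + m + h) = level_value B x (2 * h) (m + h)"
      using I lv(2) by (auto simp: I_def add.assoc)
    then have cm: "cmem (exec N x fft_body s) =
        (cmem s)(off + 10 * B + e := level_value B x h e)"
      unfolding ex(8) a lv(1) by simp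
    show ?thesis
      using I unfolding I_def ex(1-7) cm by (auto simp: less_Suc_eq)
  qed
  have finish: "level_state B x h (off + 10 * B)
      (exec N x (WStore (WConst 5) (WAdd (reg 5) (WMul (WConst 10) (reg 2)))) s)" if "I (10 * B) s" for s
    using that NW by (simp add: I_def level_state_def Let_def W_def[symmetric] small del: wval.simps(1))
  have loop: "wp N x ?loop (10 * B * (20 + 2) + 1) (I (10 * B)) s" if "I 0 s" for s
    using that
  proof (rule wp_While[rotated 2])
    fix e s assume e: "e < 10 * B" "I e s"
    show "bval (word_limit N) s (WLess (reg 4) (WMul (WConst 10) (reg 2))) \<and>
        wp N x fft_body 20 (I (Suc e)) s"
      using guard[OF e(2)] e(1) wp_straight[of fft_body 20 "I (Suc e)", OF _ _ body[OF e]]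
      by (simp add: fft_body_def)
  qed (use guard in auto)
  show ?thesis
    unfolding fft_next_def
  proof (rule wp_Seq)
    show "wp N x (WStore (WConst 3) (WDiv (reg 3) (WConst 2))) 1
        (\<lambda>s'. s' = exec N x (WStore (WConst 3) (WDiv (reg 3) (WConst 2))) s) s"
      by (rule wp_straight) simp_all
    fix s' assume s': "s' = exec N x (WStore (WConst 3) (WDiv (reg 3) (WConst 2))) s"
    show "wp N x (Seq (WStore (WConst 4) (WConst 0)) (Seq ?loop
        (WStore (WConst 5) (WAdd (reg 5) (WMul (WConst 10) (reg 2))))))
        (220 * B + 5) (level_state B x h (off + 10 * B)) s'"
    proof (rule wp_Seq)
      show "wp N x (WStore (WConst 4) (WConst 0)) 1 (I 0) s'"
        by (rule wp_straight) (use start s' in simp_all)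
      fix s assume "I 0 s"
      show "wp N x (Seq ?loop (WStore (WConst 5) (WAdd (reg 5) (WMul (WConst 10) (reg 2)))))
        (220 * B + 3) (level_state B x h (off + 10 * B)) s"
      proof (rule wp_Seq[OF loop[OF \<open>I 0 s\<close>]])
        fix s assume "I (10 * B) s"
        then show "wp N x (WStore (WConst 5) (WAdd (reg 5) (WMul (WConst 10) (reg 2)))) 1
            (level_state B x h (off + 10 * B)) s"
          by (intro wp_straight finish) simp_all
      qed simp
    qed simp
  qed (use T in simp)
qed

text \<open>After \<open>d\<close> halvings the step is \<open>2 ^ (b - d)\<close> and the block
  starts \<open>10 * B * d\<close> cells after the first. All levels remain in memory, and the word
  size must suffice to address them.\<close>

lemma wp_fft:
  assumes s: "sampled B x s" and b: "B = 2 ^ b" and B: "2 * B \<le> N"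
    and W: "16 + 10 * B * b + 100 * N < W" and T: "b * (220 * B + 10) + 5 \<le> T"
  shows "wp N x fft T (level_state B x 1 (16 + 10 * B * b)) s"
proof -
  define I where "I d s = level_state B x (2 ^ (b - d)) (16 + 10 * B * d) s" for d s
  have B0: "B > 0" using b by simp
  have NW: "16 < W" "1 < W" using W B B0 by linarith+
  note small = wval_small[OF NW(1)]
  have start: "I 0 (exec N x (Seq (WStore (WConst 5) (WConst 16)) (WStore (WConst 3) (reg 2))) s)"
    using s B0 unfolding I_def
    by (simp add: level_state_def sampled_def level_value_def fft_level_top b[symmetric]
        Let_def W_def[symmetric] small del: wval.simps(1))
  have guard: "bval (word_limit N) s (WLess (WConst 1) (reg 3)) \<longleftrightarrow> d < b"
    if "I d s" for d s
    using that one_less_power[of "2 :: nat" "b - d"]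
    by (cases "d < b") (simp_all add: I_def level_state_def small W_def[symmetric] del: wval.simps(1))
  have body: "wp N x fft_next (220 * B + 8) (I (Suc d)) s" if d: "d < b" and I: "I d s" for d s
  proof -
    have eq: "b - d = Suc (b - Suc d)" using d by simp
    have "10 * B * d \<le> 10 * B * b" using d by simp
    then have off: "16 + 10 * B * d + 100 * N < W" using W by linarith
    have "2 * 2 ^ (b - Suc d) dvd B"
      unfolding b power_Suc[symmetric] eq[symmetric] by (rule le_imp_power_dvd) simp
    moreover have "level_state B x (2 * 2 ^ (b - Suc d)) (16 + 10 * B * d) s"
      using I by (simp add: I_def eq)
    moreover have "I (Suc d) = level_state B x (2 ^ (b - Suc d)) (16 + 10 * B * d + 10 * B)"
      by (simp add: I_def fun_eq_iff add.assoc add.commute[of "10 * B"])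
    ultimately show ?thesis
      using wp_fft_next[of B x "2 ^ (b - Suc d)" "16 + 10 * B * d" s "220 * B + 8"] off B0 B
      by simp
  qed
  show ?thesis
    unfolding fft_def
  proof (rule wp_Seq)
    show "wp N x (Seq (WStore (WConst 5) (WConst 16)) (WStore (WConst 3) (reg 2))) 3 (I 0) s"
      by (rule wp_straight) (use start in simp_all)
    fix s assume "I 0 s"
    then have "wp N x (While (WLess (WConst 1) (reg 3)) fft_next)
        (b * (220 * B + 8 + 2) + 1) (I b) s"
    proof (rule wp_While[rotated 2])
      fix d s assume "d < b" "I d s"
      then show "bval (word_limit N) s (WLess (WConst 1) (reg 3)) \<and>
          wp N x fft_next (220 * B + 8) (I (Suc d)) s"
        using guard body by blast
    qed (use guard in auto)
    then show "wp N x (While (WLess (WConst 1) (reg 3)) fft_next)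
        (b * (220 * B + 8 + 2) + 1) (level_state B x 1 (16 + 10 * B * b)) s"
      by (rule wp_mono) (auto simp: I_def)
  qed (use T in \<open>simp add: algebra_simps\<close>)
qed

end

text \<open>Direction, shift and residue are the digits of an address. A direction occupies
  \<open>5 * B\<close> cells, which explains the side length given to
  \<open>bucket_index\<close>.\<close>

definition cell :: "nat \<Rightarrow> nat \<Rightarrow> bool \<times> nat \<Rightarrow> nat \<Rightarrow> nat" where
  "cell off B b s = off + bucket_index (5 * B) b + s * B"

lemma cell_eq_iff:
  assumes "snd b < B" "snd b' < B" "s < 5" "s' < 5"
  shows "cell off B b s = cell off B b' s' \<longleftrightarrow> b = b' \<and> s = s'"
proof
  assume eq: "cell off B b s = cell off B b' s'"
  define g where "g = (\<lambda>(b :: bool \<times> nat) s :: nat. (if fst b then 5 else 0) + s)"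
  have c: "cell off B b s = off + (snd b + g b s * B)" for b s
    by (simp add: cell_def bucket_index_def g_def algebra_simps)
  have "snd b + g b s * B = snd b' + g b' s' * B"
    using eq unfolding c by simp
  then have "(snd b + g b s * B) mod B = (snd b' + g b' s' * B) mod B"
    "(snd b + g b s * B) div B = (snd b' + g b' s' * B) div B"
    by simp_all
  then have "snd b = snd b'" "g b s = g b' s'" using assms(1,2) by simp_all
  then show "b = b' \<and> s = s'"
    using assms(3,4) by (auto simp: g_def prod_eq_iff split: if_splits)
qed simp

lemma phase_index_less: "N > 0 \<Longrightarrow> phase_index N z < N"
  by (simp add: phase_index_def nat_less_iff)

section \<open>The machine code of one peeling round\<close>

context
  fixes N :: nat and W :: nat
  defines "W \<equiv> word_limit N"
begin

lemma exec_decode: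
  fixes x :: signal
  assumes s: "wmem s 0 = N" "wmem s 2 = B" "wmem s 5 = off" "wmem s 7 = bucket_index B b"
    and b: "snd b < B" and B: "2 * B \<le> N" and W: "off + 100 * N < W" "off \<ge> 16"
  defines "u \<equiv> \<lambda>j. cmem s (cell off B b j)"
  shows "exec N x decode s = s\<lparr>cmem := (cmem s)(1 := u 0), wmem := (wmem s)(11 := cell off B b 0,
      10 := phase_index N (u 1 / u 0), 9 := phase_index N (u 4 / u 0))\<rparr>"
proof -
  have ib: "bucket_index B b < 2 * B" using b by (rule bucket_index_less)
  have dm: "bucket_index B b div B * (5 * B) + bucket_index B b mod B = bucket_index (5 * B) b"
    using b by (auto simp: bucket_index_def)
  have dB: "bucket_index B b div B * (5 * B) \<le> 5 * B"
    using b by (auto simp: bucket_index_def)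
  have mB: "bucket_index B b mod B < B" using b by simp
  have c: "cell off B b j \<le> off + 10 * B" if "j \<le> 4" for j
  proof -
    have "j * B \<le> 4 * B" using that by simp
    then show ?thesis
      using b unfolding cell_def bucket_index_def
      by (cases "fst b"; simp only: if_True if_False; linarith)
  qed
  have NW: "16 < W" "5 * B < W" using W B by linarith+
  note small = wval_small[OF NW(1)]
  have a11: "wval W s (WAdd (WAdd (reg 5) (WMul (WDiv (reg 7) (reg 2)) (WMul (WConst 5) (reg 2))))
      (WMod (reg 7) (reg 2))) = cell off B b 0"
  proof -
    have "off + bucket_index B b div B * (5 * B) + bucket_index B b mod B = cell off B b 0"
      using dm by (simp add: cell_def)
    moreover have "bucket_index B b div B * (5 * B) < W"
      "off + bucket_index B b div B * (5 * B) < W" "cell off B b 0 < W"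
      using dB mB c[of 0] W B NW by linarith+
    ultimately show ?thesis using NW by (simp add: small s del: wval.simps(1))
  qed
  have sc: "wval W t (shift_cell 11 j) = cell off B b j"
    if "wmem t 11 = cell off B b 0" "wmem t 2 = B" "j \<le> 4" for t j
  proof -
    have "j * B \<le> 4 * B" using that(3) by simp
    then have "j * B < W" using W B by linarith
    then have "j * B mod W = j * B" by simp
    moreover have "(cell off B b 0 + j * B) mod W = cell off B b j"
      using c[OF that(3)] W B by (simp add: cell_def)
    ultimately show ?thesis
      using that by (simp add: shift_cell_def small del: wval.simps(1))
  qed
  \<comment> \<open>Arrays start at cell 16, so the scratch cell 1 is never an array cell.\<close>
  have ne: "cell off B b j \<noteq> 1" for j using W by (simp add: cell_def)
  show ?thesis
    unfolding decode_def u_def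
    by (simp add: Let_def W_def[symmetric] a11 sc small s ne del: wval.simps One_nat_def)
qed

lemma bval_accept_test:
  assumes s: "wmem s 0 = N" "wmem s 2 = B" "wmem s 11 = cell off B b 0"
    "cmem s 1 = u 0" "wmem s 10 = phase_index N (u 1 / u 0)"
    and u: "\<And>j. j < 5 \<Longrightarrow> u j = cmem s (cell off B b j)"
    and b: "snd b < B" and B: "2 * B \<le> N" and W: "off + 100 * N < W"
  shows "bval W s accept_test \<longleftrightarrow> accepts N u"
proof -
  have NW: "16 < W" using W B b by linarith
  note small = wval_small[OF NW]
  have sc: "wval W s (shift_cell 11 j) = cell off B b j" if "j \<le> 4" for j
  proof -
    have "j * B \<le> 4 * B" using that by simp
    then have "j * B < W" "cell off B b 0 + j * B < W"
      using W B b unfolding cell_def bucket_index_def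
      by (cases "fst b"; simp only: if_True if_False; linarith)+
    moreover have "cell off B b 0 + j * B = cell off B b j" by (simp add: cell_def)
    ultimately show ?thesis
      using that s by (simp add: shift_cell_def small del: wval.simps(1))
  qed
  have N: "N > 0" using B b by simp
  have "bval W s (check_shift j) \<longleftrightarrow> u j * omega N ^ (j * phase_index N (u 1 / u 0)) = u 0"
    if "j \<le> 4" for j
  proof -
    have "j * phase_index N (u 1 / u 0) \<le> 4 * phase_index N (u 1 / u 0)" using that by simp
    also have "\<dots> \<le> 4 * N" using phase_index_less[OF N] by (simp add: less_imp_le)
    finally have "j * phase_index N (u 1 / u 0) < W" using W by simp
    then show ?thesis
      using that s u[of j] by (simp add: check_shift_def small sc del: wval.simps(1))
  qed
  then show ?thesis
    by (simp add: accept_test_def accepts_def small s del: wval.simps(1) One_nat_def)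
qed

lemma exec_locate:
  fixes x :: signal
  assumes s: "wmem s 0 = N" "wmem s 2 = B" "wmem s 5 = off" "wmem s 7 = bucket_index B b"
    and b: "snd b < B" and B: "2 * B \<le> N" and W: "off + 100 * N < W"
  defines "b' \<equiv> (\<not> fst b, wmem s 10 mod B)"
  shows "exec N x locate s = s\<lparr>
    out := (point_of (fst b) (wmem s 9) (wmem s 10), cmem s 1 * of_nat (N div B)) # out s,
    wmem := (wmem s)(12 := cell off B b' 0, 7 := bucket_index B b')\<rparr>"
proof -
  have mB: "wmem s 10 mod B < B" using b by simp
  have NW: "16 < W" "5 * B < W" "off + 5 * B < W" "off + wmem s 10 mod B < W"
    "off + 5 * B + wmem s 10 mod B < W" "B + wmem s 10 mod B < W"
    using W B b mB by linarith+
  note small = wval_small[OF NW(1)]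
  show ?thesis
  proof (cases "fst b")
    case True
    then have "\<not> bucket_index B b < B" by (simp add: bucket_index_def)
    then show ?thesis
      using True unfolding locate_def
      by (simp add: Let_def W_def[symmetric] small s NW b'_def point_of_def cell_def
          bucket_index_def add.assoc[symmetric] del: wval.simps(1))
  next
    case False
    then have "bucket_index B b < B" using b by (simp add: bucket_index_def)
    then show ?thesis
      using False unfolding locate_def
      by (simp add: Let_def W_def[symmetric] small s NW b'_def point_of_def cell_def
          bucket_index_def add.assoc[symmetric] del: wval.simps(1))
  qed
qed

lemma wval_shift_cell:
  assumes "16 < W" "a \<le> 16" "wmem s a + j * wmem s 2 < W" "j \<le> 4"
  shows "wval W s (shift_cell a j) = wmem s a + j * wmem s 2"
proof -
  have "j * wmem s 2 < W" using assms(3) by linarith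
  then show ?thesis
    using assms by (simp add: shift_cell_def wval_small[OF assms(1)] del: wval.simps(1))
qed

lemma exec_clear_shift:
  fixes x :: signal
  assumes "16 < W" "wmem s 11 + j * wmem s 2 < W" "j \<le> 4"
  shows "exec N x (clear_shift j) s = s\<lparr>cmem := (cmem s)(wmem s 11 + j * wmem s 2 := 0)\<rparr>"
  using assms by (simp add: clear_shift_def Let_def W_def[symmetric] wval_shift_cell
      wval_small[OF assms(1)] del: wval.simps(1))

lemma exec_subtract_shift:
  fixes x :: signal
  assumes "16 < W" "wmem s 12 + j * wmem s 2 < W" "j \<le> 4"
  shows "exec N x (subtract_shift j e) s = s\<lparr>cmem := (cmem s)(wmem s 12 + j * wmem s 2 :=
    cmem s (wmem s 12 + j * wmem s 2) - cmem s 1 / omega (wmem s 0) ^ wval W s e)\<rparr>"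
  using assms by (simp add: subtract_shift_def Let_def W_def[symmetric] wval_shift_cell
      wval_small[OF assms(1)] del: wval.simps(1))

lemma exec_peel:
  fixes x :: signal
  assumes s: "wmem s 0 = N" "wmem s 2 = B" "wmem s 5 = off" "wmem s 7 = bucket_index B b"
    "wmem s 11 = cell off B b 0" "wmem s 9 = v" "wmem s 10 = w" "cmem s 1 = u0"
    and b: "snd b < B" and vw: "v < N" "w < N" and B: "2 * B \<le> N"
    and W: "off + 100 * N < W" "16 \<le> off"
  defines "b' \<equiv> (\<not> fst b, w mod B)" and "p \<equiv> point_of (fst b) v w"
  defines "s' \<equiv> exec N x peel s"
  shows "wmem s' = (wmem s)(12 := cell off B b' 0, 7 := bucket_index B b')"
    and "samples s' = samples s"
    and "out s' = (p, u0 * of_nat (N div B)) # out s"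
    and "j < 5 \<Longrightarrow> cmem s' (cell off B b j) = 0"
    and "j < 5 \<Longrightarrow> cmem s' (cell off B b' j) =
      cmem s (cell off B b' j) - u0 * shift_factor N (fst b') j p"
    and "j < 5 \<Longrightarrow> snd b'' < B \<Longrightarrow> b'' \<noteq> b \<Longrightarrow> b'' \<noteq> b' \<Longrightarrow>
      cmem s' (cell off B b'' j) = cmem s (cell off B b'' j)"
proof -
  have NW: "16 < W" "3 * v < W" "3 * w < W" using W B b vw by linarith+
  have b': "snd b' < B" "b' \<noteq> b" using b by (auto simp: b'_def prod_eq_iff)
  have c: "cell off B c 0 + j * B = cell off B c j" "cell off B c 0 + B = cell off B c 1" for c j
    by (simp_all add: cell_def)
  have cW: "cell off B c j < W" if "snd c < B" "j \<le> 4" for c j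
  proof -
    have "j * B \<le> 4 * B" using that(2) by simp
    then show ?thesis
      using that(1) W B unfolding cell_def bucket_index_def
      by (cases "fst c"; simp only: if_True if_False; linarith)
  qed
  have ne: "cell off B c j \<noteq> 1" "1 \<noteq> cell off B c j" for c j using W by (simp_all add: cell_def)
  let ?s1 = "exec N x locate s"
  note s1 = exec_locate[OF s(1-4) b B W(1), of x, unfolded s, folded b'_def p_def]
  define s2 where "s2 = exec N x (Seq (clear_shift 0) (Seq (clear_shift 1) (Seq (clear_shift 2)
      (Seq (clear_shift 3) (clear_shift 4))))) ?s1"
  have s2: "s2 = ?s1\<lparr>cmem := (cmem s)(cell off B b 0 := 0, cell off B b 1 := 0,
      cell off B b 2 := 0, cell off B b 3 := 0, cell off B b 4 := 0)\<rparr>"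
    unfolding s2_def s1
    by (simp add: exec_clear_shift NW s c cW b del: One_nat_def)
  have small: "wval W t (WMul (WConst j) (reg 9)) = j * v" if "wmem t 9 = v" "j \<le> 3" for t j
  proof -
    have "j * v \<le> 3 * v" using that(2) by simp
    then have "j * v < W" using NW by linarith
    then show ?thesis
      using that by (simp add: wval_small[OF NW(1)] del: wval.simps(1))
  qed
  define d where "d j = u0 * shift_factor N (fst b') j p" for j
  have own: "own (\<not> fst b') p = v" "own (fst b') p = w"
    by (auto simp: b'_def p_def own_def point_of_def)
  have d: "u0 / omega N ^ (j * v) = d j" if "j \<le> 3" for j
  proof -
    have "j div 4 = 0" "j mod 4 = j" using that by auto
    then show ?thesis
      by (simp add: d_def shift_factor_def own power_inverse divide_inverse mult.commute)
  qed
  have d01: "d 0 = u0" "u0 / omega N ^ v = d 1" using d[of 0] d[of 1] by simp_all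
  have d4: "u0 / omega N ^ w = d 4"
    by (simp add: d_def shift_factor_def own power_inverse divide_inverse)
  have s': "s' = s2\<lparr>cmem := (cmem s2)(cell off B b' 0 := cmem s (cell off B b' 0) - d 0,
      cell off B b' 1 := cmem s (cell off B b' 1) - d 1,
      cell off B b' 2 := cmem s (cell off B b' 2) - d 2,
      cell off B b' 3 := cmem s (cell off B b' 3) - d 3,
      cell off B b' 4 := cmem s (cell off B b' 4) - d 4)\<rparr>"
    unfolding s'_def peel_def exec.simps(8) s2_def[unfolded exec.simps(8), symmetric]
    unfolding s2 s1
    by (simp add: exec_subtract_shift NW s c cW b b' small wval_small(1)[OF NW(1)] d d01 d4 ne cell_eq_iff
        del: wval.simps One_nat_def)
  show "wmem s' = (wmem s)(12 := cell off B b' 0, 7 := bucket_index B b')"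
    "samples s' = samples s" "out s' = (p, u0 * of_nat (N div B)) # out s"
    unfolding s' s2 s1 by simp_all
  have j5: "j = 0 \<or> j = 1 \<or> j = 2 \<or> j = 3 \<or> j = 4" if "j < 5" for j :: nat using that by auto
  show "j < 5 \<Longrightarrow> cmem s' (cell off B b j) = 0"
    using j5[of j] b b' unfolding s' s2 s1 by (auto simp: cell_eq_iff)
  show "j < 5 \<Longrightarrow> cmem s' (cell off B b' j) =
      cmem s (cell off B b' j) - u0 * shift_factor N (fst b') j p"
    using j5[of j] b' unfolding s' d_def by (auto simp: cell_eq_iff)
  show "j < 5 \<Longrightarrow> snd b'' < B \<Longrightarrow> b'' \<noteq> b \<Longrightarrow> b'' \<noteq> b' \<Longrightarrow>
      cmem s' (cell off B b'' j) = cmem s (cell off B b'' j)"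
    using b b' unfolding s' s2 s1 by (simp add: cell_eq_iff)
qed

end

lemma bucket_sum_level_value:
  assumes "x = idft2 N y" "B dvd N" "2 * B \<le> N" "3 < N" "snd b < B" "s < 5"
  shows "level_value N B x 1 (bucket_index (5 * B) b + s * B) =
    bucket_sum N B y {p \<in> {..<N} \<times> {..<N}. y (fst p) (snd p) \<noteq> 0} b s"
proof -
  define g where "g = (if fst b then 5 else 0) + s"
  have "bucket_index (5 * B) b + s * B = g * B + snd b"
    by (simp add: bucket_index_def g_def algebra_simps)
  then have g: "(bucket_index (5 * B) b + s * B) div B = g"
    "(bucket_index (5 * B) b + s * B) mod B = snd b"
    using assms(5) by simp_all
  have "5 \<le> g \<longleftrightarrow> fst b" "g mod 5 = s" using assms(6) by (auto simp: g_def)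
  then have "level_value N B x 1 (bucket_index (5 * B) b + s * B) =
      (\<Sum>l<B. omega B ^ (snd b * l) * line_sample N B (idft2 N y) (fst b) s l)"
    by (simp only: level_value_def g One_nat_def) (simp add: fft_level_bottom line_value_def assms(1))
  also have "\<dots> = bucket_sum N B y ({..<N} \<times> {..<N}) b s"
    using fourier_line_sample[OF assms(2-6), of y "fst b"] by simp
  also have "\<dots> = bucket_sum N B y {p \<in> {..<N} \<times> {..<N}. y (fst p) (snd p) \<noteq> 0} b s"
    unfolding bucket_sum_def by (rule sum.mono_neutral_right) auto
  finally show ?thesis .
qed

section \<open>The complete run\<close>

context
  fixes N :: nat and W :: nat
  defines "W \<equiv> word_limit N"
begin

definition found :: "signal \<Rightarrow> state \<Rightarrow> bool" where
  "found y s \<longleftrightarrow> distinct (map fst (out s)) \<and>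
    fst ` set (out s) = {p \<in> {..<N} \<times> {..<N}. y (fst p) (snd p) \<noteq> 0} \<and>
    (\<forall>(p, v)\<in>set (out s). v = y (fst p) (snd p))"

lemma wp_peel_loop:
  fixes x y :: signal
  defines "S \<equiv> {p \<in> {..<N} \<times> {..<N}. y (fst p) (snd p) \<noteq> 0}"
  assumes s: "level_state N B x 1 off s"
    and B: "B > 0" "B dvd N" "2 * B \<le> N" "3 < N"
    and W: "off + 100 * N < W" "off \<ge> 16" and T: "208 * B + 8 \<le> T"
  shows "wp N x peel_loop T (\<lambda>s. samples s = 10 * B \<and>
    (x = idft2 N y \<and> peelable B S \<and> resolvable N B y S \<longrightarrow> found y s)) s"
proof -
  define good where "good \<longleftrightarrow> x = idft2 N y \<and> peelable B S \<and> resolvable N B y S"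
  \<comment> \<open>Only the peeling invariant presupposes a good input; the other clauses hold for
    every signal, because time and sample bounds are worst case. The bound on register 8 is among
    them, as it excludes overflow on bad inputs too.\<close>
  define J where "J m s \<longleftrightarrow> wmem s 0 = N \<and> wmem s 2 = B \<and> wmem s 4 = m \<and> wmem s 5 = off \<and>
    wmem s 8 \<le> m + 1 \<and> samples s = 10 * B \<and>
    (good \<longrightarrow> peel_inv N B y S m (wmem s 7) (wmem s 8) (\<lambda>b j. cmem s (cell off B b j)) (out s))"
    for m and s :: state
  have NW: "16 < W" "4 * B < W" using W B by linarith+
  note small = wval_small[OF NW(1)]
  have NB: "of_nat (N div B) = (of_nat N / of_nat B :: complex)"
    using B(1,2) by auto
  have ne1: "cell off B b j \<noteq> 1" for b j using W by (simp add: cell_def)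
  have SD: "S \<subseteq> {p \<in> {..<N} \<times> {..<N}. y (fst p) (snd p) \<noteq> 0}" by (simp add: S_def)
  let ?init = "Seq (WStore (WConst 7) (WConst 0)) (Seq (WStore (WConst 8) (WConst 1))
      (WStore (WConst 4) (WConst 0)))"
  have start: "J 0 (exec N x ?init s)"
  proof -
    have ex: "exec N x ?init s = s\<lparr>wmem := (wmem s)(7 := 0, 8 := 1, 4 := 0)\<rparr>"
      by (simp add: Let_def W_def[symmetric] small del: wval.simps(1) One_nat_def)
    have "peel_inv N B y S 0 0 1 (\<lambda>b j. cmem s (cell off B b j)) []" if good
    proof (rule peel_inv_init[OF B(1)])
      fix b :: "bool \<times> nat" and j :: nat
      assume b: "snd b < B" "j < 5"
      have "bucket_index (5 * B) b \<le> 5 * B + snd b" by (simp add: bucket_index_def)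
      moreover have "j * B \<le> 4 * B" using b(2) by (intro mult_le_mono1) simp
      ultimately have "bucket_index (5 * B) b + j * B < 10 * B" using b(1) by linarith
      then have "cmem s (cell off B b j) = level_value N B x 1 (bucket_index (5 * B) b + j * B)"
        using s by (simp add: level_state_def cell_def add.assoc)
      then show "cmem s (cell off B b j) = bucket_sum N B y S b j"
        using that bucket_sum_level_value[of x N y B b j] B b by (simp add: good_def S_def)
    qed
    then show ?thesis
      using s unfolding J_def ex by (simp add: level_state_def)
  qed
  have guard: "bval (word_limit N) s (WLess (reg 4) (WMul (WConst 4) (reg 2))) \<longleftrightarrow> m < 4 * B"
    if "J m s" for m s
    using that NW(2) by (simp add: J_def small W_def[symmetric] del: wval.simps(1))
  have body: "J (Suc m) (exec N x peel_body s)" if m: "m < 4 * B" and J: "J m s" for m s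
  proof -
    have s: "wmem s 0 = N" "wmem s 2 = B" "wmem s 4 = m" "wmem s 5 = off" "wmem s 8 \<le> m + 1"
      "samples s = 10 * B"
      and inv: "good \<Longrightarrow> peel_inv N B y S m (wmem s 7) (wmem s 8) (\<lambda>b j. cmem s (cell off B b j)) (out s)"
      using J by (simp_all add: J_def)
    have mW: "Suc m < W" "Suc (wmem s 8) < W" "2 * B < W" using m s(5) W B by linarith+
    have inc: "exec N x (WStore (WConst 4) (WAdd (reg 4) (WConst 1))) t =
        t\<lparr>wmem := (wmem t)(4 := Suc m)\<rparr>" if "wmem t 4 = m" for t
      using that mW by (simp add: Let_def W_def[symmetric] small del: wval.simps(1))
    have test: "bval W s (WLess (reg 7) (WMul (WConst 2) (reg 2))) \<longleftrightarrow> wmem s 7 < 2 * B"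
      using s mW by (simp add: small del: wval.simps(1))
    show ?thesis
    proof (cases "wmem s 7 < 2 * B")
      case False
      then have "exec N x peel_body s = s\<lparr>wmem := (wmem s)(4 := Suc m)\<rparr>"
        using s(3) test by (simp add: peel_body_def inc W_def[symmetric]
            del: exec.simps(2) bval.simps wval.simps One_nat_def)
      then show ?thesis
        using s inv False unfolding J_def by (auto intro: peel_inv_idle)
    next
      case True
      define b where "b = (B \<le> wmem s 7, wmem s 7 mod B)"
      have b: "wmem s 7 = bucket_index B b" "snd b < B"
      proof -
        have "wmem s 7 mod B = wmem s 7 - B" if "B \<le> wmem s 7"
          using True that by (simp add: le_mod_geq)
        then show "wmem s 7 = bucket_index B b" "snd b < B"
          using B(1) by (auto simp: b_def bucket_index_def)
      qed
      define u where "u j = cmem s (cell off B b j)" for j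
      define v w where "v = phase_index N (u 4 / u 0)" and "w = phase_index N (u 1 / u 0)"
      define s1 where "s1 = exec N x decode s"
      have s1: "s1 = s\<lparr>cmem := (cmem s)(1 := u 0),
          wmem := (wmem s)(11 := cell off B b 0, 10 := w, 9 := v)\<rparr>"
        unfolding s1_def u_def v_def w_def
        by (rule exec_decode) (use s b B W in \<open>simp_all add: W_def\<close>)
      have u1: "cmem s1 (cell off B b' j) = cmem s (cell off B b' j)" for b' j
        using ne1 by (simp add: s1 del: One_nat_def)
      have acc: "bval W s1 accept_test \<longleftrightarrow> accepts N u"
      proof (rule bval_accept_test[where N = N, folded W_def])
        show "u j = cmem s1 (cell off B b j)" for j by (simp add: u1) (simp add: u_def)
      qed (use s b B W in \<open>auto simp: s1 w_def\<close>)
      have vw: "v < N" "w < N" using B phase_index_less by (auto simp: v_def w_def)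
      show ?thesis
      proof (cases "accepts N u")
        case True
        define b' where "b' = (\<not> fst b, w mod B)"
        define p where "p = point_of (fst b) v w"
        define s2 where "s2 = exec N x peel s1"
        have "wmem s1 0 = N" "wmem s1 2 = B" "wmem s1 5 = off" "wmem s1 7 = bucket_index B b"
          "wmem s1 11 = cell off B b 0" "wmem s1 9 = v" "wmem s1 10 = w" "cmem s1 1 = u 0"
          using s b by (simp_all add: s1)
        note ex = exec_peel[where N = N, folded W_def, OF this b(2) vw B(3) W, where x = x,
            folded b'_def p_def s2_def, unfolded u1]
        have s2: "wmem s2 = (wmem s1)(12 := cell off B b' 0, 7 := bucket_index B b')"
          "samples s2 = samples s1" "out s2 = (p, u 0 * of_nat (N div B)) # out s1"
          using ex(1-3) by simp_all
        have "wmem s2 4 = m" using s by (simp add: s2 s1)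
        then have "exec N x peel_body s = s2\<lparr>wmem := (wmem s2)(4 := Suc m)\<rparr>"
          using \<open>wmem s 7 < 2 * B\<close> True acc test
          by (simp add: peel_body_def inc W_def[symmetric] s1_def[symmetric] s2_def[symmetric]
              del: exec.simps(2) bval.simps wval.simps One_nat_def)
        moreover have "peel_inv N B y S (Suc m) (bucket_index B b') (wmem s 8)
            (\<lambda>b j. cmem s2 (cell off B b j)) ((p, u 0 * of_nat N / of_nat B) # out s)" if good
        proof -
          have res: "resolvable N B y S" using that by (simp add: good_def)
          show ?thesis
            using peel_inv_pass[OF B(1) SD res inv[OF that] b, of "\<lambda>b j. cmem s2 (cell off B b j)",
                folded u_def, folded v_def w_def, folded b'_def p_def] True ex(4-6)
            by simp
        qed
        ultimately show ?thesis
          using s unfolding J_def by (simp add: s2 s1 NB)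
      next
        case False
        have adv: "exec N x advance s1 = s1\<lparr>wmem := (wmem s1)(7 := wmem s 8, 8 := Suc (wmem s 8))\<rparr>"
          using mW by (simp add: advance_def s1 Let_def W_def[symmetric] small
              del: wval.simps(1))
        have "wmem s1 4 = m" using s by (simp add: s1)
        then have "exec N x peel_body s = s1\<lparr>wmem := (wmem s1)(7 := wmem s 8, 8 := Suc (wmem s 8), 4 := Suc m)\<rparr>"
          using \<open>wmem s 7 < 2 * B\<close> False acc test s
          by (simp add: peel_body_def inc adv W_def[symmetric] s1_def[symmetric]
              del: exec.simps(2) bval.simps wval.simps One_nat_def)
        moreover have "peel_inv N B y S (Suc m) (wmem s 8) (Suc (wmem s 8))
            (\<lambda>b j. cmem s (cell off B b j)) (out s)" if good
        proof -
          have res: "resolvable N B y S" using that by (simp add: good_def)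
          show ?thesis
            using peel_inv_fail[OF B(1) SD res inv[OF that] b] False by (simp add: u_def[abs_def])
        qed
        ultimately show ?thesis
          using s unfolding J_def by (simp add: s1 ne1 del: One_nat_def)
      qed
    qed
  qed
  show ?thesis
    unfolding peel_loop_def
  proof (rule wp_Seq)
    show "wp N x ?init 5 (J 0) s"
      by (rule wp_straight) (use start in \<open>simp_all del: exec.simps\<close>)
    fix s assume "J 0 s"
    then have "wp N x (While (WLess (reg 4) (WMul (WConst 4) (reg 2))) peel_body)
        (4 * B * (50 + 2) + 1) (J (4 * B)) s"
    proof (rule wp_While[rotated 2])
      fix m s assume m: "m < 4 * B" "J m s"
      have "straight peel_body" "straight_time peel_body \<le> 50"
        by (simp_all add: peel_body_def decode_def peel_def advance_def locate_def
            clear_shift_def subtract_shift_def)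
      then show "bval (word_limit N) s (WLess (reg 4) (WMul (WConst 4) (reg 2))) \<and>
          wp N x peel_body 50 (J (Suc m)) s"
        using guard[OF m(2)] m(1) wp_straight[of peel_body 50 "J (Suc m)", OF _ _ body[OF m]] by simp
    qed (use guard in auto)
    then show "wp N x (While (WLess (reg 4) (WMul (WConst 4) (reg 2))) peel_body)
        (4 * B * (50 + 2) + 1) (\<lambda>s. samples s = 10 * B \<and>
          (x = idft2 N y \<and> peelable B S \<and> resolvable N B y S \<longrightarrow> found y s)) s"
    proof (rule wp_mono)
      fix s' assume J: "J (4 * B) s'"
      have "found y s'" if good
      proof -
        have g: "peelable B S" "resolvable N B y S" using that by (auto simp: good_def)
        have "peel_inv N B y S (4 * B) (wmem s' 7) (wmem s' 8)
            (\<lambda>b j. cmem s' (cell off B b j)) (out s')" using J that by (simp add: J_def)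
        from peel_inv_final[OF B(1) SD g(2) this g(1)]
        show ?thesis unfolding found_def S_def by blast
      qed
      then show "samples s' = 10 * B \<and>
          (x = idft2 N y \<and> peelable B S \<and> resolvable N B y S \<longrightarrow> found y s')"
        using J by (auto simp: J_def good_def)
    qed simp
  qed (use T in simp)
qed

lemma wp_sparse_fft:
  fixes x y :: signal
  defines "S \<equiv> {p \<in> {..<N} \<times> {..<N}. y (fst p) (snd p) \<noteq> 0}"
  assumes b: "\<And>i. i < b \<Longrightarrow> \<alpha> * 2 ^ i < 8 * real k" "\<not> \<alpha> * 2 ^ b < 8 * real k"
    and B: "B = 2 ^ b" "B dvd N" "2 * B \<le> N" "3 < N" and k: "k \<le> N"
  shows "wp N x sparse_fft (1000 * B * (b + 1)) (\<lambda>s. samples s = 10 * B \<and>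
    (x = idft2 N y \<and> peelable B S \<and> resolvable N B y S \<longrightarrow> found y s)) (init_state N k \<alpha>)"
proof -
  have B0: "B > 0" using B(1) by simp
  have "b \<le> B" using B(1) less_exp[of b] by simp
  then have Bb: "B * b \<le> B * B" by simp
  have BB: "4 * (B * B) \<le> N * N" using mult_le_mono[OF B(3) B(3)] by simp
  \<comment> \<open>The levels occupy 10 B b \<le> 10 B^2 cells, at most 5/2 N^2 by
    \<open>2 * B \<le> N\<close>, while \<open>N > 3\<close> makes the word limit at least 64
    N^2.\<close>
  have W: "16 + 10 * B * b + 100 * N < W"
  proof -
    have "(2::nat) ^ 6 \<le> N ^ 6" using B(4) by (intro power_mono) auto
    then have "64 * (N * N) \<le> N ^ 6 * (N * N)" by (intro mult_le_mono1) simp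
    also have "\<dots> = W" by (simp add: W_def word_limit_def numeral_eq_Suc)
    finally have "64 * (N * N) \<le> W" .
    moreover have "4 * N \<le> N * N" using B(4) by (intro mult_le_mono1) simp
    moreover have "10 * B * b \<le> 10 * (B * B)" using Bb by simp
    ultimately show ?thesis using BB B(4) by linarith
  qed
  have NW: "100 * N < W" using W by linarith
  have BN: "2 ^ b \<le> N" using B by simp
  have bB: "b \<le> B * b" using B0 by simp
  let ?T1 = "3 * b + 3" and ?T2 = "220 * B + 3" and ?T3 = "b * (220 * B + 10) + 5"
    and ?T4 = "208 * B + 8"
  have T: "?T1 + 1 + (?T2 + 1 + (?T3 + 1 + ?T4)) \<le> 1000 * B * (b + 1)"
  proof -
    have "1000 * B * (b + 1) = 1000 * (B * b) + 1000 * B" "b * (220 * B + 10) = 220 * (B * b) + 10 * b"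
      by (simp_all add: algebra_simps)
    then show ?thesis using bB B0 by linarith
  qed
  show ?thesis
    unfolding sparse_fft_def
  proof (rule wp_Seq[OF _ _ T])
    show "wp N x choose_size ?T1 (\<lambda>s. wmem s 0 = N \<and> wmem s 2 = B \<and> samples s = 0 \<and> out s = [])
        (init_state N k \<alpha>)"
      unfolding B(1) using wp_choose_size[OF b BN k NW[unfolded W_def]] by simp
    fix s :: state assume s: "wmem s 0 = N \<and> wmem s 2 = B \<and> samples s = 0 \<and> out s = []"
    show "wp N x (Seq sample_lines (Seq fft peel_loop)) (?T2 + 1 + (?T3 + 1 + ?T4))
        (\<lambda>s. samples s = 10 * B \<and>
          (x = idft2 N y \<and> peelable B S \<and> resolvable N B y S \<longrightarrow> found y s)) s"
    proof (rule wp_Seq)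
      show "wp N x sample_lines ?T2 (sampled N B x) s"
        by (rule wp_sample_lines) (use s B B0 NW in \<open>auto simp: W_def\<close>)
      fix s assume s: "sampled N B x s"
      show "wp N x (Seq fft peel_loop) (?T3 + 1 + ?T4)
        (\<lambda>s. samples s = 10 * B \<and>
          (x = idft2 N y \<and> peelable B S \<and> resolvable N B y S \<longrightarrow> found y s)) s"
      proof (rule wp_Seq)
        show "wp N x fft ?T3 (level_state N B x 1 (16 + 10 * B * b)) s"
          by (rule wp_fft[OF s B(1,3)]) (use W in \<open>auto simp: W_def\<close>)
        fix s assume "level_state N B x 1 (16 + 10 * B * b) s"
        then show "wp N x peel_loop ?T4 (\<lambda>s. samples s = 10 * B \<and>
          (x = idft2 N y \<and> peelable B S \<and> resolvable N B y S \<longrightarrow> found y s)) s"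
          unfolding S_def
          by (rule wp_peel_loop) (use W B B0 in auto)
      qed simp
    qed simp
  qed
qed

end

section \<open>The success probability\<close>

lemma represents_found:
  assumes "found N y s"
  shows "represents N (out s) (dft2 N (idft2 N y))"
proof -
  have dist: "distinct (map fst (out s))"
    and fsts: "fst ` set (out s) = {p \<in> {..<N} \<times> {..<N}. y (fst p) (snd p) \<noteq> 0}"
    and vals: "\<And>p v. (p, v) \<in> set (out s) \<Longrightarrow> v = y (fst p) (snd p)"
    using assms by (auto simp: found_def)
  have "y i j = (case map_of (out s) (i, j) of None \<Rightarrow> 0 | Some v \<Rightarrow> v)" if "i < N" "j < N" for i j
  proof (cases "map_of (out s) (i, j)")
    case None
    then have "(i, j) \<notin> fst ` set (out s)" by (simp add: map_of_eq_None_iff)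
    then show ?thesis using None that unfolding fsts by simp
  next
    case (Some v)
    then show ?thesis using vals[of "(i, j)" v] by (simp add: map_of_SomeD)
  qed
  then show ?thesis
    using dist fsts by (auto simp: represents_def dft2_idft2)
qed

lemma halts_and_samples:
  assumes "\<And>x. wp N x P t (\<lambda>s. real (samples s) \<le> q) (init_state N k \<alpha>)"
  shows "halts_within P N k \<alpha> x t" "uses_samples_within P N k \<alpha> x t q"
  using assms[of x] by (auto simp: wp_def halts_within_def uses_samples_within_def)

text \<open>The final state is a function of the signal, so the joint distribution is an image of
  \<open>M\<close> and all randomness comes from the support.\<close>

lemma prob_joint_outcome_ge:
  assumes det: "\<And>x. wp N x P t (\<lambda>_. True) (init_state N k \<alpha>)"
    and good: "\<And>z. z \<in> G \<Longrightarrow> wp N (f z) P t (\<lambda>s. R (f z) (out s)) (init_state N k \<alpha>)"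
  shows "measure_pmf.prob (joint_outcome P N k \<alpha> t (map_pmf f M)) {(x, es). R x es} \<ge>
    measure_pmf.prob M G"
proof -
  obtain fin where fin: "\<And>x. run N x t (P, init_state N k \<alpha>) = return_pmf (Skip, fin x)"
    using det unfolding wp_def by metis
  have "joint_outcome P N k \<alpha> t (map_pmf f M) = map_pmf (\<lambda>z. (f z, out (fin (f z)))) M"
    by (simp add: joint_outcome_def fin bind_map_pmf map_pmf_def[symmetric])
       (simp add: map_pmf_def bind_assoc_pmf bind_return_pmf)
  then have "measure_pmf.prob (joint_outcome P N k \<alpha> t (map_pmf f M)) {(x, es). R x es} =
      measure_pmf.prob M {z. R (f z) (out (fin (f z)))}"
    by (simp add: vimage_def)
  moreover have "G \<subseteq> {z. R (f z) (out (fin (f z)))}"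
    using good fin by (fastforce simp: wp_def)
  ultimately show ?thesis
    by (simp add: measure_pmf.finite_measure_mono)
qed

lemma bucket_sum_cong:
  "(\<And>p. p \<in> T \<Longrightarrow> y (fst p) (snd p) = y' (fst p) (snd p)) \<Longrightarrow> bucket_sum N B y T b = bucket_sum N B y' T b"
  by (auto simp: bucket_sum_def fun_eq_iff intro!: sum.cong)

lemma prob_success:
  assumes alpha: "0 < \<alpha>" "\<alpha> < 1"
    and b: "\<And>i. i < b \<Longrightarrow> \<alpha> * 2 ^ i < 8 * real k" "\<not> \<alpha> * 2 ^ b < 8 * real k"
    and B: "B = 2 ^ b" "B dvd N" "2 * B \<le> N" "3 < N" and k: "k \<le> N"
  shows "measure_pmf.prob (joint_outcome sparse_fft N k \<alpha> (1000 * B * (b + 1))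
      (bernoulli_signal N (real k / (real N)\<^sup>2) a))
    {(x, es). represents N es (dft2 N x)} \<ge> 1 - \<alpha>"
proof -
  define y where "y z = (\<lambda>i j. if z (i, j) then a i j else 0)" for z :: "nat \<times> nat \<Rightarrow> bool"
  define S where "S z = {p \<in> {..<N} \<times> {..<N}. y z (fst p) (snd p) \<noteq> 0}" for z
  let ?q = "real k / (real N)\<^sup>2"
  let ?M = "random_set ({..<N} \<times> {..<N}) ?q"
  \<comment> \<open>Resolvability is taken for the fixed values \<open>a\<close> and not for the
    random spectrum, since the union bound needs confusing sets that do not depend on the support.
    On subsets of the support both spectra agree.\<close>
  let ?G = "{z. peelable B (S z) \<and> resolvable N B a (S z)}"
  have D: "bernoulli_signal N ?q a = map_pmf (\<lambda>z. idft2 N (y z)) ?M"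
    by (simp add: bernoulli_signal_def bernoulli_spectrum_def random_set_def pmf.map_comp o_def y_def)
  have "1 - \<alpha> \<le> measure_pmf.prob ?M ?G"
  proof (rule prob_recoverable)
    show "8 * real k \<le> \<alpha> * real B" using b(2) B(1) by simp
    show "S z \<subseteq> {p \<in> {..<N} \<times> {..<N}. z p \<and> a (fst p) (snd p) \<noteq> 0}" for z
      by (auto simp: S_def y_def split: if_splits)
  qed (use B alpha in auto)
  also have "\<dots> \<le> measure_pmf.prob (joint_outcome sparse_fft N k \<alpha> (1000 * B * (b + 1))
      (map_pmf (\<lambda>z. idft2 N (y z)) ?M)) {(x, es). represents N es (dft2 N x)}"
  proof (rule prob_joint_outcome_ge)
    show "wp N x sparse_fft (1000 * B * (b + 1)) (\<lambda>_. True) (init_state N k \<alpha>)" for x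
      using wp_sparse_fft[OF b B k, of x "\<lambda>_ _. 0"] by (rule wp_mono) auto
    fix z assume z: "z \<in> ?G"
    have "resolvable N B (y z) (S z)"
      unfolding resolvable_def
    proof (intro allI impI)
      fix c T assume T: "T \<subseteq> S z \<inter> bucket B c" "2 \<le> card T"
      have "bucket_sum N B (y z) T c = bucket_sum N B a T c"
      proof (rule bucket_sum_cong)
        fix p assume "p \<in> T"
        then have "p \<in> S z" using T(1) by auto
        then show "y z (fst p) (snd p) = a (fst p) (snd p)"
          by (auto simp: S_def y_def split: if_splits)
      qed
      moreover have "\<not> one_node (bucket_sum N B a T c)"
        using z T resolvable_def[of N B a "S z"] by blast
      ultimately show "\<not> one_node (bucket_sum N B (y z) T c)" by simp
    qed
    then show "wp N (idft2 N (y z)) sparse_fft (1000 * B * (b + 1))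
        (\<lambda>s. represents N (out s) (dft2 N (idft2 N (y z)))) (init_state N k \<alpha>)"
      using z
      by (intro wp_mono[OF wp_sparse_fft[OF b B k, of "idft2 N (y z)" "y z"]] represents_found)
        (auto simp: S_def)
  qed
  finally show ?thesis by (simp add: D)
qed

theorem theorem6:
  shows "\<exists>P :: com. \<forall>\<alpha> :: real. \<alpha> > 0 \<longrightarrow>
    (\<exists>c :: real. c > 0 \<and> (\<exists>C :: real.
      \<forall>(q :: nat) (N :: nat) (n :: nat) (k :: nat).
        N = 2 ^ q \<longrightarrow> n = N\<^sup>2 \<longrightarrow> 1 \<le> k \<longrightarrow> real k < c * sqrt (real n) \<longrightarrow>
        (\<exists>t :: nat.
          real t \<le> C * (real k * log 2 (real k + 1)) \<and>
          (\<forall>x. halts_within P N k \<alpha> x t \<and> uses_samples_within P N k \<alpha> x t (C * real k)) \<and>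
          (\<forall>a. measure_pmf.prob (joint_outcome P N k \<alpha> t (bernoulli_signal N (real k / real n) a))
                 {(x, es). represents N es (dft2 N x)} \<ge> 1 - \<alpha>))))"
proof (intro exI[of _ sparse_fft] allI impI)
  fix \<alpha> :: real assume \<alpha>: "\<alpha> > 0"
  \<comment> \<open>\<open>D\<close> bounds B / k: if \<open>b > 0\<close>, half of \<open>B\<close>
    was still too small, so B < 16 k / \<alpha>; if \<open>B = 1\<close>, the summand 1 suffices
    because k \<ge> 1.\<close>
  define D where "D = 16 / \<alpha> + 1"
  have D: "D \<ge> 1" using \<alpha> by (simp add: D_def)
  define C where "C = 1000 * D * (log 2 D + 2)"
  have logD: "log 2 D \<ge> 0" using D by simp
  show "\<exists>c>0. \<exists>C. \<forall>q N n k. N = 2 ^ q \<longrightarrow> n = N\<^sup>2 \<longrightarrow> 1 \<le> k \<longrightarrow> real k < c * sqrt (real n) \<longrightarrow>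
        (\<exists>t :: nat.
          real t \<le> C * (real k * log 2 (real k + 1)) \<and>
          (\<forall>x. halts_within sparse_fft N k \<alpha> x t \<and> uses_samples_within sparse_fft N k \<alpha> x t (C * real k)) \<and>
          (\<forall>a. measure_pmf.prob (joint_outcome sparse_fft N k \<alpha> t (bernoulli_signal N (real k / real n) a))
                 {(x, es). represents N es (dft2 N x)} \<ge> 1 - \<alpha>))"
  \<comment> \<open>With B \<le> D k this choice gives 4 B < N, hence the room
    \<open>2 * B \<le> N\<close> that the translated lines and the error bound use.\<close>
  proof (rule exI[of _ "1 / (4 * D)"], intro conjI exI[of _ C] allI impI)
    show "1 / (4 * D) > 0" using D by simp
    fix q N n k :: nat
    assume N: "N = 2 ^ q" and n: "n = N\<^sup>2" and k: "1 \<le> k" and kc: "real k < 1 / (4 * D) * sqrt (real n)"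
    have "sqrt (real n) = real N" by (simp add: n)
    then have kN: "4 * (D * real k) < real N" using kc D by (simp add: field_simps)
    have "real k \<le> D * real k" using mult_right_mono[OF D, of "real k"] by simp
    then have kle: "k \<le> N" using kN by linarith
    have N3: "3 < N" using kN \<open>real k \<le> D * real k\<close> k by linarith
    define b where "b = (LEAST b. \<not> \<alpha> * 2 ^ b < 8 * real k)"
    obtain b0 :: nat where "8 * real k / \<alpha> < 2 ^ b0"
      using real_arch_pow[of 2 "8 * real k / \<alpha>"] by auto
    then have "\<not> \<alpha> * 2 ^ b0 < 8 * real k" using \<alpha> by (simp add: field_simps)
    then have b: "\<not> \<alpha> * 2 ^ b < 8 * real k" unfolding b_def by (rule LeastI)
    have bmin: "\<alpha> * 2 ^ i < 8 * real k" if "i < b" for i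
      using not_less_Least that unfolding b_def by blast
    define B :: nat where "B = 2 ^ b"
    have BD: "real B \<le> D * real k"
    proof (cases b)
      case 0
      then have "real B \<le> real k" using k by (simp add: B_def)
      then show ?thesis using \<open>real k \<le> D * real k\<close> by linarith
    next
      case (Suc i)
      then have "\<alpha> * real B < 16 * real k" using bmin[of i] by (simp add: B_def)
      then have "real B < 16 / \<alpha> * real k" using \<alpha> by (simp add: field_simps)
      then show ?thesis by (simp add: D_def algebra_simps)
    qed
    have BN: "2 * B \<le> N" using BD kN by linarith
    have "B \<le> N" using BN by simp
    then have "b \<le> q" unfolding B_def N by simp
    then have BdN: "B dvd N" unfolding B_def N by (rule le_imp_power_dvd)
    define L where "L = log 2 (real k + 1)"
    have L: "L \<ge> 1" using k by (simp add: L_def)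
    \<comment> \<open>Since \<open>L \<ge> 1\<close>, additive constants in the logarithm of
      \<open>B\<close> become factors of \<open>L\<close>; for k = 1 this relies on the shifted
      argument k + 1.\<close>
    have b1: "real b + 1 \<le> (log 2 D + 2) * L"
    proof -
      have "real b = log 2 (real B)" by (simp add: B_def log_nat_power)
      also have "\<dots> \<le> log 2 (D * (real k + 1))"
      proof -
        have "real B \<le> D * (real k + 1)" using BD D by (simp add: algebra_simps)
        moreover have "real B > 0" by (simp add: B_def)
        ultimately show ?thesis by simp
      qed
      also have "\<dots> = log 2 D + L" using D k by (simp add: log_mult L_def)
      finally have "real b + 1 \<le> log 2 D * 1 + 2 * L" using L by simp
      also have "\<dots> \<le> log 2 D * L + 2 * L" using L logD by (intro add_mono mult_left_mono) auto
      finally show ?thesis by (simp add: algebra_simps)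
    qed
    let ?t = "1000 * B * (b + 1)"
    have "real ?t = 1000 * (real B * (real b + 1))" by (simp add: algebra_simps)
    also have "\<dots> \<le> 1000 * (D * real k * ((log 2 D + 2) * L))"
      using BD b1 D by (intro mult_left_mono mult_mono) auto
    also have "\<dots> = C * (real k * L)" by (simp add: C_def)
    finally have t: "real ?t \<le> C * (real k * log 2 (real k + 1))" by (simp add: L_def)
    have smp: "real (10 * B) \<le> C * real k"
    proof -
      have "real (10 * B) \<le> 10 * (D * real k)" using BD by simp
      also have "\<dots> \<le> 1000 * (log 2 D + 2) * (D * real k)"
        using logD D by (intro mult_right_mono) auto
      finally show ?thesis by (simp add: C_def mult_ac)
    qed
    have w: "wp N x sparse_fft ?t (\<lambda>s. real (samples s) \<le> C * real k) (init_state N k \<alpha>)" for x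
      using wp_sparse_fft[OF bmin b B_def BdN BN N3 kle, of x "\<lambda>_ _. 0"]
      by (rule wp_mono) (use smp in auto)
    have "1 - \<alpha> \<le> measure_pmf.prob (joint_outcome sparse_fft N k \<alpha> ?t
        (bernoulli_signal N (real k / real n) a)) {(x, es). represents N es (dft2 N x)}" for a
    \<comment> \<open>For \<alpha> \<ge> 1 the probability claim is void, but time and samples still
      have to be bounded; so the split comes only here.\<close>
    proof (cases "\<alpha> < 1")
      case True
      then show ?thesis
        using prob_success[OF \<alpha> True bmin b B_def BdN BN N3 kle, of a] by (simp add: n)
    next
      case False
      then have "1 - \<alpha> \<le> 0" by simp
      also have "0 \<le> measure_pmf.prob (joint_outcome sparse_fft N k \<alpha> ?t
        (bernoulli_signal N (real k / real n) a)) {(x, es). represents N es (dft2 N x)}"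
        by (rule measure_nonneg)
      finally show ?thesis .
    qed
    then show "\<exists>t :: nat.
          real t \<le> C * (real k * log 2 (real k + 1)) \<and>
          (\<forall>x. halts_within sparse_fft N k \<alpha> x t \<and> uses_samples_within sparse_fft N k \<alpha> x t (C * real k)) \<and>
          (\<forall>a. measure_pmf.prob (joint_outcome sparse_fft N k \<alpha> t (bernoulli_signal N (real k / real n) a))
                 {(x, es). represents N es (dft2 N x)} \<ge> 1 - \<alpha>)"
      using t halts_and_samples[OF w] by (intro exI[of _ ?t] conjI allI) blast+
  qed
qed

end
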